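(* Let $k$ be an algebraically closed field and let $X\subset \mathbb{P}^6_k$ be a general set of $22$ points (that is, $(P_1,\dots,P_{22})$ lies in a suitable nonempty Zariski open subset of $(\mathbb{P}^6_k)^{22}$ and $X=\{P_1,\dots,P_{22}\}$). Then no subset $Y\subset X$ of exactly $11$ points has the predicted subset resolution relative to $X$. In particular, it is not true that for every finite set $X$ of $d$ distinct points in a projective space and every integer $1\le e<d$ there is a subset of $X$ with exactly $e$ points having the predicted subset resolution relative to $X$.
   Context: Let $S=k[x_0,\dots,x_n]$ be the homogeneous coordinate ring of $\mathbb{P}^n_k$. For a finite set of points $W\subset\mathbb{P}^n_k$, $I(W)\subset S$ is its homogeneous ideal, $I(W)_t$ the degree $t$ part, and $h_W(t)=\dim_k (S/I(W))_t$ its Hilbert function. The Koszul maps of $W$ are $$d^W_{p,q}: \textstyle\bigwedge^p S_1\otimes_k I(W)_q \to \bigwedge^{p-1}S_1\otimes_k I(W)_{q+1},$$ $$d^W_{p,q}(l_1\wedge\dots\wedge l_p\otimes f)=\sum_{i=1}^p(-1)^{p-i}\, l_1\wedge\dots\wedge l_{i-1}\wedge l_{i+1}\wedge\dots\wedge l_p\otimes l_i f,$$ with $d^W_{0,q}$ the zero map. The exponent of $S(-(p+q))$ in the $p$-th free module $F_p$ of the minimal graded free resolution $\cdots\to F_1\to F_0\to I(W)\to 0$ equals $\dim_k(\ker d^W_{p,q}/\operatorname{im} d^W_{p+1,q-1})$. Definition (predicted subset resolution). Let $X\subset\mathbb{P}^n_k$ be a set of $d$ distinct points, let $1\le e<d$,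 and let $Y\subset X$ be a subset of exactly $e$ points. Say that $Y$ has the predicted subset resolution relative to $X$ if: (a) $h_Y(t)=\min\{h_X(t),e\}$ for all $t$; and (b) for every integer $m$ and every $i\ge 0$, $$\operatorname{rank} d^Y_{i+1,m-i-1}=\min\bigl\{\dim_k\textstyle\bigwedge^{i+1}S_1\otimes_k I(Y)_{m-i-1}-\dim_k\ker d^X_{i+1,m-i-1},\ \dim_k\ker d^Y_{i,m-i}\bigr\}.$$ (The right-hand side is always an upper bound for the rank, because $I(X)\subset I(Y)$ forces $\ker d^X_{i+1,m-i-1}\subset\ker d^Y_{i+1,m-i-1}$, and the maps form a complex.) *)

theory Defs
  imports
    "HOL-Library.Poly_Mapping"
    "HOL-Library.FuncSet"
    "HOL-Computational_Algebra.Polynomial"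
begin

section \<open>Polynomials\<close>

text \<open>Polynomials with variables indexed by \<open>'v\<close>; keys are the exponent vectors of monomials.\<close>

type_synonym ('v, 'k) mpoly = "('v \<Rightarrow>\<^sub>0 nat) \<Rightarrow>\<^sub>0 'k"

definition Const :: "'k::field \<Rightarrow> ('v, 'k) mpoly"
  where "Const c = Poly_Mapping.single 0 c"

definition Var :: "'v \<Rightarrow> ('v, 'k::field) mpoly"
  where "Var i = Poly_Mapping.single (Poly_Mapping.single i 1) 1"

definition eval :: "('v \<Rightarrow> 'k) \<Rightarrow> ('v, 'k::field) mpoly \<Rightarrow> 'k"
  where "eval v f = (\<Sum>m\<in>Poly_Mapping.keys f.
           Poly_Mapping.lookup f m * (\<Prod>i\<in>Poly_Mapping.keys m. v i ^ Poly_Mapping.lookup m i))"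

definition mdeg :: "('v \<Rightarrow>\<^sub>0 nat) \<Rightarrow> nat"
  where "mdeg m = (\<Sum>i\<in>Poly_Mapping.keys m. Poly_Mapping.lookup m i)"

text \<open>The ring \<open>S = k[x\<^sub>0, \<dots>, x\<^sub>n]\<close> and its graded pieces (zero in negative degrees).\<close>

definition polyS :: "nat \<Rightarrow> (nat, 'k::field) mpoly set"
  where "polyS n = {f. \<forall>m\<in>Poly_Mapping.keys f. Poly_Mapping.keys m \<subseteq> {..n}}"

definition polyS_deg :: "nat \<Rightarrow> int \<Rightarrow> (nat, 'k::field) mpoly set"
  where "polyS_deg n t = {f \<in> polyS n. \<forall>m\<in>Poly_Mapping.keys f. int (mdeg m) = t}"

definition pscale :: "'k::field \<Rightarrow> ('v, 'k) mpoly \<Rightarrow> ('v, 'k) mpoly"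
  where "pscale c f = Const c * f"

global_interpretation mpoly: vector_space "pscale :: 'k::field \<Rightarrow> ('v, 'k) mpoly \<Rightarrow> ('v, 'k) mpoly"
  by unfold_locales
    (simp_all add: pscale_def Const_def algebra_simps single_add mult_single flip: mult.assoc)

text \<open>
  The dimension of the quotient space \<open>V / U\<close>, as the least size of a subset of \<open>V\<close> whose cosets span \<open>V / U\<close>.
\<close>

definition quot_dim :: "('v, 'k::field) mpoly set \<Rightarrow> ('v, 'k) mpoly set \<Rightarrow> nat"
  where "quot_dim V U = (LEAST d. \<exists>B\<subseteq>V. finite B \<and> card B = d \<and> V \<subseteq> mpoly.span (U \<union> B))"

lemma quot_dim_eq:
  assumes "mpoly.subspace U" "mpoly.subspace V" "U \<subseteq> V" "finite T" "V \<subseteq> mpoly.span T"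
  shows "quot_dim V U = mpoly.dim V - mpoly.dim U"
proof -
  have fin: "finite B" if "mpoly.independent B" "B \<subseteq> V" for B
    using mpoly.independent_span_bound[OF assms(4) that(1)] that(2) assms(5) by blast
  obtain BU where BU: "BU \<subseteq> U" "mpoly.independent BU" "U \<subseteq> mpoly.span BU" "card BU = mpoly.dim U"
    using mpoly.basis_exists[of U] by blast
  have BUV: "BU \<subseteq> V" using BU(1) assms(3) by blast
  obtain BV where BV: "BU \<subseteq> BV" "BV \<subseteq> V" "mpoly.independent BV" "V \<subseteq> mpoly.span BV"
    using mpoly.maximal_independent_subset_extend[OF BUV BU(2)] by blast
  have finV: "finite BV" using fin BV by blast
  have cV: "card BV = mpoly.dim V"
    using BV mpoly.basis_card_eq_dim by blast
  show ?thesis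
    unfolding quot_dim_def
  proof (rule Least_equality)
    show "\<exists>B\<subseteq>V. finite B \<and> card B = mpoly.dim V - mpoly.dim U \<and> V \<subseteq> mpoly.span (U \<union> B)"
    proof (intro exI[of _ "BV - BU"] conjI)
      show "BV - BU \<subseteq> V" using BV by blast
      show "finite (BV - BU)" using finV by blast
      show "card (BV - BU) = mpoly.dim V - mpoly.dim U"
        using card_Diff_subset[of BU BV] finV BV(1) BU(4) cV finite_subset by metis
      have "BV \<subseteq> U \<union> (BV - BU)" using BU(1) by blast
      then show "V \<subseteq> mpoly.span (U \<union> (BV - BU))" using BV(4) mpoly.span_mono by blast
    qed
  next
    fix d
    assume "\<exists>B\<subseteq>V. finite B \<and> card B = d \<and> V \<subseteq> mpoly.span (U \<union> B)"
    then obtain B where B: "B \<subseteq> V" "finite B" "card B = d" "V \<subseteq> mpoly.span (U \<union> B)" by blast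
    have finU: "finite BU" using finV BV(1) finite_subset by blast
    have "U \<union> B \<subseteq> mpoly.span (BU \<union> B)"
      using BU(3) mpoly.span_mono[of BU "BU \<union> B"] mpoly.span_superset[of "BU \<union> B"] by blast
    then have "V \<subseteq> mpoly.span (BU \<union> B)"
      using B(4) mpoly.span_minimal mpoly.subspace_span by blast
    then have "mpoly.dim V \<le> card (BU \<union> B)"
      using mpoly.dim_le_card[of V "BU \<union> B"] finU B(2) by blast
    also have "\<dots> \<le> card BU + card B" by (rule card_Un_le)
    finally show "mpoly.dim V - mpoly.dim U \<le> d" using BU(4) B(3) by simp
  qed
qed

section \<open>Projective space\<close>

text \<open>
  A point of \<open>\<P>\<^sup>n\<close> is the set of all its homogeneous coordinate vectors; vectors are functions on
  \<open>nat\<close> that vanish beyond \<open>n\<close>.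
\<close>

definition proj_space :: "nat \<Rightarrow> (nat \<Rightarrow> 'k::field) set set"
  where "proj_space n =
    {v. (\<forall>i>n. v i = 0) \<and> (\<exists>i. v i \<noteq> 0)} // {(v, w). \<exists>c. c \<noteq> 0 \<and> w = (\<lambda>i. c * v i)}"

definition vanishes_at :: "(nat, 'k::field) mpoly \<Rightarrow> (nat \<Rightarrow> 'k) set \<Rightarrow> bool"
  where "vanishes_at f P \<longleftrightarrow> (\<forall>v\<in>P. eval v f = 0)"

text \<open>The homogeneous ideal of \<open>W\<close>, generated by the forms vanishing at every point of \<open>W\<close>.\<close>

definition ideal_of :: "nat \<Rightarrow> (nat \<Rightarrow> 'k::field) set set \<Rightarrow> (nat, 'k) mpoly set"
  where "ideal_of n W = {(\<Sum>j<r. g j * f j) | (r :: nat) g f.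
           \<forall>j<r. g j \<in> polyS n \<and> (\<exists>t. f j \<in> polyS_deg n t) \<and> (\<forall>P\<in>W. vanishes_at (f j) P)}"

definition ideal_deg :: "nat \<Rightarrow> (nat \<Rightarrow> 'k::field) set set \<Rightarrow> int \<Rightarrow> (nat, 'k) mpoly set"
  where "ideal_deg n W t = ideal_of n W \<inter> polyS_deg n t"

definition hilbert_fun :: "nat \<Rightarrow> (nat \<Rightarrow> 'k::field) set set \<Rightarrow> int \<Rightarrow> nat"
  where "hilbert_fun n W t = quot_dim (polyS_deg n t) (ideal_deg n W t)"

text \<open>
  The Zariski topology of \<open>(\<P>\<^sup>n)\<^sup>d\<close>: the variable \<open>(j, i)\<close> is the \<open>i\<close>-th homogeneous coordinate of the
  \<open>j\<close>-th point, and closed sets are the zero loci of sets of multihomogeneous polynomials.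
\<close>

definition multihomogeneous :: "nat \<Rightarrow> nat \<Rightarrow> (nat \<times> nat, 'k::field) mpoly \<Rightarrow> bool"
  where "multihomogeneous n d f \<longleftrightarrow>
    (\<forall>m\<in>Poly_Mapping.keys f. Poly_Mapping.keys m \<subseteq> {..<d} \<times> {..n}) \<and>
    (\<exists>e. \<forall>m\<in>Poly_Mapping.keys f. \<forall>j<d. (\<Sum>i\<le>n. Poly_Mapping.lookup m (j, i)) = e j)"

definition vanishes_at_tuple ::
    "nat \<Rightarrow> (nat \<times> nat, 'k::field) mpoly \<Rightarrow> (nat \<Rightarrow> (nat \<Rightarrow> 'k) set) \<Rightarrow> bool"
  where "vanishes_at_tuple d f P \<longleftrightarrow>
    (\<forall>v. (\<forall>j<d. v j \<in> P j) \<longrightarrow> eval (\<lambda>(j, i). v j i) f = 0)"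

definition zariski_open_tuples :: "nat \<Rightarrow> nat \<Rightarrow> (nat \<Rightarrow> (nat \<Rightarrow> 'k::field) set) set \<Rightarrow> bool"
  where "zariski_open_tuples n d U \<longleftrightarrow>
    (\<exists>F. (\<forall>f\<in>F. multihomogeneous n d f) \<and>
         U = {P \<in> {..<d} \<rightarrow>\<^sub>E proj_space n. \<not> (\<forall>f\<in>F. vanishes_at_tuple d f P)})"

section \<open>Koszul maps\<close>

text \<open>
  The space \<open>\<Lambda>\<^sup>p S\<^sub>1 \<otimes> M\<close> for \<open>M \<subseteq> S\<close> is modelled on the basis of \<open>\<Lambda>\<^sup>p S\<^sub>1\<close> given by
  \<open>x\<^sub>A = x\<^bsub>a(1)\<^esub> \<and> \<dots> \<and> x\<^bsub>a(p)\<^esub>\<close> for \<open>A = {a(1) < \<dots> < a(p)} \<subseteq> {0, \<dots>, n}\<close>: the element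
  \<open>Poly_Mapping.single A f\<close> stands for \<open>x\<^sub>A \<otimes> f\<close>.
\<close>

type_synonym 'k chain = "nat set \<Rightarrow>\<^sub>0 (nat, 'k) mpoly"

definition chains :: "nat \<Rightarrow> (nat \<Rightarrow> 'k::field) set set \<Rightarrow> nat \<Rightarrow> int \<Rightarrow> 'k chain set"
  where "chains n W p q = {u. \<forall>A\<in>Poly_Mapping.keys u.
           A \<subseteq> {..n} \<and> card A = p \<and> Poly_Mapping.lookup u A \<in> ideal_deg n W q}"

text \<open>If \<open>a = a(i)\<close> in \<open>A = {a(1) < \<dots> < a(p)}\<close>, then \<open>p - i\<close> is the number of \<open>b \<in> A\<close> with \<open>a < b\<close>.\<close>

definition koszul :: "'k::field chain \<Rightarrow> 'k chain"
  where "koszul u = (\<Sum>A\<in>Poly_Mapping.keys u. \<Sum>a\<in>A.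
           Poly_Mapping.single (A - {a})
             ((-1) ^ card {b \<in> A. a < b} * (Var a * Poly_Mapping.lookup u A)))"

definition cscale :: "'k::field \<Rightarrow> 'k chain \<Rightarrow> 'k chain"
  where "cscale c u = Poly_Mapping.map (pscale c) u"

lemma lookup_cscale: "Poly_Mapping.lookup (cscale c u) A = pscale c (Poly_Mapping.lookup u A)"
  by (simp add: cscale_def map.rep_eq when_def)

global_interpretation chain: vector_space "cscale :: 'k::field \<Rightarrow> 'k chain \<Rightarrow> 'k chain"
  by unfold_locales
    (auto intro!: poly_mapping_eqI simp: lookup_cscale lookup_add
       mpoly.scale_right_distrib mpoly.scale_left_distrib)

definition koszul_ker :: "nat \<Rightarrow> (nat \<Rightarrow> 'k::field) set set \<Rightarrow> nat \<Rightarrow> int \<Rightarrow> 'k chain set"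
  where "koszul_ker n W p q = {u \<in> chains n W p q. koszul u = 0}"

definition koszul_rank :: "nat \<Rightarrow> (nat \<Rightarrow> 'k::field) set set \<Rightarrow> nat \<Rightarrow> int \<Rightarrow> nat"
  where "koszul_rank n W p q = chain.dim (koszul ` chains n W p q)"

definition predicted_subset_resolution ::
    "nat \<Rightarrow> (nat \<Rightarrow> 'k::field) set set \<Rightarrow> (nat \<Rightarrow> 'k) set set \<Rightarrow> bool"
  where "predicted_subset_resolution n X Y \<longleftrightarrow>
    (\<forall>t. hilbert_fun n Y t = min (hilbert_fun n X t) (card Y)) \<and>
    (\<forall>(m :: int) (i :: nat).
       int (koszul_rank n Y (i + 1) (m - int i - 1)) =
       min (int (chain.dim (chains n Y (i + 1) (m - int i - 1)))
              - int (chain.dim (koszul_ker n X (i + 1) (m - int i - 1))))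
           (int (chain.dim (koszul_ker n Y i (m - int i)))))"

section \<open>The Koszul map on pure tensors\<close>

text \<open>
  Nothing below enters the definitions above. With \<open>wedge n l\<close> the left multiplication by the linear
  form \<open>l\<close>, so that \<open>pure_tensor n [l\<^sub>1, \<dots>, l\<^sub>p] f\<close> is \<open>l\<^sub>1 \<and> \<dots> \<and> l\<^sub>p \<otimes> f\<close>, the lemmas
  \<open>koszul_pure_tensor\<close>, \<open>wedge_wedge_self\<close> and \<open>pure_tensor_Var\<close> show that \<open>koszul\<close> is given by
  the coordinate-free formula
  \<open>l\<^sub>1 \<and> \<dots> \<and> l\<^sub>p \<otimes> f \<mapsto> \<Sum>\<^sub>i (-1)\<^bsup>p-i\<^esup> l\<^sub>1 \<and> \<dots> (omit l\<^sub>i) \<dots> \<and> l\<^sub>p \<otimes> l\<^sub>i f\<close>, that the wedge product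
  is alternating, and that \<open>x\<^sub>A \<otimes> f\<close> is represented by \<open>Poly_Mapping.single A f\<close>.
\<close>

definition wedge :: "nat \<Rightarrow> (nat, 'k::field) mpoly \<Rightarrow> 'k chain \<Rightarrow> 'k chain"
  where "wedge n l u = (\<Sum>A\<in>Poly_Mapping.keys u. \<Sum>i\<in>{..n} - A.
           Poly_Mapping.single (insert i A)
             ((-1) ^ card {b \<in> A. b < i} *
              (Const (Poly_Mapping.lookup l (Poly_Mapping.single i 1)) * Poly_Mapping.lookup u A)))"

definition pure_tensor :: "nat \<Rightarrow> (nat, 'k::field) mpoly list \<Rightarrow> (nat, 'k) mpoly \<Rightarrow> 'k chain"
  where "pure_tensor n ls f = foldr (wedge n) ls (Poly_Mapping.single {} f)"

lemma sum_keys_superset: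
  assumes "finite K" "Poly_Mapping.keys u \<subseteq> K" "\<And>A. \<phi> A 0 = 0"
  shows "(\<Sum>A\<in>Poly_Mapping.keys u. \<phi> A (Poly_Mapping.lookup u A)) =
         (\<Sum>A\<in>K. \<phi> A (Poly_Mapping.lookup u A))"
  using assms by (intro sum.mono_neutral_left) (auto simp: in_keys_iff)

lemma sum_keys_add:
  assumes "\<And>A f g. \<phi> A (f + g) = \<phi> A f + \<phi> A g" "\<And>A. \<phi> A 0 = (0::'b::comm_monoid_add)"
  shows "(\<Sum>A\<in>Poly_Mapping.keys (u + v). \<phi> A (Poly_Mapping.lookup (u + v) A)) =
         (\<Sum>A\<in>Poly_Mapping.keys u. \<phi> A (Poly_Mapping.lookup u A)) +
         (\<Sum>A\<in>Poly_Mapping.keys v. \<phi> A (Poly_Mapping.lookup v A))"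
proof -
  let ?K = "Poly_Mapping.keys u \<union> Poly_Mapping.keys v"
  have "Poly_Mapping.keys (u + v) \<subseteq> ?K" by (rule keys_add)
  then show ?thesis
    using sum_keys_superset[of ?K "u + v" \<phi>] sum_keys_superset[of ?K u \<phi>]
      sum_keys_superset[of ?K v \<phi>] assms
    by (simp add: lookup_add sum.distrib)
qed

lemma koszul_add: "koszul (u + v) = koszul u + koszul v"
  unfolding koszul_def
  by (rule sum_keys_add) (simp_all add: algebra_simps single_add sum.distrib)

lemma koszul_single: "koszul (Poly_Mapping.single A f) =
    (\<Sum>a\<in>A. Poly_Mapping.single (A - {a}) ((-1) ^ card {b \<in> A. a < b} * (Var a * f)))"
  by (cases "f = 0") (simp_all add: koszul_def)

lemma wedge_add: "wedge n l (u + v) = wedge n l u + wedge n l v"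
  unfolding wedge_def
  by (rule sum_keys_add) (simp_all add: algebra_simps single_add sum.distrib)

lemma wedge_single: "wedge n l (Poly_Mapping.single A f) =
    (\<Sum>i\<in>{..n} - A. Poly_Mapping.single (insert i A)
       ((-1) ^ card {b \<in> A. b < i} * (Const (Poly_Mapping.lookup l (Poly_Mapping.single i 1)) * f)))"
  by (cases "f = 0") (simp_all add: wedge_def)

lemma koszul_0 [simp]: "koszul 0 = 0" and wedge_0 [simp]: "wedge n l 0 = 0"
  by (simp_all add: koszul_def wedge_def)

lemma koszul_sum: "koszul (sum h I) = (\<Sum>i\<in>I. koszul (h i))"
  by (induction I rule: infinite_finite_induct) (simp_all add: koszul_add)

lemma wedge_sum: "wedge n l (sum h I) = (\<Sum>i\<in>I. wedge n l (h i))"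
  by (induction I rule: infinite_finite_induct) (simp_all add: wedge_add)

lemma single_sum: "Poly_Mapping.single k (sum h I) = (\<Sum>i\<in>I. Poly_Mapping.single k (h i))"
  by (induction I rule: infinite_finite_induct) (simp_all add: single_add)

lemma chain_eq_sum: "u = (\<Sum>A\<in>Poly_Mapping.keys u. Poly_Mapping.single A (Poly_Mapping.lookup u A))"
  by (rule poly_mapping_eqI)
    (simp add: lookup_sum lookup_single when_def not_in_keys_iff_lookup_eq_zero)

definition basis_wedge :: "nat \<Rightarrow> nat set \<Rightarrow> (nat, 'k::field) mpoly \<Rightarrow> 'k chain"
  where "basis_wedge i A f =
    (if i \<in> A then 0 else Poly_Mapping.single (insert i A) ((-1) ^ card {b \<in> A. b < i} * f))"

lemma wedge_single': "wedge n l (Poly_Mapping.single A f) =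
    (\<Sum>i\<le>n. basis_wedge i A (Const (Poly_Mapping.lookup l (Poly_Mapping.single i 1)) * f))"
proof -
  have "(\<Sum>i\<le>n. basis_wedge i A (Const (Poly_Mapping.lookup l (Poly_Mapping.single i 1)) * f)) =
        (\<Sum>i\<in>{..n} - A. basis_wedge i A (Const (Poly_Mapping.lookup l (Poly_Mapping.single i 1)) * f))"
    by (rule sum.mono_neutral_right) (auto simp: basis_wedge_def)
  then show ?thesis by (simp add: wedge_single basis_wedge_def)
qed

lemma card_split:
  assumes "finite (A :: nat set)"
  shows "card {b \<in> A. b < i} + card {b \<in> A. i < b} = card (A - {i})"
proof -
  have "A - {i} = {b \<in> A. b < i} \<union> {b \<in> A. i < b}" by auto
  moreover have "card ({b \<in> A. b < i} \<union> {b \<in> A. i < b}) = card {b \<in> A. b < i} + card {b \<in> A. i < b}"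
    using assms by (intro card_Un_disjoint) auto
  ultimately show ?thesis by simp
qed

lemma sign_swap:
  assumes A: "finite (A :: nat set)" and i: "i \<notin> A" and a: "a \<in> A"
  shows "(-1) ^ card {b \<in> insert i A. a < b} * (-1) ^ card {b \<in> A. b < i} =
         ((-1) ^ card {b \<in> A - {a}. b < i} * (-1) ^ card {b \<in> A. a < b} :: 'r::comm_ring_1)"
proof (cases "a < i")
  case True
  then have 1: "{b \<in> insert i A. a < b} = insert i {b \<in> A. a < b}"
    and 2: "{b \<in> A. b < i} = insert a {b \<in> A - {a}. b < i}"
    using a by auto
  have 3: "card {b \<in> insert i A. a < b} = Suc (card {b \<in> A. a < b})"
    unfolding 1 using A i by (subst card_insert_disjoint) auto
  have 4: "card {b \<in> A. b < i} = Suc (card {b \<in> A - {a}. b < i})"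
    unfolding 2 using A by (subst card_insert_disjoint) auto
  show ?thesis unfolding 3 4 by simp
next
  case False
  then have 1: "{b \<in> insert i A. a < b} = {b \<in> A. a < b}"
    and 2: "{b \<in> A. b < i} = {b \<in> A - {a}. b < i}"
    by auto
  show ?thesis unfolding 1 2 by simp
qed

lemma koszul_basis_wedge:
  assumes A: "finite A"
  shows "koszul (basis_wedge i A g) = Poly_Mapping.single A ((-1) ^ card A * (Var i * g)) +
           (\<Sum>a\<in>A. basis_wedge i (A - {a}) ((-1) ^ card {b \<in> A. a < b} * (Var a * g)))"
proof (cases "i \<in> A")
  case False
  have i: "card {b \<in> A. b < i} + card {b \<in> A. i < b} = card A"
    using card_split[OF A, of i] False by simp
  have ii: "{b \<in> insert i A. i < b} = {b \<in> A. i < b}" by auto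
  have first: "Poly_Mapping.single (insert i A - {i}) ((-1) ^ card {b \<in> insert i A. i < b} *
      (Var i * ((-1) ^ card {b \<in> A. b < i} * g))) = Poly_Mapping.single A ((-1) ^ card A * (Var i * g))"
    unfolding ii i[symmetric] using False by (simp add: power_add mult_ac)
  have rest: "Poly_Mapping.single (insert i A - {a}) ((-1) ^ card {b \<in> insert i A. a < b} *
      (Var a * ((-1) ^ card {b \<in> A. b < i} * g))) =
      basis_wedge i (A - {a}) ((-1) ^ card {b \<in> A. a < b} * (Var a * g))" if a: "a \<in> A" for a
  proof -
    have ne: "i \<noteq> a" using a False by auto
    have e: "insert i A - {a} = insert i (A - {a})" using ne by auto
    have "(-1) ^ card {b \<in> insert i A. a < b} * (Var a * ((-1) ^ card {b \<in> A. b < i} * g)) =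
       ((-1) ^ card {b \<in> insert i A. a < b} * (-1) ^ card {b \<in> A. b < i}) * (Var a * g)"
      by (simp add: mult_ac)
    also have "\<dots> = ((-1) ^ card {b \<in> A - {a}. b < i} * (-1) ^ card {b \<in> A. a < b}) * (Var a * g)"
      by (subst sign_swap[OF A False a]) simp
    also have "\<dots> = (-1) ^ card {b \<in> A - {a}. b < i} * ((-1) ^ card {b \<in> A. a < b} * (Var a * g))"
      by (simp add: mult_ac)
    finally show ?thesis using False by (simp only: e basis_wedge_def) simp
  qed
  have "koszul (basis_wedge i A g) = (\<Sum>a\<in>insert i A. Poly_Mapping.single (insert i A - {a})
     ((-1) ^ card {b \<in> insert i A. a < b} * (Var a * ((-1) ^ card {b \<in> A. b < i} * g))))"
    using False by (simp add: basis_wedge_def koszul_single)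
  also have "\<dots> = Poly_Mapping.single A ((-1) ^ card A * (Var i * g)) +
           (\<Sum>a\<in>A. basis_wedge i (A - {a}) ((-1) ^ card {b \<in> A. a < b} * (Var a * g)))"
    by (subst sum.insert[OF A False]) (simp only: first rest cong: sum.cong)
  finally show ?thesis .
next
  case True
  have i: "card {b \<in> A - {i}. b < i} + card {b \<in> A. i < b} = card A - 1"
  proof -
    have "{b \<in> A - {i}. b < i} = {b \<in> A. b < i}" by auto
    then show ?thesis using card_split[OF A, of i] True A by simp
  qed
  have c: "card A = Suc (card A - 1)"
    using True A by (metis Suc_pred' card_gt_0_iff empty_iff)
  have "(\<Sum>a\<in>A. basis_wedge i (A - {a}) ((-1) ^ card {b \<in> A. a < b} * (Var a * g))) =
      (\<Sum>a\<in>{i}. basis_wedge i (A - {a}) ((-1) ^ card {b \<in> A. a < b} * (Var a * g)))"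
    using A True by (intro sum.mono_neutral_right) (auto simp: basis_wedge_def)
  also have "\<dots> = Poly_Mapping.single A
      ((-1) ^ (card {b \<in> A - {i}. b < i} + card {b \<in> A. i < b}) * (Var i * g))"
    using True by (simp add: basis_wedge_def insert_absorb power_add mult_ac)
  also have "\<dots> = Poly_Mapping.single A (- ((-1) ^ card A * (Var i * g)))"
    unfolding i by (subst (2) c) simp
  finally show ?thesis
    using True by (simp add: basis_wedge_def flip: single_add)
qed

lemma linear_form_eq:
  assumes l: "l \<in> polyS_deg n 1"
  shows "l = (\<Sum>i\<le>n. Const (Poly_Mapping.lookup l (Poly_Mapping.single i 1)) * Var i)"
proof (rule poly_mapping_eqI)
  fix m
  have inj: "Poly_Mapping.single i (1::nat) = Poly_Mapping.single j 1 \<longleftrightarrow> i = j" for i j :: nat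
    by (metis lookup_single_eq lookup_single_not_eq one_neq_zero)
  have eq: "Poly_Mapping.lookup (\<Sum>i\<le>n. Const (Poly_Mapping.lookup l (Poly_Mapping.single i 1)) * Var i) m
    = (\<Sum>i\<le>n. Poly_Mapping.lookup l (Poly_Mapping.single i 1) when Poly_Mapping.single i 1 = m)"
    by (simp add: lookup_sum Const_def Var_def mult_single lookup_single)
  show "Poly_Mapping.lookup l m =
    Poly_Mapping.lookup (\<Sum>i\<le>n. Const (Poly_Mapping.lookup l (Poly_Mapping.single i 1)) * Var i) m"
  proof (cases "\<exists>i\<le>n. m = Poly_Mapping.single i 1")
    case True
    then obtain i where i: "i \<le> n" "m = Poly_Mapping.single i 1" by blast
    have "Poly_Mapping.single j 1 = m \<longleftrightarrow> j = i" for j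
      unfolding i(2) by (rule inj)
    then show ?thesis unfolding eq using i by (simp add: when_def)
  next
    case False
    have "m \<notin> Poly_Mapping.keys l"
    proof
      assume m: "m \<in> Poly_Mapping.keys l"
      then have mn: "Poly_Mapping.keys m \<subseteq> {..n}" and md: "mdeg m = 1"
        using l by (auto simp: polyS_deg_def polyS_def)
      from md have "\<exists>i\<in>Poly_Mapping.keys m. Poly_Mapping.lookup m i = 1 \<and>
          (\<forall>j\<in>Poly_Mapping.keys m. i \<noteq> j \<longrightarrow> Poly_Mapping.lookup m j = 0)"
        unfolding mdeg_def using sum_eq_1_iff[OF finite_keys] by blast
      then obtain i where i: "i \<in> Poly_Mapping.keys m" "Poly_Mapping.lookup m i = 1"
          "\<And>j. j \<in> Poly_Mapping.keys m \<Longrightarrow> i \<noteq> j \<Longrightarrow> Poly_Mapping.lookup m j = 0" by blast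
      have "m = Poly_Mapping.single i 1"
      proof (rule poly_mapping_eqI)
        fix j show "Poly_Mapping.lookup m j = Poly_Mapping.lookup (Poly_Mapping.single i 1) j"
          using i by (cases "j = i") (auto simp: lookup_single when_def in_keys_iff)
      qed
      with False mn i(1) show False by auto
    qed
    moreover have "(\<Sum>i\<le>n. Poly_Mapping.lookup l (Poly_Mapping.single i 1)
        when Poly_Mapping.single i 1 = m) = 0"
      using False by (intro sum.neutral) (auto simp: when_def)
    ultimately show ?thesis unfolding eq by (simp add: in_keys_iff)
  qed
qed

lemma koszul_wedge_single:
  assumes A: "finite A" and l: "l \<in> polyS_deg n 1"
  shows "koszul (wedge n l (Poly_Mapping.single A f)) =
    Poly_Mapping.single A ((-1) ^ card A * (l * f)) + wedge n l (koszul (Poly_Mapping.single A f))"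
proof -
  let ?c = "\<lambda>i. Const (Poly_Mapping.lookup l (Poly_Mapping.single i 1))"
  have "koszul (wedge n l (Poly_Mapping.single A f)) =
     (\<Sum>i\<le>n. Poly_Mapping.single A ((-1) ^ card A * (Var i * (?c i * f)))) +
     (\<Sum>i\<le>n. \<Sum>a\<in>A. basis_wedge i (A - {a}) ((-1) ^ card {b \<in> A. a < b} * (Var a * (?c i * f))))"
    unfolding wedge_single' koszul_sum koszul_basis_wedge[OF A] sum.distrib ..
  also have "(\<Sum>i\<le>n. Poly_Mapping.single A ((-1) ^ card A * (Var i * (?c i * f)))) =
     Poly_Mapping.single A ((-1) ^ card A * ((\<Sum>i\<le>n. ?c i * Var i) * f))"
    unfolding single_sum[symmetric] by (simp add: sum_distrib_left sum_distrib_right mult_ac)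
  also have "(\<Sum>i\<le>n. ?c i * Var i) = l" using linear_form_eq[OF l] by simp
  also have "(\<Sum>i\<le>n. \<Sum>a\<in>A. basis_wedge i (A - {a})
      ((-1) ^ card {b \<in> A. a < b} * (Var a * (?c i * f)))) =
     wedge n l (koszul (Poly_Mapping.single A f))"
    unfolding koszul_single wedge_sum wedge_single'
    by (subst sum.swap) (simp add: mult_ac)
  finally show ?thesis .
qed

lemma keys_wedge:
  assumes "\<And>A. A \<in> Poly_Mapping.keys u \<Longrightarrow> A \<subseteq> {..n} \<and> card A = p"
    and "A \<in> Poly_Mapping.keys (wedge n l u)"
  shows "A \<subseteq> {..n} \<and> card A = Suc p"
proof -
  from assms(2) have "Poly_Mapping.lookup (wedge n l u) A \<noteq> 0" by (simp add: in_keys_iff)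
  then obtain B i where B: "B \<in> Poly_Mapping.keys u" "i \<in> {..n} - B" "A = insert i B"
    unfolding wedge_def lookup_sum
    by (metis (no_types, lifting) sum.neutral lookup_single_not_eq)
  moreover have "finite B" using assms(1)[OF B(1)] finite_subset by blast
  ultimately show ?thesis using assms(1)[OF B(1)] by auto
qed

lemma keys_pure_tensor:
  "A \<in> Poly_Mapping.keys (pure_tensor n ls f) \<Longrightarrow> A \<subseteq> {..n} \<and> card A = length ls"
proof (induction ls arbitrary: A)
  case Nil
  then show ?case by (auto simp: pure_tensor_def split: if_splits)
next
  case (Cons l ls)
  then show ?case
    using keys_wedge[of "pure_tensor n ls f" n "length ls" A l] by (simp add: pure_tensor_def)
qed

definition pmult :: "(nat, 'k::field) mpoly \<Rightarrow> 'k chain \<Rightarrow> 'k chain"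
  where "pmult g u = (\<Sum>A\<in>Poly_Mapping.keys u. Poly_Mapping.single A (g * Poly_Mapping.lookup u A))"

lemma pmult_add: "pmult g (u + v) = pmult g u + pmult g v"
  unfolding pmult_def by (rule sum_keys_add) (simp_all add: algebra_simps single_add)

lemma pmult_single: "pmult g (Poly_Mapping.single A f) = Poly_Mapping.single A (g * f)"
  by (cases "f = 0") (simp_all add: pmult_def)

lemma pmult_sum: "pmult g (sum h I) = (\<Sum>i\<in>I. pmult g (h i))"
  by (induction I rule: infinite_finite_induct) (simp_all add: pmult_add, simp_all add: pmult_def)

lemma pmult_wedge: "pmult g (wedge n l u) = wedge n l (pmult g u)"
proof -
  have "pmult g (wedge n l (Poly_Mapping.single A f)) = wedge n l (pmult g (Poly_Mapping.single A f))"
    for A f by (simp add: wedge_single pmult_single pmult_sum mult_ac)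
  then show ?thesis
    by (subst (1 2) chain_eq_sum) (simp add: pmult_sum wedge_sum)
qed

lemma pmult_pure_tensor: "pmult g (pure_tensor n ls f) = pure_tensor n ls (g * f)"
  by (induction ls) (simp_all add: pure_tensor_def pmult_single pmult_wedge)

lemma koszul_wedge:
  assumes "\<And>A. A \<in> Poly_Mapping.keys u \<Longrightarrow> A \<subseteq> {..n} \<and> card A = p" and l: "l \<in> polyS_deg n 1"
  shows "koszul (wedge n l u) = pmult ((-1) ^ p * l) u + wedge n l (koszul u)"
proof -
  let ?s = "\<lambda>A. Poly_Mapping.single A (Poly_Mapping.lookup u A)"
  have "koszul (wedge n l u) = (\<Sum>A\<in>Poly_Mapping.keys u. koszul (wedge n l (?s A)))"
    by (subst chain_eq_sum[of u]) (simp add: koszul_sum wedge_sum)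
  also have "\<dots> = (\<Sum>A\<in>Poly_Mapping.keys u. pmult ((-1) ^ p * l) (?s A) + wedge n l (koszul (?s A)))"
  proof (rule sum.cong[OF refl])
    fix A assume "A \<in> Poly_Mapping.keys u"
    then have "finite A" "card A = p" using assms(1) finite_subset[of A "{..n}"] by auto
    then show "koszul (wedge n l (?s A)) = pmult ((-1) ^ p * l) (?s A) + wedge n l (koszul (?s A))"
      by (simp add: koszul_wedge_single[OF _ l] pmult_single mult_ac)
  qed
  also have "\<dots> = pmult ((-1) ^ p * l) (sum ?s (Poly_Mapping.keys u)) +
      wedge n l (koszul (sum ?s (Poly_Mapping.keys u)))"
    by (simp add: sum.distrib pmult_sum koszul_sum wedge_sum)
  also have "sum ?s (Poly_Mapping.keys u) = u" by (rule chain_eq_sum[symmetric])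
  finally show ?thesis .
qed

lemma koszul_pure_tensor:
  assumes "set ls \<subseteq> polyS_deg n 1"
  shows "koszul (pure_tensor n ls f) = (\<Sum>i<length ls.
           pure_tensor n (take i ls @ drop (Suc i) ls) ((-1) ^ (length ls - Suc i) * (ls ! i * f)))"
  using assms
proof (induction ls)
  case Nil
  then show ?case by (simp add: pure_tensor_def koszul_single)
next
  case (Cons l ls)
  have P: "pure_tensor n (l # xs) g = wedge n l (pure_tensor n xs g)" for xs g
    by (simp add: pure_tensor_def)
  have "koszul (pure_tensor n (l # ls) f) =
      pure_tensor n ls ((-1) ^ length ls * (l * f)) + wedge n l (koszul (pure_tensor n ls f))"
    unfolding P using Cons.prems
    by (subst koszul_wedge[OF keys_pure_tensor]) (auto simp: pmult_pure_tensor mult_ac)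
  also have "wedge n l (koszul (pure_tensor n ls f)) = (\<Sum>i<length ls. pure_tensor n
      (l # (take i ls @ drop (Suc i) ls)) ((-1) ^ (length ls - Suc i) * (ls ! i * f)))"
    using Cons by (simp add: wedge_sum P)
  finally show ?case by (simp add: sum.lessThan_Suc_shift del: sum.lessThan_Suc)
qed

lemma sum_alternating:
  fixes T :: "'i \<Rightarrow> 'i \<Rightarrow> 'b::ab_group_add"
  assumes "finite I"
    and "\<And>i. i \<in> I \<Longrightarrow> T i i = 0" and "\<And>i j. i \<in> I \<Longrightarrow> j \<in> I \<Longrightarrow> i \<noteq> j \<Longrightarrow> T i j + T j i = 0"
  shows "(\<Sum>i\<in>I. \<Sum>j\<in>I. T i j) = 0"
  using assms
proof (induction I rule: finite_induct)
  case (insert x I)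
  have "(\<Sum>i\<in>insert x I. \<Sum>j\<in>insert x I. T i j) =
      T x x + (\<Sum>j\<in>I. T x j + T j x) + (\<Sum>i\<in>I. \<Sum>j\<in>I. T i j)"
    using insert.hyps by (simp add: sum.distrib add_ac)
  moreover have "(\<Sum>j\<in>I. T x j + T j x) = 0"
    using insert.hyps insert.prems by (intro sum.neutral) auto
  ultimately show ?case using insert by simp
qed simp

lemma sign_insert:
  assumes "finite (A :: nat set)" "i \<notin> A" "j \<notin> A" "i \<noteq> j"
  shows "(-1) ^ card {b \<in> insert i A. b < j} * (-1) ^ card {b \<in> A. b < i} +
         (-1) ^ card {b \<in> insert j A. b < i} * (-1) ^ card {b \<in> A. b < j} = (0 :: 'r::comm_ring_1)"
proof -
  have *: "(-1) ^ card {b \<in> insert i A. b < j} * (-1) ^ card {b \<in> A. b < i} +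
      (-1) ^ card {b \<in> insert j A. b < i} * (-1) ^ card {b \<in> A. b < j} = (0 :: 'r)"
    if "i < j" "i \<notin> A" for i j
  proof -
    have 1: "{b \<in> insert i A. b < j} = insert i {b \<in> A. b < j}"
      and 2: "{b \<in> insert j A. b < i} = {b \<in> A. b < i}"
      using that by auto
    have 3: "card {b \<in> insert i A. b < j} = Suc (card {b \<in> A. b < j})"
      unfolding 1 using assms(1) that by (subst card_insert_disjoint) auto
    show ?thesis unfolding 3 2 by simp
  qed
  show ?thesis
    using *[of i j] *[of j i] assms by (cases "i < j") (simp_all add: add.commute)
qed

lemma wedge_wedge_single:
  assumes A: "finite A"
  shows "wedge n l (wedge n l (Poly_Mapping.single A f)) = 0"
proof -
  let ?c = "\<lambda>i. Const (Poly_Mapping.lookup l (Poly_Mapping.single i 1))"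
  let ?T = "\<lambda>i j. basis_wedge j (insert i A) (?c j * ((-1) ^ card {b \<in> A. b < i} * (?c i * f)))"
  have "wedge n l (wedge n l (Poly_Mapping.single A f)) = (\<Sum>i\<in>{..n} - A. \<Sum>j\<le>n. ?T i j)"
    by (subst wedge_single) (simp only: wedge_sum wedge_single')
  also have "\<dots> = (\<Sum>i\<in>{..n} - A. \<Sum>j\<in>{..n} - A. ?T i j)"
    by (intro sum.cong refl sum.mono_neutral_right) (auto simp: basis_wedge_def)
  also have "\<dots> = 0"
  proof (rule sum_alternating)
    fix i j assume ij: "i \<in> {..n} - A" "j \<in> {..n} - A" "i \<noteq> j"
    have "?T i j + ?T j i = Poly_Mapping.single (insert i (insert j A))
       (((-1) ^ card {b \<in> insert i A. b < j} * (-1) ^ card {b \<in> A. b < i} +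
         (-1) ^ card {b \<in> insert j A. b < i} * (-1) ^ card {b \<in> A. b < j}) * (?c i * ?c j * f))"
      using ij by (simp add: basis_wedge_def insert_commute algebra_simps flip: single_add)
    also have "\<dots> = 0"
      by (subst sign_insert) (use A ij in auto)
    finally show "?T i j + ?T j i = 0" .
  qed (auto simp: basis_wedge_def)
  finally show ?thesis .
qed

lemma wedge_wedge_self:
  assumes "\<And>A. A \<in> Poly_Mapping.keys u \<Longrightarrow> finite A"
  shows "wedge n l (wedge n l u) = 0"
  by (subst chain_eq_sum[of u]) (simp add: wedge_sum wedge_wedge_single assms)

lemma wedge_Var:
  assumes "a \<le> n" "finite A" "\<And>b. b \<in> A \<Longrightarrow> a < b"
  shows "wedge n (Var a) (Poly_Mapping.single A f) = Poly_Mapping.single (insert a A) f"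
proof -
  have inj: "Poly_Mapping.single i (1::nat) = Poly_Mapping.single j 1 \<longleftrightarrow> i = j" for i j :: nat
    by (metis lookup_single_eq lookup_single_not_eq one_neq_zero)
  have c: "Const (Poly_Mapping.lookup (Var a) (Poly_Mapping.single i 1)) = (if i = a then 1 else 0)"
    for i
    unfolding Var_def lookup_single inj by (simp add: Const_def when_def)
  have a: "a \<in> {..n} - A" using assms by auto
  have e: "{b \<in> A. b < a} = {}" using assms(3) by fastforce
  have "wedge n (Var a) (Poly_Mapping.single A f) = (\<Sum>i\<in>{a}. Poly_Mapping.single (insert i A)
       ((-1) ^ card {b \<in> A. b < i} * ((if i = a then 1 else 0) * f)))"
    unfolding wedge_single c using a by (intro sum.mono_neutral_right) auto
  then show ?thesis by (simp only: sum.insert finite.emptyI empty_iff not_False_eq_True sum.empty e) simp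
qed

lemma pure_tensor_Var:
  assumes "A \<subseteq> {..n}"
  shows "pure_tensor n (map Var (sorted_list_of_set A)) f = Poly_Mapping.single A f"
proof -
  have *: "pure_tensor n (map Var xs) f = Poly_Mapping.single (set xs) f"
    if "sorted_wrt (<) xs" "set xs \<subseteq> {..n}" for xs
    using that
  proof (induction xs)
    case Nil
    then show ?case by (simp add: pure_tensor_def)
  next
    case (Cons a xs)
    then show ?case using wedge_Var[of a n "set xs" f] by (simp add: pure_tensor_def)
  qed
  have "finite A" using assms finite_subset by blast
  then show ?thesis using *[of "sorted_list_of_set A"] assms by simp
qed

end

(*
  For 11 points Y in a general set X of 22 points, the prediction for i = 2, m = 5 says that
  d_{3,2} : /\^3 S_1 (x) I(Y)_2 -> /\^2 S_1 (x) I(Y)_3 has full rank relative to X. As ker d^X_{3,2} = 0 for general X,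
  this means that d_{3,2} is injective or maps onto ker d^Y_{2,3}; both fail.

  It is not injective by a count of dimensions: the image of /\^4 S_1 (x) S_1 in /\^3 S_1 (x) S_2 has dimension 224, and
  vanishing at a point imposes at most 20 conditions on its elements, as their contraction with the point is zero.

  It is not onto: split Y into a basis p_k (7 points) and 4 points q_a. As there are 6 pairs of the q_a, some nonzero
  diagonal form with coefficients c_k in this basis makes the q_a orthogonal; for general points all c_k and all norms
  d_a of the q_a are nonzero. Let r_k be the projection of p_k to the orthogonal complement of the q_a, which is
  three-dimensional with a basis b_0, b_1, b_2. Every quadric F satisfies
  sum_k (F(p_k) - F(r_k)) / c_k = sum_a F(q_a) / d_a. For h in /\^3 S_1 (x) S_2 with dh = 0, the quadric
  F = h(b_0, b_1, b_2) vanishes at all r_k. Now let w be the product of a quadric through the points of Y other than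
  q_a with a trivector that vanishes on all the q_b and not on (b_0, b_1, b_2): then dw vanishes on Y, and if
  dw = du with u vanishing on Y, the identity for h = w - u fails in the single term at q_a.
*)
theory Submission
  imports Defs
begin

section \<open>Evaluation of polynomials\<close>

text \<open>Generality is reduced to linear algebra. Each condition on the points says that a linear
  system, with entries multihomogeneous in the points, has only the zero solution. One witness then
  proves it for general points: elimination at the witness yields pivots whose product is nonzero
  there. Different conditions may have different witnesses, as finitely many nonempty open sets
  meet. The obstacle is that c_k and d_a are rational, not polynomial, in the points. They are
  therefore encoded by linear forms: L_k is c_k times the k-th coordinate in the basis p_k, and L_a
  is the form paired with q_a, tied by L_k(q_a) = L_a(p_k). That c_k or d_a is nonzero follows once
  one more equation leaves only the zero solution. The numbers fit as follows: 22 = 28 - 6 counts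
  the monomials of degree 2 other than the products of two consecutive variables, one for each point
  of a witness; 11 = 7 + 4 with 4 choose 2 = 6 < 7; the orthogonal complement has dimension 7 - 4 =
  3, the degree of the exterior power; and 11 times 20 is 220 < 224.\<close>

lemma infinite_alg_closed_field: "infinite (UNIV :: 'k::alg_closed_field set)"
proof
  assume fin: "finite (UNIV :: 'k set)"
  \<comment> \<open>Over a finite field \<open>p\<close> vanishes everywhere, so
    \<open>p + 1\<close> would have positive degree and no root.\<close>
  define p :: "'k poly" where "p = (\<Prod>a\<in>UNIV. [:- a, 1:])"
  have deg: "degree p = card (UNIV :: 'k set)"
    unfolding p_def by (subst degree_prod_eq_sum_degree) auto
  have "degree (p + 1) = degree p"
    using deg fin by (intro degree_add_eq_left) (auto simp: card_gt_0_iff)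
  then have "degree (p + 1) > 0" using deg fin by (simp add: card_gt_0_iff)
  then obtain x where "poly (p + 1) x = 0" using alg_closed_imp_poly_has_root by blast
  moreover have "poly p x = 0" unfolding p_def poly_prod using fin by (auto intro!: prod_zero)
  ultimately show False by simp
qed

definition monom_val :: "('v \<Rightarrow> 'k) \<Rightarrow> ('v \<Rightarrow>\<^sub>0 nat) \<Rightarrow> 'k::field"
  where "monom_val v m = (\<Prod>i\<in>Poly_Mapping.keys m. v i ^ Poly_Mapping.lookup m i)"

lemma monom_val_superset:
  assumes "finite K" "Poly_Mapping.keys m \<subseteq> K"
  shows "monom_val v m = (\<Prod>i\<in>K. v i ^ Poly_Mapping.lookup m i)"
  unfolding monom_val_def using assms
  by (intro prod.mono_neutral_left) (auto simp: not_in_keys_iff_lookup_eq_zero)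

lemma monom_val_add: "monom_val v (m + m') = monom_val v m * monom_val v m'"
proof -
  let ?K = "Poly_Mapping.keys m \<union> Poly_Mapping.keys m'"
  have "Poly_Mapping.keys (m + m') \<subseteq> ?K" by (rule keys_add)
  then show ?thesis
    by (simp add: monom_val_superset[of ?K] lookup_add power_add prod.distrib)
qed

lemma monom_val_0 [simp]: "monom_val v 0 = 1"
  by (simp add: monom_val_def)

lemma monom_val_single [simp]: "monom_val v (Poly_Mapping.single i k) = v i ^ k"
  by (cases "k = 0") (simp_all add: monom_val_def)

lemma eval_eq: "eval v f = (\<Sum>m\<in>Poly_Mapping.keys f. Poly_Mapping.lookup f m * monom_val v m)"
  by (simp add: eval_def monom_val_def)

lemma eval_superset:
  assumes "finite K" "Poly_Mapping.keys f \<subseteq> K"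
  shows "eval v f = (\<Sum>m\<in>K. Poly_Mapping.lookup f m * monom_val v m)"
  unfolding eval_eq using assms
  by (intro sum.mono_neutral_left) (auto simp: not_in_keys_iff_lookup_eq_zero)

lemma eval_0 [simp]: "eval v 0 = 0"
  by (simp add: eval_def)

lemma eval_add [simp]: "eval v (f + g) = eval v f + eval v g"
proof -
  let ?K = "Poly_Mapping.keys f \<union> Poly_Mapping.keys g"
  have "Poly_Mapping.keys (f + g) \<subseteq> ?K" by (rule keys_add)
  then show ?thesis
    by (simp add: eval_superset[of ?K] lookup_add sum.distrib algebra_simps)
qed

lemma eval_sum: "eval v (sum h I) = (\<Sum>i\<in>I. eval v (h i))"
  by (induction I rule: infinite_finite_induct) simp_all

lemma eval_uminus [simp]: "eval v (- f) = - eval v f"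
proof -
  have "eval v (f + - f) = 0" by simp
  then show ?thesis unfolding eval_add by (simp add: eq_neg_iff_add_eq_0 add.commute)
qed

lemma eval_diff [simp]: "eval v (f - g) = eval v f - eval v g"
  using eval_add[of v f "- g"] by simp

lemma eval_single [simp]: "eval v (Poly_Mapping.single m c) = c * monom_val v m"
  by (cases "c = 0") (simp_all add: eval_eq)

lemma poly_mapping_eq_sum_single:
  "f = (\<Sum>m\<in>Poly_Mapping.keys f. Poly_Mapping.single m (Poly_Mapping.lookup f m))"
  by (rule poly_mapping_eqI)
    (simp add: lookup_sum lookup_single when_def not_in_keys_iff_lookup_eq_zero)

lemma eval_mult [simp]: "eval v (f * g) = eval v f * eval v g"
proof -
  have "f * g = (\<Sum>m\<in>Poly_Mapping.keys f. \<Sum>m'\<in>Poly_Mapping.keys g.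
      Poly_Mapping.single (m + m') (Poly_Mapping.lookup f m * Poly_Mapping.lookup g m'))"
    by (subst poly_mapping_eq_sum_single[of f], subst poly_mapping_eq_sum_single[of g])
      (simp add: sum_product mult_single)
  then have "eval v (f * g) = (\<Sum>m\<in>Poly_Mapping.keys f. \<Sum>m'\<in>Poly_Mapping.keys g.
      Poly_Mapping.lookup f m * Poly_Mapping.lookup g m' * monom_val v (m + m'))"
    by (simp add: eval_sum)
  then show ?thesis
    by (simp add: eval_eq sum_product monom_val_add mult_ac)
qed

lemma eval_1 [simp]: "eval v 1 = 1"
  using eval_single[of v 0 1] by simp

lemma eval_power [simp]: "eval v (f ^ k) = eval v f ^ k"
  by (induction k) simp_all

lemma eval_Const [simp]: "eval v (Const c) = c"
  by (simp add: Const_def)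

lemma eval_Var [simp]: "eval v (Var i) = v i"
  by (simp add: Var_def)

lemma eval_pscale [simp]: "eval v (pscale c f) = c * eval v f"
  by (simp add: pscale_def)

section \<open>Generic tuples of points\<close>

text \<open>
  Degrees are integers so that they can be subtracted; the zero function has every degree.
\<close>

definition mhom :: "nat \<Rightarrow> nat \<Rightarrow> (nat \<Rightarrow> int) \<Rightarrow> ((nat \<Rightarrow> nat \<Rightarrow> 'k::field) \<Rightarrow> 'k) \<Rightarrow> bool"
  where "mhom n d e F \<longleftrightarrow> (\<exists>f.
    (\<forall>m\<in>Poly_Mapping.keys f. Poly_Mapping.keys m \<subseteq> {..<d} \<times> {..n} \<and>
       (\<forall>j<d. int (\<Sum>i\<le>n. Poly_Mapping.lookup m (j, i)) = e j)) \<and>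
    (\<forall>v. F v = eval (\<lambda>(j, i). v j i) f))"

lemma mhom_zero: "mhom n d e (\<lambda>v. 0)"
  unfolding mhom_def by (rule exI[of _ 0]) simp

lemma mhom_const: "mhom n d (\<lambda>_. 0) (\<lambda>v. c)"
  unfolding mhom_def by (rule exI[of _ "Const c"]) (simp add: Const_def split: if_splits)

lemma mhom_coord: "j < d \<Longrightarrow> i \<le> n \<Longrightarrow> mhom n d (\<lambda>l. if l = j then 1 else 0) (\<lambda>v. v j i)"
  unfolding mhom_def
  by (rule exI[of _ "Var (j, i)"])
    (auto simp: Var_def lookup_single when_def simp flip: of_nat_sum)

lemma mhom_add:
  assumes "mhom n d e F" "mhom n d e G"
  shows "mhom n d e (\<lambda>v. F v + G v)"
proof -
  obtain f g where f: "\<forall>m\<in>Poly_Mapping.keys f. Poly_Mapping.keys m \<subseteq> {..<d} \<times> {..n} \<and>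
       (\<forall>j<d. int (\<Sum>i\<le>n. Poly_Mapping.lookup m (j, i)) = e j)" "\<forall>v. F v = eval (\<lambda>(j, i). v j i) f"
    and g: "\<forall>m\<in>Poly_Mapping.keys g. Poly_Mapping.keys m \<subseteq> {..<d} \<times> {..n} \<and>
       (\<forall>j<d. int (\<Sum>i\<le>n. Poly_Mapping.lookup m (j, i)) = e j)" "\<forall>v. G v = eval (\<lambda>(j, i). v j i) g"
    using assms unfolding mhom_def by blast
  show ?thesis
    unfolding mhom_def
  proof (intro exI[of _ "f + g"] conjI ballI allI impI)
    fix m assume "m \<in> Poly_Mapping.keys (f + g)"
    then have m: "m \<in> Poly_Mapping.keys f \<or> m \<in> Poly_Mapping.keys g"
      using keys_add[of f g] by blast
    show "Poly_Mapping.keys m \<subseteq> {..<d} \<times> {..n}"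
      using m f(1)[rule_format, of m] g(1)[rule_format, of m] by blast
    show "int (\<Sum>i\<le>n. Poly_Mapping.lookup m (j, i)) = e j" if "j < d" for j
      using m f(1)[rule_format, of m] g(1)[rule_format, of m] that by blast
  qed (use f g in simp_all)
qed

lemma mhom_mult:
  assumes "mhom n d e F" "mhom n d e' G"
  shows "mhom n d (\<lambda>j. e j + e' j) (\<lambda>v. F v * G v)"
proof -
  obtain f g where f: "\<forall>m\<in>Poly_Mapping.keys f. Poly_Mapping.keys m \<subseteq> {..<d} \<times> {..n} \<and>
       (\<forall>j<d. int (\<Sum>i\<le>n. Poly_Mapping.lookup m (j, i)) = e j)" "\<forall>v. F v = eval (\<lambda>(j, i). v j i) f"
    and g: "\<forall>m\<in>Poly_Mapping.keys g. Poly_Mapping.keys m \<subseteq> {..<d} \<times> {..n} \<and>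
       (\<forall>j<d. int (\<Sum>i\<le>n. Poly_Mapping.lookup m (j, i)) = e' j)" "\<forall>v. G v = eval (\<lambda>(j, i). v j i) g"
    using assms unfolding mhom_def by blast
  show ?thesis
    unfolding mhom_def
  proof (intro exI[of _ "f * g"] conjI ballI allI impI)
    fix m assume "m \<in> Poly_Mapping.keys (f * g)"
    then obtain m1 m2 where m: "m = m1 + m2" "m1 \<in> Poly_Mapping.keys f" "m2 \<in> Poly_Mapping.keys g"
      using keys_mult by blast
    show "Poly_Mapping.keys m \<subseteq> {..<d} \<times> {..n}"
      using keys_add[of m1 m2] f(1) g(1) m by blast
    show "int (\<Sum>i\<le>n. Poly_Mapping.lookup m (j, i)) = e j + e' j" if "j < d" for j
      using f(1)[rule_format, OF m(2)] g(1)[rule_format, OF m(3)] that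
      by (simp add: m(1) lookup_add sum.distrib)
  qed (use f g in simp_all)
qed

lemma mhom_cmult: "mhom n d e F \<Longrightarrow> mhom n d e (\<lambda>v. c * F v)"
  using mhom_mult[OF mhom_const[of n d c]] by simp

lemma mhom_uminus: "mhom n d e F \<Longrightarrow> mhom n d e (\<lambda>v. - F v)"
  using mhom_cmult[of n d e F "-1"] by simp

lemma mhom_diff: "mhom n d e F \<Longrightarrow> mhom n d e G \<Longrightarrow> mhom n d e (\<lambda>v. F v - G v)"
  using mhom_add[OF _ mhom_cmult[of n d e G "-1"]] by simp

text \<open>Reduces the question whether two nonempty open sets meet to roots of polynomials in one
  variable.\<close>

lemma mhom_on_line:
  assumes "mhom n d e F"
  shows "\<exists>p. \<forall>t. poly p t = F (\<lambda>j i. v j i + t * w j i)"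
proof -
  obtain f where f: "\<And>v. F v = eval (\<lambda>(j, i). v j i) f" using assms unfolding mhom_def by blast
  show ?thesis
    by (rule exI[of _ "\<Sum>m\<in>Poly_Mapping.keys f. Polynomial.smult (Poly_Mapping.lookup f m)
          (\<Prod>x\<in>Poly_Mapping.keys m. [:v (fst x) (snd x), w (fst x) (snd x):] ^ Poly_Mapping.lookup m x)"])
      (simp add: f eval_def poly_sum poly_prod case_prod_beta)
qed

text \<open>The condition holds on a nonempty basic open set, the locus where one multihomogeneous
  function is nonzero. Asking for a tuple with nonzero value, rather than for a nonzero polynomial,
  lets an explicit witness settle nonemptiness.\<close>

definition generically :: "nat \<Rightarrow> nat \<Rightarrow> ((nat \<Rightarrow> nat \<Rightarrow> 'k::field) \<Rightarrow> bool) \<Rightarrow> bool"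
  where "generically n d Q \<longleftrightarrow>
    (\<exists>e F. mhom n d e F \<and> (\<exists>v. F v \<noteq> 0) \<and> (\<forall>v. F v \<noteq> 0 \<longrightarrow> Q v))"

lemma generically_mono: "generically n d Q \<Longrightarrow> (\<And>v. Q v \<Longrightarrow> R v) \<Longrightarrow> generically n d R"
  unfolding generically_def by metis

lemma generically_True: "generically n d (\<lambda>v. True)"
  unfolding generically_def using mhom_const[of n d 1] by (intro exI[of _ "\<lambda>_. 0"] exI[of _ "\<lambda>v. 1"]) auto

lemma generically_conj:
  fixes Q R :: "(nat \<Rightarrow> nat \<Rightarrow> 'k::field) \<Rightarrow> bool"
  assumes inf: "infinite (UNIV :: 'k set)" and "generically n d Q" "generically n d R"
  shows "generically n d (\<lambda>v. Q v \<and> R v)"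
proof -
  obtain e F v where F: "mhom n d e F" "F v \<noteq> 0" "\<And>v. F v \<noteq> 0 \<Longrightarrow> Q v"
    using assms(2) unfolding generically_def by blast
  obtain e' G w where G: "mhom n d e' G" "G w \<noteq> 0" "\<And>v. G v \<noteq> 0 \<Longrightarrow> R v"
    using assms(3) unfolding generically_def by blast
  \<comment> \<open>The line joins a good tuple for \<open>Q\<close> to one for \<open>R\<close>.
    Both functions restrict to nonzero polynomials on it, and an infinite field contains a parameter
    that is a root of neither.\<close>
  define line where "line = (\<lambda>t j i. v j i + t * (w j i - v j i))"
  have line: "line 0 = v" "line 1 = w" by (auto simp: line_def)
  obtain p q where p: "\<And>t. poly p t = F (line t)" and q: "\<And>t. poly q t = G (line t)"
    using mhom_on_line[OF F(1), of v "\<lambda>j i. w j i - v j i"]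
      mhom_on_line[OF G(1), of v "\<lambda>j i. w j i - v j i"] unfolding line_def by blast
  have "poly p 0 \<noteq> 0" "poly q 1 \<noteq> 0" using F(2) G(2) by (simp_all add: p q line)
  then have "p * q \<noteq> 0" by auto
  then have "finite {t. poly (p * q) t = 0}" by (rule poly_roots_finite)
  then obtain t where "poly (p * q) t \<noteq> 0" using inf ex_new_if_finite by blast
  then have "F (line t) * G (line t) \<noteq> 0" by (simp add: p q)
  with mhom_mult[OF F(1) G(1)] F(3) G(3) show ?thesis
    unfolding generically_def by (intro exI[of _ "\<lambda>j. e j + e' j"] exI[of _ "\<lambda>v. F v * G v"]) auto
qed

lemma generically_Ball:
  fixes Q :: "'i \<Rightarrow> (nat \<Rightarrow> nat \<Rightarrow> 'k::field) \<Rightarrow> bool"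
  assumes "infinite (UNIV :: 'k set)" "finite I" "\<And>i. i \<in> I \<Longrightarrow> generically n d (Q i)"
  shows "generically n d (\<lambda>v. \<forall>i\<in>I. Q i v)"
  using assms(2,3)
proof (induction I rule: finite_induct)
  case (insert i I)
  then have "generically n d (\<lambda>v. Q i v \<and> (\<forall>i\<in>I. Q i v))"
    by (intro generically_conj[OF assms(1)]) auto
  then show ?case by (rule generically_mono) auto
qed (simp add: generically_True)

section \<open>Linear systems\<close>

text \<open>Full column rank, stated without minors. The set of rows may be infinite, as it is for
  \<open>cycle_rows\<close>.\<close>

definition injective_system :: "'r set \<Rightarrow> 'c set \<Rightarrow> ('r \<Rightarrow> 'c \<Rightarrow> 'k::field) \<Rightarrow> bool"
  where "injective_system R C M \<longleftrightarrow>
    (\<forall>x. (\<forall>r\<in>R. (\<Sum>c\<in>C. M r c * x c) = 0) \<longrightarrow> (\<forall>c\<in>C. x c = 0))"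

text \<open>Division-free, so that the entries stay multihomogeneous.\<close>

lemma eliminate_unknown:
  fixes M :: "'r \<Rightarrow> 'c \<Rightarrow> 'k::field"
  assumes C: "finite C" "c \<notin> C" and piv: "M r c \<noteq> 0" "r \<in> R"
  shows "injective_system R (insert c C) M \<longleftrightarrow>
    injective_system R C (\<lambda>s c'. M r c * M s c' - M s c * M r c')"
proof
  assume inj: "injective_system R (insert c C) M"
  show "injective_system R C (\<lambda>s c'. M r c * M s c' - M s c * M r c')"
    unfolding injective_system_def
  proof (intro allI impI)
    fix x assume x: "\<forall>s\<in>R. (\<Sum>c'\<in>C. (M r c * M s c' - M s c * M r c') * x c') = 0"
    \<comment> \<open>Row \<open>r\<close> is solved for the eliminated unknown
      \<open>c\<close>.\<close>
    define y where "y = x(c := - (\<Sum>c'\<in>C. M r c' * x c') / M r c)"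
    have yx: "(\<Sum>c'\<in>C. M s c' * y c') = (\<Sum>c'\<in>C. M s c' * x c')" for s
      using C by (intro sum.cong) (auto simp: y_def)
    have "(\<Sum>c'\<in>insert c C. M s c' * y c') = 0" if s: "s \<in> R" for s
    proof -
      have "M r c * (\<Sum>c'\<in>C. M s c' * x c') - M s c * (\<Sum>c'\<in>C. M r c' * x c') = 0"
        using x[rule_format, OF s]
        by (simp add: sum_distrib_left sum_subtractf left_diff_distrib mult.assoc)
      then show ?thesis using C piv(1) by (simp add: yx) (simp add: y_def field_simps)
    qed
    then have "\<forall>c'\<in>insert c C. y c' = 0" using inj unfolding injective_system_def by blast
    then show "\<forall>c'\<in>C. x c' = 0" using C(2) by (auto simp: y_def split: if_splits)
  qed
next
  assume inj: "injective_system R C (\<lambda>s c'. M r c * M s c' - M s c * M r c')"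
  show "injective_system R (insert c C) M"
    unfolding injective_system_def
  proof (intro allI impI)
    fix x assume x: "\<forall>s\<in>R. (\<Sum>c'\<in>insert c C. M s c' * x c') = 0"
    have x': "(\<Sum>c'\<in>C. M s c' * x c') = - (M s c * x c)" if "s \<in> R" for s
      using x[rule_format, OF that] C by (simp add: add_eq_0_iff)
    have "(\<Sum>c'\<in>C. (M r c * M s c' - M s c * M r c') * x c') = 0" if s: "s \<in> R" for s
    proof -
      have "(\<Sum>c'\<in>C. (M r c * M s c' - M s c * M r c') * x c') =
          M r c * (\<Sum>c'\<in>C. M s c' * x c') - M s c * (\<Sum>c'\<in>C. M r c' * x c')"
        by (simp add: sum_distrib_left sum_subtractf left_diff_distrib mult.assoc)
      then show ?thesis using x'[OF s] x'[OF piv(2)] by simp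
    qed
    then have "\<forall>c'\<in>C. x c' = 0" using inj unfolding injective_system_def by blast
    moreover from this have "x c = 0" using x'[OF piv(2)] piv(1) by simp
    ultimately show "\<forall>c'\<in>insert c C. x c' = 0" by blast
  qed
qed

text \<open>If column \<open>c\<close> were zero, the unit vector at \<open>c\<close> would be a
  nontrivial solution.\<close>

lemma injective_system_pivot:
  fixes M :: "'r \<Rightarrow> 'c \<Rightarrow> 'a::field"
  assumes "injective_system R (insert c C) M" "finite C" "c \<notin> C"
  shows "\<exists>r\<in>R. M r c \<noteq> 0"
proof (rule ccontr)
  assume "\<not> ?thesis"
  then have M: "M r c = 0" if "r \<in> R" for r using that by blast
  have "(\<Sum>c'\<in>insert c C. M r c' * (if c' = c then 1 else 0)) = 0" if "r \<in> R" for r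
  proof (rule sum.neutral, rule ballI)
    show "M r c' * (if c' = c then 1 else 0) = 0" for c' using M[OF that] by simp
  qed
  then have "(if c = c then 1 else 0 :: 'a) = 0"
    using assms(1)[unfolded injective_system_def, rule_format, of "\<lambda>c'. if c' = c then 1 else 0" c]
    by blast
  then show False by simp
qed

text \<open>Eliminate with pivots chosen at the witness \<open>w\<close>. The product of these
  pivots is nonzero at \<open>w\<close>, and wherever it is nonzero the same elimination proves
  injectivity. The degree of an entry must split as row degree minus column degree, so that the two
  products in an elimination step have equal degrees and their difference is again
  multihomogeneous.\<close>

lemma injective_system_generic:
  fixes M :: "'r \<Rightarrow> 'c \<Rightarrow> (nat \<Rightarrow> nat \<Rightarrow> 'k::field) \<Rightarrow> 'k"
  assumes "finite C" and "\<And>r c. r \<in> R \<Longrightarrow> c \<in> C \<Longrightarrow> mhom n d (\<lambda>j. dr r j - dc c j) (M r c)"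
    and "injective_system R C (\<lambda>r c. M r c w)"
  shows "generically n d (\<lambda>v. injective_system R C (\<lambda>r c. M r c v))"
proof -
  have "\<exists>e F. mhom n d e F \<and> F w \<noteq> 0 \<and> (\<forall>v. F v \<noteq> 0 \<longrightarrow> injective_system R C (\<lambda>r c. M r c v))"
    using assms
  proof (induction C arbitrary: M dr rule: finite_induct)
    case empty
    show ?case
      using mhom_const[of n d 1]
      by (intro exI[of _ "\<lambda>_. 0"] exI[of _ "\<lambda>v. 1"]) (auto simp: injective_system_def)
  next
    case (insert c C)
    obtain r where r: "r \<in> R" "M r c w \<noteq> 0"
      using injective_system_pivot[OF insert.prems(2) insert.hyps] by blast
    define M' where "M' = (\<lambda>s c' v. M r c v * M s c' v - M s c v * M r c' v)"
    have inj: "injective_system R (insert c C) (\<lambda>r c. M r c v) \<longleftrightarrow>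
        injective_system R C (\<lambda>r c. M' r c v)" if "M r c v \<noteq> 0" for v
      unfolding M'_def using eliminate_unknown[of C c "\<lambda>r c. M r c v" r R] insert.hyps r(1) that by blast
    \<comment> \<open>Multiplication by the pivot raises every row degree by
      \<open>dr r - dc c\<close>; column degrees do not change.\<close>
    have "mhom n d (\<lambda>j. (dr s j + dr r j - dc c j) - dc c' j) (M' s c')" if "s \<in> R" "c' \<in> C" for s c'
    proof -
      have e: "(\<lambda>j. (dr r j - dc c j) + (dr s j - dc c' j)) = (\<lambda>j. dr s j + dr r j - dc c j - dc c' j)"
        "(\<lambda>j. (dr s j - dc c j) + (dr r j - dc c' j)) = (\<lambda>j. dr s j + dr r j - dc c j - dc c' j)"
        by (simp_all add: algebra_simps)
      show ?thesis
        unfolding M'_def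
        using mhom_mult[of n d "\<lambda>j. dr r j - dc c j" "M r c" "\<lambda>j. dr s j - dc c' j" "M s c'"]
          mhom_mult[of n d "\<lambda>j. dr s j - dc c j" "M s c" "\<lambda>j. dr r j - dc c' j" "M r c'"]
          insert.prems(1) that r(1) unfolding e by (intro mhom_diff) auto
    qed
    from insert.IH[where dr = "\<lambda>s j. dr s j + dr r j - dc c j" and M = M', OF this] inj[OF r(2)] insert.prems(2)
    obtain e F where F: "mhom n d e F" "F w \<noteq> 0" "\<And>v. F v \<noteq> 0 \<Longrightarrow> injective_system R C (\<lambda>r c. M' r c v)"
      by blast
    have "mhom n d (\<lambda>j. (dr r j - dc c j) + e j) (\<lambda>v. M r c v * F v)"
      using insert.prems(1)[OF r(1)] F(1) by (intro mhom_mult) auto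
    then show ?case using F(2,3) r(2) inj
      by (intro exI[of _ "\<lambda>j. (dr r j - dc c j) + e j"] exI[of _ "\<lambda>v. M r c v * F v"]) auto
  qed
  then show ?thesis unfolding generically_def by blast
qed

text \<open>Elimination turns the pivot row into zero, so it removes one unknown together with one
  equation; an injective system with fewer equations than unknowns would shrink to one with no
  unknowns and a negative number of equations.\<close>

lemma underdetermined_system:
  fixes M :: "'r \<Rightarrow> 'c \<Rightarrow> 'k::field"
  assumes "finite C" "finite R" "card R < card C"
  shows "\<exists>x. (\<forall>r\<in>R. (\<Sum>c\<in>C. M r c * x c) = 0) \<and> (\<exists>c\<in>C. x c \<noteq> 0)"
proof -
  have "\<not> injective_system R C M"
    using assms
  proof (induction C arbitrary: M R rule: finite_induct)
    case (insert c C)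
    show ?case
    proof
      assume inj: "injective_system R (insert c C) M"
      obtain r where r: "r \<in> R" "M r c \<noteq> 0"
        using injective_system_pivot[OF inj insert.hyps] by blast
      let ?M = "\<lambda>s c'. M r c * M s c' - M s c * M r c'"
      have "injective_system R C ?M"
        using eliminate_unknown[of C c M r R] insert.hyps r inj by blast
      moreover have "(\<Sum>c'\<in>C. ?M r c' * x c') = 0" for x by (simp add: mult.commute)
      ultimately have "injective_system (R - {r}) C ?M"
        unfolding injective_system_def by blast
      moreover have "card (R - {r}) < card C" using insert.hyps insert.prems card.remove[OF _ r(1)] by simp
      ultimately show False using insert.IH[of "R - {r}" ?M] insert.prems by blast
    qed
  qed simp
  then show ?thesis unfolding injective_system_def by blast
qed

section \<open>Forms and the ideal of a set of points\<close>

lemma monom_val_scale: "monom_val (\<lambda>i. c * v i) m = c ^ mdeg m * monom_val v m"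
  by (simp add: monom_val_def mdeg_def power_mult_distrib prod.distrib power_sum)

lemma eval_scale:
  assumes "f \<in> polyS_deg n t"
  shows "eval (\<lambda>i. c * v i) f = c ^ nat t * eval v f"
proof -
  have "mdeg m = nat t" if "m \<in> Poly_Mapping.keys f" for m
    using assms that by (auto simp: polyS_deg_def)
  then show ?thesis
    by (simp add: eval_eq monom_val_scale sum_distrib_left mult_ac)
qed

lemma proj_space_vec:
  assumes "P \<in> proj_space n" "v \<in> P"
  shows "\<exists>i\<le>n. v i \<noteq> 0"
  using assms unfolding proj_space_def quotient_def by (auto, metis not_le_imp_less mult_eq_0_iff)+

lemma proj_space_scale:
  assumes "P \<in> proj_space n" "v \<in> P" "w \<in> P"
  shows "\<exists>c. c \<noteq> 0 \<and> w = (\<lambda>i. c * v i)"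
proof -
  obtain u c d where "c \<noteq> 0" "v = (\<lambda>i. c * u i)" "d \<noteq> 0" "w = (\<lambda>i. d * u i)"
    using assms unfolding proj_space_def quotient_def by auto
  then show ?thesis by (intro exI[of _ "d / c"]) auto
qed

lemma vanishes_at_iff:
  assumes "f \<in> polyS_deg n t" "P \<in> proj_space n" "v \<in> P"
  shows "vanishes_at f P \<longleftrightarrow> eval v f = 0"
proof
  assume f: "eval v f = 0"
  have "eval w f = 0" if "w \<in> P" for w
    using proj_space_scale[OF assms(2,3) that] eval_scale[OF assms(1)] f by auto
  then show "vanishes_at f P" by (simp add: vanishes_at_def)
qed (use assms in \<open>auto simp: vanishes_at_def\<close>)

lemma polyS_deg_0 [simp]: "0 \<in> polyS_deg n t"
  by (simp add: polyS_deg_def polyS_def)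

lemma polyS_deg_add: "f \<in> polyS_deg n t \<Longrightarrow> g \<in> polyS_deg n t \<Longrightarrow> f + g \<in> polyS_deg n t"
  using keys_add[of f g] unfolding polyS_deg_def polyS_def by blast

lemma mdeg_add: "mdeg (m + m') = mdeg m + mdeg m'"
proof -
  let ?K = "Poly_Mapping.keys m \<union> Poly_Mapping.keys m'"
  have *: "mdeg l = (\<Sum>i\<in>?K. Poly_Mapping.lookup l i)" if "Poly_Mapping.keys l \<subseteq> ?K" for l
    unfolding mdeg_def using that
    by (intro sum.mono_neutral_left) (auto simp: not_in_keys_iff_lookup_eq_zero)
  show ?thesis
    using keys_add[of m m'] by (simp add: * lookup_add sum.distrib)
qed

lemma polyS_deg_mult:
  assumes "f \<in> polyS_deg n s" "g \<in> polyS_deg n t"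
  shows "f * g \<in> polyS_deg n (s + t)"
proof -
  have "Poly_Mapping.keys m \<subseteq> {..n} \<and> int (mdeg m) = s + t" if m: "m \<in> Poly_Mapping.keys (f * g)" for m
  proof -
    obtain a b where "m = a + b" "a \<in> Poly_Mapping.keys f" "b \<in> Poly_Mapping.keys g"
      using m keys_mult[of f g] by blast
    then show ?thesis
      using assms keys_add[of a b] unfolding polyS_deg_def polyS_def
      by (simp add: mdeg_add) blast
  qed
  then show ?thesis by (auto simp: polyS_deg_def polyS_def)
qed

lemma polyS_deg_Const: "Const c \<in> polyS_deg n 0"
  by (simp add: polyS_deg_def polyS_def Const_def mdeg_def)

lemma polyS_deg_Var: "i \<le> n \<Longrightarrow> Var i \<in> polyS_deg n 1"
  by (simp add: polyS_deg_def polyS_def Var_def mdeg_def)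

lemma polyS_deg_Const_mult: "f \<in> polyS_deg n t \<Longrightarrow> Const c * f \<in> polyS_deg n t"
  using polyS_deg_mult[OF polyS_deg_Const] by force

lemma polyS_deg_sum: "(\<And>i. i \<in> I \<Longrightarrow> h i \<in> polyS_deg n t) \<Longrightarrow> sum h I \<in> polyS_deg n t"
  by (induction I rule: infinite_finite_induct) (auto intro: polyS_deg_add)

lemma Const_simps: "Const (- a) = - Const a" "Const 0 = 0" "Const 1 = 1"
  by (simp_all add: Const_def single_uminus)

lemma polyS_deg_uminus: "f \<in> polyS_deg n t \<Longrightarrow> - f \<in> polyS_deg n t"
  using polyS_deg_Const_mult[of f n t "-1"] by (simp add: Const_simps)

text \<open>Combinations of forms vanishing on \<open>W\<close> vanish on \<open>W\<close>, and a
  form vanishing on \<open>W\<close> is itself one of the generators. From here on the ideal is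
  handled through values at points.\<close>

lemma ideal_deg_iff: "f \<in> ideal_deg n W t \<longleftrightarrow> f \<in> polyS_deg n t \<and> (\<forall>P\<in>W. vanishes_at f P)"
proof
  assume f: "f \<in> ideal_deg n W t"
  then obtain r :: nat and g h where h: "f = (\<Sum>j<r. g j * h j)" "\<forall>j<r. \<forall>P\<in>W. vanishes_at (h j) P"
    unfolding ideal_deg_def ideal_of_def by blast
  then have "\<forall>P\<in>W. vanishes_at f P" by (simp add: vanishes_at_def eval_sum)
  then show "f \<in> polyS_deg n t \<and> (\<forall>P\<in>W. vanishes_at f P)" using f by (simp add: ideal_deg_def)
next
  assume f: "f \<in> polyS_deg n t \<and> (\<forall>P\<in>W. vanishes_at f P)"
  have "f \<in> ideal_of n W"
    unfolding ideal_of_def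
    by (intro CollectI exI[of _ "1::nat"] exI[of _ "\<lambda>_. 1"] exI[of _ "\<lambda>_. f"])
      (use f in \<open>auto simp: polyS_def\<close>)
  then show "f \<in> ideal_deg n W t" using f by (simp add: ideal_deg_def)
qed

section \<open>Contraction and exterior multiplication\<close>

definition above_sign :: "nat \<Rightarrow> nat set \<Rightarrow> 'r::comm_ring_1"
  where "above_sign a B = (-1) ^ card {b \<in> B. a < b}"

lemma above_sign_insert:
  assumes "finite B" "c \<notin> B"
  shows "above_sign a (insert c B) = (if a < c then - above_sign a B else above_sign a B)"
proof -
  have "{b \<in> insert c B. a < b} = (if a < c then insert c {b \<in> B. a < b} else {b \<in> B. a < b})"
    by auto
  then show ?thesis using assms by (simp add: above_sign_def)
qed

lemma above_sign_square [simp]: "above_sign a B * above_sign a B = 1"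
  by (simp add: above_sign_def flip: power_mult_distrib)

text \<open>
  A function \<open>\<theta>\<close> on the subsets of \<open>{..n}\<close> stands for \<open>\<Sum>\<^sub>A \<theta> A x\<^sub>A\<close> in the exterior algebra;
  \<open>contr n v\<close> is the contraction with a vector, with the signs of \<open>koszul\<close>, and \<open>ext_mult n m\<close> the right
  multiplication by the linear form with coefficients \<open>m\<close>.
\<close>

definition contr :: "nat \<Rightarrow> (nat \<Rightarrow> 'r) \<Rightarrow> (nat set \<Rightarrow> 'r) \<Rightarrow> nat set \<Rightarrow> 'r::comm_ring_1"
  where "contr n v \<theta> B =
    (if B \<subseteq> {..n} then \<Sum>a\<in>{..n} - B. above_sign a B * v a * \<theta> (insert a B) else 0)"

definition ext_mult :: "nat \<Rightarrow> (nat \<Rightarrow> 'r) \<Rightarrow> (nat set \<Rightarrow> 'r) \<Rightarrow> nat set \<Rightarrow> 'r::comm_ring_1"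
  where "ext_mult n m \<theta> A = (if A \<subseteq> {..n} then \<Sum>a\<in>A. above_sign a A * m a * \<theta> (A - {a}) else 0)"

lemma contr_add: "contr n v (\<lambda>A. \<theta> A + \<eta> A) B = contr n v \<theta> B + contr n v \<eta> B"
  by (simp add: contr_def algebra_simps sum.distrib)

lemma contr_cmult: "contr n v (\<lambda>A. c * \<theta> A) B = c * contr n v \<theta> B"
  by (simp add: contr_def sum_distrib_left mult_ac)

lemma contr_0: "contr n v (\<lambda>A. 0) B = 0"
  by (simp add: contr_def)

lemma contr_uminus: "contr n v (\<lambda>A. - \<theta> A) B = - contr n v \<theta> B"
  using contr_cmult[of n v "-1" \<theta> B] by simp

lemma contr_diff: "contr n v (\<lambda>A. \<theta> A - \<eta> A) B = contr n v \<theta> B - contr n v \<eta> B"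
  using contr_add[of n v \<theta> "\<lambda>A. - \<eta> A" B] by (simp add: contr_uminus)

lemma contr_vec_add: "contr n (\<lambda>i. v i + w i) \<theta> B = contr n v \<theta> B + contr n w \<theta> B"
  by (simp add: contr_def algebra_simps sum.distrib)

lemma contr_vec_cmult: "contr n (\<lambda>i. c * v i) \<theta> B = c * contr n v \<theta> B"
  by (simp add: contr_def sum_distrib_left mult_ac)

lemma contr_cong:
  assumes "\<And>i. i \<le> n \<Longrightarrow> v i = w i" "\<And>A. A \<subseteq> {..n} \<Longrightarrow> \<theta> A = \<eta> A"
  shows "contr n v \<theta> B = contr n w \<eta> B"
  unfolding contr_def using assms by (auto intro!: sum.cong)

lemma contr_contr_self: "contr n v (contr n v \<theta>) B = 0"
proof (cases "B \<subseteq> {..n}")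
  case B: True
  then have fin: "finite B" using finite_subset by blast
  let ?D = "{..n} - B"
  \<comment> \<open>The diagonal is filled with zeros so that both sums run over the same set; the
    terms for (a, c) and (c, a) then cancel.\<close>
  define T where "T = (\<lambda>a c. if a = c then 0 else above_sign a B * above_sign c (insert a B) *
    (v a * v c * \<theta> (insert c (insert a B))))"
  have "contr n v (contr n v \<theta>) B = (\<Sum>a\<in>?D. \<Sum>c\<in>?D. T a c)"
    unfolding contr_def[of n v "contr n v \<theta>"] if_P[OF B]
  proof (rule sum.cong[OF refl])
    fix a assume a: "a \<in> ?D"
    have "(\<Sum>c\<in>?D. T a c) = (\<Sum>c\<in>{..n} - insert a B. T a c)"
      by (rule sum.mono_neutral_right) (auto simp: T_def)
    also have "\<dots> = above_sign a B * v a * contr n v \<theta> (insert a B)"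
      using a B by (auto simp: contr_def T_def sum_distrib_left mult_ac intro!: sum.cong)
    finally show "above_sign a B * v a * contr n v \<theta> (insert a B) = (\<Sum>c\<in>?D. T a c)" by simp
  qed
  also have "\<dots> = 0"
  proof (rule sum_alternating)
    fix a c assume ac: "a \<in> ?D" "c \<in> ?D" "a \<noteq> c"
    then show "T a c + T c a = 0"
      using above_sign_insert[OF fin, of a c, where ?'a = 'a] above_sign_insert[OF fin, of c a, where ?'a = 'a]
      by (cases "a < c") (auto simp: T_def insert_commute[of a c] mult_ac)
  qed (auto simp: T_def)
  finally show ?thesis .
qed (simp add: contr_def)

text \<open>Polarization of \<open>contr_contr_self\<close>.\<close>

lemma contr_anticommute: "contr n v (contr n w \<theta>) B = - contr n w (contr n v \<theta>) B"
proof -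
  have "contr n (\<lambda>i. v i + w i) \<theta> = (\<lambda>B. contr n v \<theta> B + contr n w \<theta> B)"
    by (rule ext) (rule contr_vec_add)
  then have "contr n (\<lambda>i. v i + w i) (contr n (\<lambda>i. v i + w i) \<theta>) B =
      contr n v (contr n w \<theta>) B + contr n w (contr n v \<theta>) B"
    by (simp add: contr_vec_add contr_add contr_contr_self)
  then show ?thesis by (simp add: contr_contr_self add_eq_0_iff2)
qed

text \<open>The Leibniz rule of an antiderivation. Contraction and multiplication both act from the
  right, so no sign depends on the degree of the element.\<close>

lemma contr_ext_mult:
  assumes supp: "\<And>A. \<not> A \<subseteq> {..n} \<Longrightarrow> \<theta> A = 0"
  shows "contr n v (ext_mult n m \<theta>) B = (\<Sum>i\<le>n. v i * m i) * \<theta> B - ext_mult n m (contr n v \<theta>) B"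
proof (cases "B \<subseteq> {..n}")
  case B: True
  then have fin: "finite B" using finite_subset by blast
  let ?D = "{..n} - B"
  let ?T = "\<lambda>a c. above_sign a B * above_sign c (insert a B) * v a * m c * \<theta> (insert a B - {c})"
  \<comment> \<open>Inserting \<open>a\<close> and removing \<open>c\<close> in the other order
    costs one sign, because exactly one of the two elements lies above the other.\<close>
  have sg: "above_sign a B * above_sign c (insert a B) = - (above_sign c B * above_sign a (B - {c}) :: 'a)"
    if "a \<in> ?D" "c \<in> B" for a c
  proof -
    have "above_sign a B = (if a < c then - above_sign a (B - {c}) else above_sign a (B - {c}) :: 'a)"
      using that fin above_sign_insert[of "B - {c}" c a] by (simp add: insert_absorb)
    moreover have "above_sign c (insert a B) = (if c < a then - above_sign c B else above_sign c B :: 'a)"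
      using that fin by (simp add: above_sign_insert)
    moreover have "a \<noteq> c" using that by auto
    ultimately show ?thesis by (cases "a < c") (simp_all add: mult.commute)
  qed
  have "contr n v (ext_mult n m \<theta>) B = (\<Sum>a\<in>?D. v a * m a * \<theta> B + (\<Sum>c\<in>B. ?T a c))"
    unfolding contr_def if_P[OF B]
  proof (rule sum.cong[OF refl])
    fix a assume a: "a \<in> ?D"
    have s: "above_sign a (insert a B) = (above_sign a B :: 'a)"
      using a fin by (simp add: above_sign_insert)
    have "ext_mult n m \<theta> (insert a B) = (\<Sum>c\<in>insert a B. above_sign c (insert a B) * m c * \<theta> (insert a B - {c}))"
      using a B by (simp add: ext_mult_def)
    also have "\<dots> = above_sign a B * m a * \<theta> B + (\<Sum>c\<in>B. above_sign c (insert a B) * m c * \<theta> (insert a B - {c}))"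
      using a fin by (simp add: s)
    finally have "above_sign a B * v a * ext_mult n m \<theta> (insert a B) =
        (above_sign a B * above_sign a B) * (v a * m a * \<theta> B) + (\<Sum>c\<in>B. ?T a c)"
      by (simp only: distrib_left sum_distrib_left mult_ac)
    then show "above_sign a B * v a * ext_mult n m \<theta> (insert a B) = v a * m a * \<theta> B + (\<Sum>c\<in>B. ?T a c)"
      by simp
  qed
  moreover have "ext_mult n m (contr n v \<theta>) B = (\<Sum>c\<in>B. v c * m c * \<theta> B - (\<Sum>a\<in>?D. ?T a c))"
    unfolding ext_mult_def if_P[OF B]
  proof (rule sum.cong[OF refl])
    fix c assume c: "c \<in> B"
    have D: "{..n} - (B - {c}) = insert c ?D" "c \<notin> ?D" using c B by auto
    have s: "above_sign c (B - {c}) = (above_sign c B :: 'a)"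
      using above_sign_insert[of "B - {c}" c c, where ?'a = 'a] c fin by (simp add: insert_absorb)
    have "contr n v \<theta> (B - {c}) = (\<Sum>a\<in>insert c ?D. above_sign a (B - {c}) * v a * \<theta> (insert a (B - {c})))"
      unfolding contr_def D(1) using B by auto
    also have "\<dots> = above_sign c B * v c * \<theta> B + (\<Sum>a\<in>?D. above_sign a (B - {c}) * v a * \<theta> (insert a B - {c}))"
    proof -
      have "insert a (B - {c}) = insert a B - {c}" if "a \<in> ?D" for a using that c by auto
      then show ?thesis using D(2) c by (simp add: s insert_absorb)
    qed
    finally have "above_sign c B * m c * contr n v \<theta> (B - {c}) =
       (above_sign c B * above_sign c B) * (v c * m c * \<theta> B) +
       (\<Sum>a\<in>?D. (above_sign c B * above_sign a (B - {c})) * v a * m c * \<theta> (insert a B - {c}))"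
      by (simp only: distrib_left sum_distrib_left mult_ac)
    also have "(\<Sum>a\<in>?D. (above_sign c B * above_sign a (B - {c})) * v a * m c * \<theta> (insert a B - {c})) =
       - (\<Sum>a\<in>?D. ?T a c)"
      unfolding sum_negf[symmetric] by (rule sum.cong[OF refl]) (simp add: sg c)
    finally show "above_sign c B * m c * contr n v \<theta> (B - {c}) = v c * m c * \<theta> B - (\<Sum>a\<in>?D. ?T a c)"
      by simp
  qed
  moreover have "(\<Sum>i\<le>n. v i * m i) * \<theta> B = (\<Sum>a\<in>?D. v a * m a * \<theta> B) + (\<Sum>c\<in>B. v c * m c * \<theta> B)"
  proof -
    have "{..n} = ?D \<union> B" using B by auto
    then have "(\<Sum>i\<le>n. v i * m i * \<theta> B) = (\<Sum>i\<in>?D \<union> B. v i * m i * \<theta> B)" by simp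
    also have "\<dots> = (\<Sum>a\<in>?D. v a * m a * \<theta> B) + (\<Sum>c\<in>B. v c * m c * \<theta> B)"
      using fin by (intro sum.union_disjoint) auto
    finally show ?thesis by (simp add: sum_distrib_right)
  qed
  moreover have "(\<Sum>a\<in>?D. \<Sum>c\<in>B. ?T a c) = (\<Sum>c\<in>B. \<Sum>a\<in>?D. ?T a c)" by (rule sum.swap)
  ultimately show ?thesis by (simp add: sum.distrib sum_subtractf)
qed (use supp in \<open>simp add: contr_def ext_mult_def\<close>)

lemma ext_mult_uminus: "ext_mult n m (\<lambda>A. - \<theta> A) B = - ext_mult n m \<theta> B"
  by (simp add: ext_mult_def sum_negf)

lemma ext_mult_0: "ext_mult n m (\<lambda>A. 0) B = 0"
  by (simp add: ext_mult_def)

lemma ext_mult_outside: "\<not> A \<subseteq> {..n} \<Longrightarrow> ext_mult n m \<theta> A = 0"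
  by (simp add: ext_mult_def)

lemma ext_mult_card:
  assumes "\<And>A. \<theta> A \<noteq> 0 \<Longrightarrow> card A = p" "ext_mult n m \<theta> A \<noteq> 0"
  shows "card A = Suc p"
proof -
  have A: "A \<subseteq> {..n}" using assms(2) ext_mult_outside by metis
  then have "\<exists>a\<in>A. \<theta> (A - {a}) \<noteq> 0"
    using assms(2) by (auto simp: ext_mult_def intro!: sum.neutral)
  then obtain a where a: "a \<in> A" "card (A - {a}) = p" using assms(1) by blast
  have "finite A" using A finite_subset by blast
  then show ?thesis using a card.remove by metis
qed

section \<open>Koszul maps and contraction\<close>

text \<open>The Koszul map is contraction with the tautological vector of the variables. Evaluation
  at a point p turns it into contraction with p, which is how cycles are studied point by
  point.\<close>

lemma lookup_koszul:
  assumes "\<And>A. A \<in> Poly_Mapping.keys u \<Longrightarrow> A \<subseteq> {..n}"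
  shows "Poly_Mapping.lookup (koszul u) B = contr n Var (Poly_Mapping.lookup u) B"
proof -
  define X where "X = (\<lambda>A a. above_sign a A * (Var a * Poly_Mapping.lookup u A))"
  have "Poly_Mapping.lookup (koszul u) B =
      (\<Sum>A\<in>Poly_Mapping.keys u. \<Sum>a\<in>A. X A a when A - {a} = B)"
    unfolding koszul_def lookup_sum lookup_single X_def above_sign_def ..
  also have "\<dots> = (\<Sum>A\<in>Poly_Mapping.keys u. \<Sum>a\<in>{..n}. if a \<notin> B \<and> A = insert a B then X A a else 0)"
    using assms by (intro sum.cong[OF refl] sum.mono_neutral_cong_left) (auto simp: when_def)
  also have "\<dots> = (\<Sum>A\<in>Pow {..n}. \<Sum>a\<in>{..n}. if a \<notin> B \<and> A = insert a B then X A a else 0)"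
    using assms by (intro sum.mono_neutral_left)
      (auto simp: X_def not_in_keys_iff_lookup_eq_zero intro!: sum.neutral)
  also have "\<dots> = (\<Sum>a\<in>{..n}. \<Sum>A\<in>Pow {..n}. if A = insert a B then (if a \<notin> B then X A a else 0) else 0)"
    by (subst sum.swap) (auto intro!: sum.cong)
  also have "\<dots> = (\<Sum>a\<in>{..n}. if insert a B \<subseteq> {..n} \<and> a \<notin> B then X (insert a B) a else 0)"
    by (intro sum.cong[OF refl]) (simp add: sum.delta)
  also have "\<dots> = contr n Var (Poly_Mapping.lookup u) B"
  proof (cases "B \<subseteq> {..n}")
    case True
    then have fin: "finite B" using finite_subset by blast
    have "(\<Sum>a\<in>{..n}. if insert a B \<subseteq> {..n} \<and> a \<notin> B then X (insert a B) a else 0) =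
        (\<Sum>a\<in>{..n} - B. X (insert a B) a)"
      using True by (intro sum.mono_neutral_cong_right) auto
    then show ?thesis
      using True fin by (auto simp: contr_def X_def above_sign_insert mult_ac intro!: sum.cong)
  qed (simp add: contr_def)
  finally show ?thesis .
qed

lemma eval_above_sign [simp]: "eval v (above_sign a B) = above_sign a B"
  by (simp add: above_sign_def)

lemma eval_contr: "eval v (contr n l \<theta> B) = contr n (\<lambda>i. eval v (l i)) (\<lambda>A. eval v (\<theta> A)) B"
  by (simp add: contr_def eval_sum)

lemma eval_koszul:
  assumes "\<And>A. A \<in> Poly_Mapping.keys u \<Longrightarrow> A \<subseteq> {..n}"
  shows "eval v (Poly_Mapping.lookup (koszul u) B) = contr n v (\<lambda>A. eval v (Poly_Mapping.lookup u A)) B"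
  by (simp add: lookup_koszul[OF assms] eval_contr)

lemma keys_koszul:
  assumes "\<And>A. A \<in> Poly_Mapping.keys u \<Longrightarrow> A \<subseteq> {..n} \<and> card A = Suc p" "B \<in> Poly_Mapping.keys (koszul u)"
  shows "B \<subseteq> {..n} \<and> card B = p"
proof -
  have nz: "contr n Var (Poly_Mapping.lookup u) B \<noteq> 0"
    using assms lookup_koszul[of u n B] by (metis in_keys_iff)
  then have B: "B \<subseteq> {..n}" by (auto simp: contr_def split: if_splits)
  obtain a where a: "a \<in> {..n} - B" "Poly_Mapping.lookup u (insert a B) \<noteq> 0"
    using nz B sum.neutral[of "{..n} - B" "\<lambda>a. above_sign a B * Var a * Poly_Mapping.lookup u (insert a B)"]
    by (force simp: contr_def)
  then have "card (insert a B) = Suc p" using assms(1)[of "insert a B"] by (simp add: in_keys_iff)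
  moreover have "finite B" using B finite_subset by blast
  ultimately show ?thesis using a B by simp
qed

lemma koszul_koszul:
  assumes "\<And>A. A \<in> Poly_Mapping.keys u \<Longrightarrow> A \<subseteq> {..n} \<and> card A = Suc p"
  shows "koszul (koszul u) = 0"
proof (rule poly_mapping_eqI)
  fix B
  have "Poly_Mapping.lookup (koszul (koszul u)) B = contr n Var (Poly_Mapping.lookup (koszul u)) B"
    using keys_koszul[of u n p] assms by (intro lookup_koszul) blast
  also have "Poly_Mapping.lookup (koszul u) = contr n Var (Poly_Mapping.lookup u)"
    using assms by (intro ext lookup_koszul) blast
  finally show "Poly_Mapping.lookup (koszul (koszul u)) B = Poly_Mapping.lookup 0 B"
    by (simp add: contr_contr_self)
qed

section \<open>Dimensions of spaces of chains\<close>

lemma cscale_single: "cscale c (Poly_Mapping.single A f) = Poly_Mapping.single A (pscale c f)"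
  by (rule poly_mapping_eqI) (simp add: lookup_cscale lookup_single when_def pscale_def)

lemma koszul_cscale: "koszul (cscale c u) = cscale c (koszul u)"
proof -
  have *: "koszul (cscale c (Poly_Mapping.single A f)) = cscale c (koszul (Poly_Mapping.single A f))" for A f
    by (simp add: cscale_single koszul_single chain.scale_sum_right pscale_def mult_ac)
  have "koszul (cscale c u) =
      (\<Sum>A\<in>Poly_Mapping.keys u. koszul (cscale c (Poly_Mapping.single A (Poly_Mapping.lookup u A))))"
    by (subst chain_eq_sum[of u]) (simp add: chain.scale_sum_right koszul_sum)
  also have "\<dots> = cscale c (koszul u)"
    by (subst (3) chain_eq_sum[of u]) (simp add: * chain.scale_sum_right koszul_sum)
  finally show ?thesis .
qed

lemma lookup_chains: "u \<in> chains n W p q \<Longrightarrow> Poly_Mapping.lookup u A \<in> ideal_deg n W q"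
  by (cases "A \<in> Poly_Mapping.keys u")
    (auto simp: chains_def not_in_keys_iff_lookup_eq_zero ideal_deg_iff vanishes_at_def)

lemma ideal_deg_add: "f \<in> ideal_deg n W t \<Longrightarrow> g \<in> ideal_deg n W t \<Longrightarrow> f + g \<in> ideal_deg n W t"
  by (auto simp: ideal_deg_iff polyS_deg_add vanishes_at_def)

lemma ideal_deg_pscale: "f \<in> ideal_deg n W t \<Longrightarrow> pscale c f \<in> ideal_deg n W t"
  by (auto simp: ideal_deg_iff polyS_deg_Const_mult pscale_def vanishes_at_def)

lemma subspace_chains: "chain.subspace (chains n W p q)"
proof (rule chain.subspaceI)
  fix u v :: "'a chain" and c :: 'a
  show "0 \<in> chains n W p q" by (simp add: chains_def)
  assume u: "u \<in> chains n W p q"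
  have "A \<in> Poly_Mapping.keys u" if "A \<in> Poly_Mapping.keys (cscale c u)" for A
    using that by (auto simp: in_keys_iff lookup_cscale)
  then show "cscale c u \<in> chains n W p q"
    using u unfolding chains_def by (auto simp: lookup_cscale ideal_deg_pscale)
  assume v: "v \<in> chains n W p q"
  show "u + v \<in> chains n W p q"
    unfolding chains_def
  proof (intro CollectI ballI)
    fix A assume "A \<in> Poly_Mapping.keys (u + v)"
    then have "A \<in> Poly_Mapping.keys u \<or> A \<in> Poly_Mapping.keys v" using keys_add[of u v] by blast
    then show "A \<subseteq> {..n} \<and> card A = p \<and> Poly_Mapping.lookup (u + v) A \<in> ideal_deg n W q"
      using u v ideal_deg_add[OF lookup_chains[OF u] lookup_chains[OF v]]
      by (auto simp: chains_def lookup_add)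
  qed
qed

lemma finite_monomials: "finite {m. Poly_Mapping.keys m \<subseteq> {..n::nat} \<and> mdeg m = t}"
proof (rule finite_imageD)
  show "inj_on Poly_Mapping.lookup {m. Poly_Mapping.keys m \<subseteq> {..n::nat} \<and> mdeg m = t}"
    by (rule inj_onI, rule poly_mapping_eqI) simp
  have "Poly_Mapping.lookup m i \<le> t" if "Poly_Mapping.keys m \<subseteq> {..n}" "mdeg m = t" for m i
  proof (cases "i \<in> Poly_Mapping.keys m")
    case True
    then show ?thesis
      using that member_le_sum[of i "Poly_Mapping.keys m" "Poly_Mapping.lookup m"] by (simp add: mdeg_def)
  qed (simp add: not_in_keys_iff_lookup_eq_zero)
  moreover have "Poly_Mapping.lookup m i = 0" if "Poly_Mapping.keys m \<subseteq> {..n}" "i \<notin> {..n}" for m :: "nat \<Rightarrow>\<^sub>0 nat" and i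
    using that by (meson in_keys_iff subsetD)
  ultimately have "Poly_Mapping.lookup ` {m. Poly_Mapping.keys m \<subseteq> {..n} \<and> mdeg m = t} \<subseteq>
      {f. \<forall>i. (i \<in> {..n} \<longrightarrow> f i \<in> {..t}) \<and> (i \<notin> {..n} \<longrightarrow> f i = 0)}"
    by auto
  then show "finite (Poly_Mapping.lookup ` {m. Poly_Mapping.keys m \<subseteq> {..n} \<and> mdeg m = t})"
    by (rule finite_subset) (rule finite_set_of_finite_funs; simp)
qed

text \<open>Without a finite spanning set the dimensions would carry no information, as an infinite
  basis has \<open>card\<close> equal to 0.\<close>

lemma finite_dim_chains: "\<exists>T. finite T \<and> chains n W p q \<subseteq> chain.span T"
proof (intro exI conjI)
  let ?M = "{m. Poly_Mapping.keys m \<subseteq> {..n::nat} \<and> mdeg m = nat q}"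
  let ?T = "(\<lambda>(A, m). Poly_Mapping.single A (Poly_Mapping.single m 1)) ` (Pow {..n} \<times> ?M) :: 'a chain set"
  show "finite ?T" using finite_monomials[of n "nat q"] by simp
  show "chains n W p q \<subseteq> chain.span ?T"
  proof
    fix u :: "'a chain" assume u: "u \<in> chains n W p q"
    have s: "Poly_Mapping.single A f = (\<Sum>m\<in>Poly_Mapping.keys f.
        cscale (Poly_Mapping.lookup f m) (Poly_Mapping.single A (Poly_Mapping.single m 1)))" for A and f :: "(nat, 'a) mpoly"
      by (subst poly_mapping_eq_sum_single[of f])
        (simp add: single_sum cscale_single pscale_def Const_def mult_single)
    have "u = (\<Sum>A\<in>Poly_Mapping.keys u. \<Sum>m\<in>Poly_Mapping.keys (Poly_Mapping.lookup u A).
        cscale (Poly_Mapping.lookup (Poly_Mapping.lookup u A) m) (Poly_Mapping.single A (Poly_Mapping.single m 1)))"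
      by (subst chain_eq_sum) (simp flip: s)
    also have "\<dots> \<in> chain.span ?T"
    proof (intro chain.span_sum chain.span_scale chain.span_base)
      fix A m assume "A \<in> Poly_Mapping.keys u" "m \<in> Poly_Mapping.keys (Poly_Mapping.lookup u A)"
      then have "(A, m) \<in> Pow {..n} \<times> ?M"
        using u by (fastforce simp: chains_def ideal_deg_iff polyS_deg_def polyS_def)
      then show "Poly_Mapping.single A (Poly_Mapping.single m 1) \<in> ?T" by (rule rev_image_eqI) simp
    qed
    finally show "u \<in> chain.span ?T" .
  qed
qed

section \<open>Rank and dimension for the Koszul map\<close>

lemma finite_chain_basis:
  assumes "finite T" "V \<subseteq> chain.span T" "chain.independent B" "B \<subseteq> V"
  shows "finite B"
  using chain.independent_span_bound[OF assms(1,3)] assms(2,4) by blast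

text \<open>Extend the kernel element \<open>x\<close> to a basis of \<open>V\<close>; the images of
  the other basis elements already span the image.\<close>

lemma dim_koszul_image_less:
  assumes T: "finite T" "V \<subseteq> chain.span T" and x: "x \<in> V" "x \<noteq> 0" "koszul x = 0"
  shows "chain.dim (koszul ` V) < chain.dim V"
proof -
  have "chain.independent {x}" using x(2) by simp
  then obtain B where B: "{x} \<subseteq> B" "B \<subseteq> V" "chain.independent B" "V \<subseteq> chain.span B"
    using chain.maximal_independent_subset_extend[of "{x}" V] x(1) by blast
  have fin: "finite B" using finite_chain_basis[OF T B(3,2)] .
  let ?K = "koszul ` (B - {x})"
  have "chain.subspace {u. koszul u \<in> chain.span ?K}"
    by (rule chain.subspaceI) (auto simp: koszul_add koszul_cscale chain.span_add chain.span_scale chain.span_zero)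
  moreover have "B \<subseteq> {u. koszul u \<in> chain.span ?K}"
  proof
    fix b assume "b \<in> B"
    then show "b \<in> {u. koszul u \<in> chain.span ?K}"
      using x(3) by (cases "b = x") (auto intro: chain.span_base chain.span_zero)
  qed
  ultimately have "chain.span B \<subseteq> {u. koszul u \<in> chain.span ?K}" by (rule chain.span_minimal[rotated])
  then have "koszul ` V \<subseteq> chain.span ?K" using B(4) by blast
  then have "chain.dim (koszul ` V) \<le> card ?K" using fin by (intro chain.dim_le_card) auto
  also have "\<dots> \<le> card (B - {x})" using fin by (intro card_image_le) auto
  also have "\<dots> < card B" using fin B(1) by (intro psubset_card_mono) auto
  also have "card B = chain.dim V" using B by (intro chain.basis_card_eq_dim) auto
  finally show ?thesis .
qed

lemma dim_eq_imp_subset: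
  assumes T: "finite T" "W \<subseteq> chain.span T" and V: "chain.subspace V" "V \<subseteq> W" and dim: "chain.dim V = chain.dim W"
  shows "W \<subseteq> V"
proof -
  obtain B where B: "B \<subseteq> V" "chain.independent B" "V \<subseteq> chain.span B" "card B = chain.dim V"
    using chain.basis_exists[of V] by blast
  obtain C where C: "B \<subseteq> C" "C \<subseteq> W" "chain.independent C" "W \<subseteq> chain.span C"
    using chain.maximal_independent_subset_extend[of B W] B(1,2) V(2) by blast
  have "finite C" using finite_chain_basis[OF T C(3,2)] .
  moreover have "card C = chain.dim W" using C by (intro chain.basis_card_eq_dim) auto
  ultimately have "B = C" using C(1) B(4) dim by (metis card_subset_eq)
  then show ?thesis using C(4) chain.span_minimal[OF B(1) V(1)] by blast
qed

text \<open>The coefficients of the image are combinations of those of \<open>u\<close>, so they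
  vanish at the same points.\<close>

lemma koszul_chains:
  assumes u: "u \<in> chains n W (Suc p) q"
  shows "koszul u \<in> koszul_ker n W p (q + 1)"
proof -
  have k: "A \<subseteq> {..n} \<and> card A = Suc p" if "A \<in> Poly_Mapping.keys u" for A
    using u that by (auto simp: chains_def)
  have "Poly_Mapping.lookup (koszul u) B \<in> ideal_deg n W (q + 1)" for B
  proof -
    have D: "polyS_deg n (q + 1) = polyS_deg n (1 + q)" by (simp add: add.commute)
    have "(above_sign a B :: (nat, 'a) mpoly) = Const (above_sign a B)" for a
    proof -
      have "Const ((-1) ^ k) = (-1 :: (nat, 'a) mpoly) ^ k" for k
        by (induction k) (simp_all add: Const_def single_uminus)
      then show ?thesis by (simp add: above_sign_def)
    qed
    then have "contr n Var (Poly_Mapping.lookup u) B \<in> polyS_deg n (q + 1)"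
      unfolding contr_def D using lookup_chains[OF u]
      by (auto simp: mult.assoc ideal_deg_iff
          intro!: polyS_deg_sum polyS_deg_Const_mult polyS_deg_mult[OF polyS_deg_Var])
    moreover have "vanishes_at (contr n Var (Poly_Mapping.lookup u) B) P" if "P \<in> W" for P
    proof -
      have "eval v (Poly_Mapping.lookup u A) = 0" if "v \<in> P" for v A
        using lookup_chains[OF u, of A] \<open>P \<in> W\<close> that by (simp add: ideal_deg_iff vanishes_at_def)
      then show ?thesis by (simp add: vanishes_at_def eval_contr contr_0)
    qed
    ultimately show ?thesis using lookup_koszul[of u n B] k by (auto simp: ideal_deg_iff)
  qed
  then have "koszul u \<in> chains n W p (q + 1)"
    using keys_koszul[OF k] unfolding chains_def by blast
  then show ?thesis using koszul_koszul[OF k] by (simp add: koszul_ker_def)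
qed

lemma subspace_koszul_image:
  assumes V: "chain.subspace V"
  shows "chain.subspace (koszul ` V)"
proof (rule chain.subspaceI)
  have "koszul 0 \<in> koszul ` V" using chain.subspace_0[OF V] by (rule imageI)
  then show "0 \<in> koszul ` V" by simp
  fix a b :: "'a chain" and c :: 'a
  assume "a \<in> koszul ` V"
  then obtain a' where a: "a = koszul a'" "a' \<in> V" by blast
  have "koszul (cscale c a') \<in> koszul ` V" using chain.subspace_scale[OF V a(2)] by (rule imageI)
  then show "cscale c a \<in> koszul ` V" by (simp add: a(1) koszul_cscale)
  assume "b \<in> koszul ` V"
  then obtain b' where b: "b = koszul b'" "b' \<in> V" by blast
  have "koszul (a' + b') \<in> koszul ` V" using chain.subspace_add[OF V a(2) b(2)] by (rule imageI)
  then show "a + b \<in> koszul ` V" by (simp add: a(1) b(1) koszul_add)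
qed

text \<open>Condition (b) is contradicted at i = p and m = q + p + 1. The kernel for
  \<open>X\<close> being zero, the predicted rank is the smaller of the dimensions of the source and
  of the cycles. The kernel element \<open>x\<close> makes the rank smaller than the former, so it
  would equal the latter, and \<open>y\<close> would be a boundary.\<close>

lemma not_predicted_subset_resolution:
  assumes X: "koszul_ker n X (Suc p) q = {0}"
    and x: "x \<in> koszul_ker n Y (Suc p) q" "x \<noteq> 0"
    and y: "y \<in> koszul_ker n Y p (q + 1)" "y \<notin> koszul ` chains n Y (Suc p) q"
  shows "\<not> predicted_subset_resolution n X Y"
proof
  assume "predicted_subset_resolution n X Y"
  then have *: "int (koszul_rank n Y (p + 1) (m - int p - 1)) =
       min (int (chain.dim (chains n Y (p + 1) (m - int p - 1)))
              - int (chain.dim (koszul_ker n X (p + 1) (m - int p - 1))))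
           (int (chain.dim (koszul_ker n Y p (m - int p))))" for m :: int
    unfolding predicted_subset_resolution_def by blast
  have "chain.dim {0::'a chain} = 0"
    using chain.dim_le_card[of "{0}" "{}"] by simp
  then have rank: "chain.dim (koszul ` chains n Y (Suc p) q) =
      min (chain.dim (chains n Y (Suc p) q)) (chain.dim (koszul_ker n Y p (q + 1)))"
    using *[of "q + int p + 1"] X by (simp add: koszul_rank_def add.commute)
  obtain T where T: "finite T" "chains n Y (Suc p) q \<subseteq> chain.span T"
    using finite_dim_chains[of n Y "Suc p" q] by metis
  have "chain.dim (koszul ` chains n Y (Suc p) q) < chain.dim (chains n Y (Suc p) q)"
  proof (rule dim_koszul_image_less[OF T _ x(2)])
    show "x \<in> chains n Y (Suc p) q" "koszul x = 0" using x(1) unfolding koszul_ker_def by blast+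
  qed
  then have dim: "chain.dim (koszul ` chains n Y (Suc p) q) = chain.dim (koszul_ker n Y p (q + 1))"
    using rank by simp
  obtain T' where T': "finite T'" "chains n Y p (q + 1) \<subseteq> chain.span T'"
    using finite_dim_chains[of n Y p "q + 1"] by metis
  note sub = subspace_koszul_image[OF subspace_chains[of n Y "Suc p" q]]
  have "koszul_ker n Y p (q + 1) \<subseteq> koszul ` chains n Y (Suc p) q"
  proof (rule dim_eq_imp_subset[OF T'(1) _ sub _ dim])
    show "koszul_ker n Y p (q + 1) \<subseteq> chain.span T'" using T'(2) unfolding koszul_ker_def by blast
    show "koszul ` chains n Y (Suc p) q \<subseteq> koszul_ker n Y p (q + 1)" using koszul_chains by blast
  qed
  then show False using y by blast
qed

section \<open>Quadrics\<close>

lemma mdeg_eq_2: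
  assumes "Poly_Mapping.keys m \<subseteq> {..n::nat}" "mdeg m = 2"
  shows "\<exists>t\<le>n. \<exists>s\<le>t. m = Poly_Mapping.single s 1 + Poly_Mapping.single t 1"
proof -
  have "m \<noteq> 0" using assms(2) by (auto simp: mdeg_def)
  then obtain t where t: "t \<in> Poly_Mapping.keys m"
    by (metis ex_in_conv keys_eq_empty)
  define m' where "m' = m - Poly_Mapping.single t 1"
  have m: "m = m' + Poly_Mapping.single t 1"
    using t by (intro poly_mapping_eqI) (auto simp: m'_def lookup_add lookup_minus lookup_single when_def in_keys_iff)
  have "mdeg m' = 1" using assms(2) unfolding m mdeg_add by (simp add: mdeg_def[of "Poly_Mapping.single t _"])
  then obtain s where s: "s \<in> Poly_Mapping.keys m'" "Poly_Mapping.lookup m' s = 1"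
      "\<And>j. j \<in> Poly_Mapping.keys m' \<Longrightarrow> s \<noteq> j \<Longrightarrow> Poly_Mapping.lookup m' j = 0"
    unfolding mdeg_def sum_eq_1_iff[OF finite_keys[of m']] by blast
  have m': "m' = Poly_Mapping.single s 1"
  proof (rule poly_mapping_eqI)
    fix j show "Poly_Mapping.lookup m' j = Poly_Mapping.lookup (Poly_Mapping.single s 1) j"
      using s by (cases "j = s") (auto simp: lookup_single when_def in_keys_iff)
  qed
  have "s \<in> Poly_Mapping.keys m" unfolding m m' by (simp add: in_keys_iff lookup_add)
  then have "s \<le> n" "t \<le> n" using t assms(1) by auto
  show ?thesis
  proof (cases "s \<le> t")
    case True
    then show ?thesis using m m' \<open>t \<le> n\<close> by blast
  next
    case False
    then show ?thesis using m m' \<open>s \<le> n\<close> by (metis add.commute nat_le_linear)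
  qed
qed

definition pair_monom :: "nat \<Rightarrow> nat \<Rightarrow> nat \<Rightarrow>\<^sub>0 nat"
  where "pair_monom s t = Poly_Mapping.single s 1 + Poly_Mapping.single t 1"

lemma lookup_pair_monom: "Poly_Mapping.lookup (pair_monom s t) i = (if i = s then 1 else 0) + (if i = t then 1 else 0)"
  by (simp add: pair_monom_def lookup_add lookup_single when_def)

lemma pair_monom_inject:
  assumes "s \<le> t" "s' \<le> t'" "pair_monom s t = pair_monom s' t'"
  shows "s = s' \<and> t = t'"
proof -
  have e: "i \<in> {s, t} \<longleftrightarrow> i \<in> {s', t'}" for i
    using arg_cong[OF assms(3), of "\<lambda>m. Poly_Mapping.lookup m i"]
    by (auto simp: lookup_pair_monom split: if_splits)
  show ?thesis using e[of s] e[of t] e[of s'] e[of t'] assms(1,2) by auto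
qed

text \<open>Quadrics are written as sums over s at most t, one coefficient for each monomial, so no
  division by 2 occurs and the characteristic is arbitrary.\<close>

definition quad_coeff :: "(nat, 'k::field) mpoly \<Rightarrow> nat \<Rightarrow> nat \<Rightarrow> 'k"
  where "quad_coeff q s t = Poly_Mapping.lookup q (pair_monom s t)"

lemma quadric_eq:
  assumes "q \<in> polyS_deg n 2"
  shows "q = (\<Sum>t\<le>n. \<Sum>s\<le>t. Poly_Mapping.single (pair_monom s t) (quad_coeff q s t))"
proof -
  let ?I = "SIGMA t:{..n}. {..t}"
  have inj: "inj_on (\<lambda>(t, s). pair_monom s t) ?I"
    by (rule inj_onI) (auto dest: pair_monom_inject)
  have "q = (\<Sum>m\<in>Poly_Mapping.keys q. Poly_Mapping.single m (Poly_Mapping.lookup q m))"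
    by (rule poly_mapping_eq_sum_single)
  also have "\<dots> = (\<Sum>m\<in>(\<lambda>(t, s). pair_monom s t) ` ?I. Poly_Mapping.single m (Poly_Mapping.lookup q m))"
  proof (rule sum.mono_neutral_left)
    show "Poly_Mapping.keys q \<subseteq> (\<lambda>(t, s). pair_monom s t) ` ?I"
    proof
      fix m assume "m \<in> Poly_Mapping.keys q"
      then have "Poly_Mapping.keys m \<subseteq> {..n}" "mdeg m = 2"
        using assms by (auto simp: polyS_deg_def polyS_def)
      from mdeg_eq_2[OF this] show "m \<in> (\<lambda>(t, s). pair_monom s t) ` ?I"
        unfolding pair_monom_def by force
    qed
  qed (auto simp: not_in_keys_iff_lookup_eq_zero)
  also have "\<dots> = (\<Sum>t\<le>n. \<Sum>s\<le>t. Poly_Mapping.single (pair_monom s t) (quad_coeff q s t))"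
    unfolding sum.reindex[OF inj] by (simp add: sum.Sigma quad_coeff_def case_prod_beta)
  finally show ?thesis .
qed

lemma eval_quadric:
  assumes "q \<in> polyS_deg n 2"
  shows "eval v q = (\<Sum>t\<le>n. \<Sum>s\<le>t. quad_coeff q s t * (v s * v t))"
  by (subst quadric_eq[OF assms]) (simp add: eval_sum pair_monom_def monom_val_add)

section \<open>Independent points\<close>

definition pairing :: "nat \<Rightarrow> (nat \<Rightarrow> 'k::field) \<Rightarrow> (nat \<Rightarrow> 'k) \<Rightarrow> 'k"
  where "pairing n m p = (\<Sum>i\<le>n. m i * p i)"

text \<open>A dual way to say that the vectors span the space; for \<open>Suc n\<close> of them it
  means that they form a basis.\<close>

definition indep_points :: "nat \<Rightarrow> (nat \<Rightarrow> nat \<Rightarrow> 'k::field) \<Rightarrow> nat set \<Rightarrow> bool"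
  where "indep_points n v J \<longleftrightarrow> (\<forall>m. (\<forall>j\<in>J. pairing n m (v j) = 0) \<longrightarrow> (\<forall>i\<le>n. m i = 0))"

lemma pairing_cmult: "pairing n (\<lambda>i. c * m i) p = c * pairing n m p"
  by (simp add: pairing_def sum_distrib_left mult_ac)

lemma pairing_unit: "i \<le> n \<Longrightarrow> pairing n (\<lambda>l. if l = i then 1 else 0) p = p i"
  by (simp add: pairing_def if_distrib[of "\<lambda>x. x * _"] cong: if_cong)

text \<open>The \<open>n\<close> points other than \<open>k\<close> leave a nonzero linear form
  vanishing at them; by independence it does not vanish at \<open>v k\<close> and can be
  normalized.\<close>

lemma dual_form:
  assumes J: "indep_points n v J" "finite J" "card J = Suc n" "k \<in> J"
  shows "\<exists>x. \<forall>j\<in>J. pairing n x (v j) = (if j = k then 1 else 0)"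
proof -
  have "card (J - {k}) < card {..n}" using J by simp
  then obtain m where m: "\<forall>j\<in>J - {k}. (\<Sum>i\<in>{..n}. v j i * m i) = 0" "\<exists>i\<in>{..n}. m i \<noteq> 0"
    using underdetermined_system[of "{..n}" "J - {k}" v] J(2) by auto
  have 0: "pairing n m (v j) = 0" if "j \<in> J" "j \<noteq> k" for j
    using m(1) that by (simp add: pairing_def mult.commute)
  then have k: "pairing n m (v k) \<noteq> 0"
    using J(1) m(2) unfolding indep_points_def by (metis atMost_iff)
  show ?thesis
    by (rule exI[of _ "\<lambda>i. inverse (pairing n m (v k)) * m i"])
      (use 0 k in \<open>simp add: pairing_cmult del: mult_eq_0_iff\<close>)
qed

lemma dual_basis:
  assumes "indep_points n v J" "finite J" "card J = Suc n"
  shows "\<exists>x. \<forall>k\<in>J. \<forall>j\<in>J. pairing n (x k) (v j) = (if j = k then 1 else 0)"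
  using dual_form[OF assms] by (intro bchoice) blast

lemma dual_basis_expansion:
  assumes J: "indep_points n v J" "finite J"
    and x: "\<forall>k\<in>J. \<forall>j\<in>J. pairing n (x k) (v j) = (if j = k then 1 else 0)" and i: "i \<le> n"
  shows "p i = (\<Sum>k\<in>J. pairing n (x k) p * v k i)"
proof -
  \<comment> \<open>This linear form is the \<open>i\<close>-th coordinate minus the
    \<open>i\<close>-th coordinate of the expansion. It vanishes on the basis, hence
    identically.\<close>
  define m where "m = (\<lambda>l. (if l = i then 1 else 0) - (\<Sum>k\<in>J. v k i * x k l))"
  have m: "pairing n m q = q i - (\<Sum>k\<in>J. v k i * pairing n (x k) q)" for q
  proof -
    have "pairing n m q = pairing n (\<lambda>l. if l = i then 1 else 0) q - (\<Sum>l\<le>n. \<Sum>k\<in>J. v k i * (x k l * q l))"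
      by (simp only: pairing_def m_def left_diff_distrib sum_subtractf sum_distrib_right mult.assoc)
    also have "\<dots> = q i - (\<Sum>k\<in>J. \<Sum>l\<le>n. v k i * (x k l * q l))"
      by (subst sum.swap) (simp add: pairing_unit[OF i])
    finally show ?thesis by (simp add: pairing_def sum_distrib_left)
  qed
  have "pairing n m (v j) = 0" if "j \<in> J" for j
  proof -
    have "(\<Sum>k\<in>J. v k i * pairing n (x k) (v j)) = (\<Sum>k\<in>J. if k = j then v j i else 0)"
      using x that by (intro sum.cong) auto
    then show ?thesis using that J(2) by (simp add: m)
  qed
  then have "\<forall>i\<le>n. m i = 0" using J(1) unfolding indep_points_def by blast
  then have "pairing n m p = 0" by (simp add: pairing_def)
  then show ?thesis unfolding m by (simp add: mult.commute)
qed

definition linear_form :: "nat \<Rightarrow> (nat \<Rightarrow> 'k::field) \<Rightarrow> (nat, 'k) mpoly"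
  where "linear_form n m = (\<Sum>i\<le>n. Const (m i) * Var i)"

lemma eval_linear_form [simp]: "eval p (linear_form n m) = pairing n m p"
  by (simp add: linear_form_def pairing_def eval_sum)

lemma linear_form_deg: "linear_form n m \<in> polyS_deg n 1"
  unfolding linear_form_def by (intro polyS_deg_sum polyS_deg_Const_mult polyS_deg_Var) simp

text \<open>The quadric is a pair of hyperplanes missing \<open>v a\<close>, one through n - 1 of
  the other points and one through the rest. Up to \<open>n\<close> of the other points together
  with \<open>a\<close> extend to \<open>Suc n\<close> independent points, whose dual form at
  \<open>a\<close> gives such a hyperplane.\<close>

lemma separating_quadric:
  assumes fin: "finite Y" and card: "Suc n \<le> card Y" "card Y \<le> 2 * n - 1" and a: "a \<in> Y"
    and indep: "\<And>J. J \<subseteq> Y \<Longrightarrow> card J = Suc n \<Longrightarrow> indep_points n v J"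
  shows "\<exists>q \<in> polyS_deg n 2. eval (v a) q \<noteq> 0 \<and> (\<forall>j\<in>Y - {a}. eval (v j) q = 0)"
proof -
  have line: "\<exists>l \<in> polyS_deg n 1. eval (v a) l \<noteq> 0 \<and> (\<forall>j\<in>S. eval (v j) l = 0)"
    if S: "S \<subseteq> Y - {a}" "card S \<le> n" for S
  proof -
    have finS: "finite S" using S(1) fin finite_subset by blast
    have "card (insert a S) \<le> Suc n" using finS S(2) by (simp add: card_insert_if)
    moreover have "insert a S \<subseteq> Y" using S(1) a by blast
    ultimately obtain J where J: "insert a S \<subseteq> J" "J \<subseteq> Y" "card J = Suc n"
      using exists_subset_between[of "insert a S" "Suc n" Y] card(1) fin by blast
    have "finite J" using J(2) fin finite_subset by blast
    then obtain x where x: "\<forall>j\<in>J. pairing n x (v j) = (if j = a then 1 else 0)"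
      using dual_form[OF indep[OF J(2,3)] _ J(3), of a] J(1) by blast
    have "pairing n x (v j) = 0" if "j \<in> S" for j
    proof -
      have "j \<in> J" "j \<noteq> a" using that J(1) S(1) by blast+
      then show ?thesis using x by simp
    qed
    moreover have "pairing n x (v a) = 1" using x J(1) by simp
    ultimately show ?thesis
      by (intro bexI[of _ "linear_form n x"]) (auto simp: linear_form_deg)
  qed
  have cY: "card (Y - {a}) = card Y - 1" using a by simp
  obtain S where S: "S \<subseteq> Y - {a}" "card S = n - 1"
    using obtain_subset_with_card_n[of "n - 1" "Y - {a}"] cY card(1) by (metis Suc_leD diff_le_mono)
  have "card (Y - {a} - S) \<le> n"
    using S cY card fin finite_subset[OF S(1)] by (subst card_Diff_subset) auto
  then obtain l' where l': "l' \<in> polyS_deg n 1" "eval (v a) l' \<noteq> 0" "\<forall>j\<in>Y - {a} - S. eval (v j) l' = 0"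
    using line[of "Y - {a} - S"] by blast
  obtain l where l: "l \<in> polyS_deg n 1" "eval (v a) l \<noteq> 0" "\<forall>j\<in>S. eval (v j) l = 0"
    using line[OF S(1)] S(2) by auto
  show ?thesis
    using l l' polyS_deg_mult[OF l(1) l'(1)] by (intro bexI[of _ "l * l'"]) auto
qed

section \<open>Contraction with vectors of a three-dimensional space\<close>

text \<open>A nonzero \<open>p\<close> in the span of independent b0, b1, b2 divides their wedge
  product, so contraction with all three factors through contraction with \<open>p\<close>. In the
  proof, the vector with a nonzero coefficient is exchanged for \<open>p\<close>, and alternation
  removes the other terms.\<close>

lemma contr_triple_zero:
  fixes p :: "nat \<Rightarrow> 'k::field"
  assumes p: "\<And>i. i \<le> n \<Longrightarrow> p i = \<beta>0 * b0 i + \<beta>1 * b1 i + \<beta>2 * b2 i"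
    and nz: "\<beta>0 \<noteq> 0 \<or> \<beta>1 \<noteq> 0 \<or> \<beta>2 \<noteq> 0" and h: "\<And>B. contr n p h B = 0"
  shows "contr n b0 (contr n b1 (contr n b2 h)) B = 0"
proof -
  let ?C = "contr n"
  have "\<beta>0 * ?C b0 h B + \<beta>1 * ?C b1 h B + \<beta>2 * ?C b2 h B = ?C p h B" for B
  proof -
    have "?C p h B = ?C (\<lambda>i. (\<beta>0 * b0 i + \<beta>1 * b1 i) + \<beta>2 * b2 i) h B" by (rule contr_cong) (simp_all add: p)
    then show ?thesis by (simp only: contr_vec_add contr_vec_cmult)
  qed
  then have *: "(\<lambda>B. (\<beta>0 * ?C b0 h B + \<beta>1 * ?C b1 h B) + \<beta>2 * ?C b2 h B) = (\<lambda>B. 0)" by (simp add: h)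
  \<comment> \<open>The relation expressing contraction with \<open>p\<close> is contracted with two
    further vectors, to be chosen among b0, b1, b2.\<close>
  have D: "\<beta>0 * ?C x (?C y (?C b0 h)) B + \<beta>1 * ?C x (?C y (?C b1 h)) B + \<beta>2 * ?C x (?C y (?C b2 h)) B = 0" for x y
  proof -
    have fn: "?C y (\<lambda>B. (\<beta>0 * ?C b0 h B + \<beta>1 * ?C b1 h B) + \<beta>2 * ?C b2 h B) =
        (\<lambda>B. (\<beta>0 * ?C y (?C b0 h) B + \<beta>1 * ?C y (?C b1 h) B) + \<beta>2 * ?C y (?C b2 h) B)"
      by (rule ext) (simp only: contr_add contr_cmult)
    have "?C x (?C y (\<lambda>B. (\<beta>0 * ?C b0 h B + \<beta>1 * ?C b1 h B) + \<beta>2 * ?C b2 h B)) B =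
        \<beta>0 * ?C x (?C y (?C b0 h)) B + \<beta>1 * ?C x (?C y (?C b1 h)) B + \<beta>2 * ?C x (?C y (?C b2 h)) B"
      unfolding fn by (simp only: contr_add contr_cmult)
    moreover have "?C y (\<lambda>B. 0) = (\<lambda>B. 0)" by (rule ext) (rule contr_0)
    ultimately show ?thesis unfolding * by (simp add: contr_0)
  qed
  have right: "?C x (?C y (?C y h)) B = 0" for x y
  proof -
    have "?C y (?C y h) = (\<lambda>B. 0)" by (rule ext) (rule contr_contr_self)
    then show ?thesis by (simp add: contr_0)
  qed
  have swap: "?C x (?C y (?C z h)) B = - ?C x (?C z (?C y h)) B" for x y z
  proof -
    have "?C y (?C z h) = (\<lambda>B. - ?C z (?C y h) B)" by (rule ext) (rule contr_anticommute)
    then show ?thesis by (simp add: contr_uminus)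
  qed
  have outer: "?C x (?C y (?C x h)) B = 0" for x y
    using swap[of x y x] by (simp add: contr_contr_self)
  consider "\<beta>0 \<noteq> 0" | "\<beta>1 \<noteq> 0" | "\<beta>2 \<noteq> 0" using nz by blast
  then show ?thesis
  proof cases
    case 1
    have "?C b1 (?C b2 (?C b0 h)) B = ?C b0 (?C b1 (?C b2 h)) B"
      using swap[of b1 b2 b0] contr_anticommute[of n b1 b0 "?C b2 h" B] by simp
    then show ?thesis using 1 D[of b1 b2] by (simp add: right outer)
  next
    case 2
    then show ?thesis using D[of b0 b2] swap[of b0 b2 b1] by (simp add: right outer)
  next
    case 3
    then show ?thesis using D[of b0 b1] by (simp add: right outer)
  qed
qed

text \<open>Since \<open>ext_mult\<close> multiplies on the right, \<open>\<theta>\<close> is the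
  trivector m_2 wedge m_1 wedge m_0. The value is -1 because contraction passes m_2 over two
  factors, m_1 over one and m_0 over none.\<close>

lemma contr_ext_mult_triple:
  fixes b m :: "nat \<Rightarrow> nat \<Rightarrow> 'k::field"
  assumes dual: "\<And>i j. i < 3 \<Longrightarrow> j < 3 \<Longrightarrow> pairing n (m i) (b j) = (if i = j then 1 else 0)"
    and w: "\<And>i. i < 3 \<Longrightarrow> pairing n (m i) w = 0"
  defines "\<theta> \<equiv> ext_mult n (m 0) (ext_mult n (m 1) (ext_mult n (m 2) (\<lambda>A. if A = {} then 1 else 0)))"
  shows "contr n (b 0) (contr n (b 1) (contr n (b 2) \<theta>)) {} = - 1" and "contr n w \<theta> B = 0"
    and "\<And>A. \<theta> A \<noteq> 0 \<Longrightarrow> A \<subseteq> {..n} \<and> card A = 3"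
proof -
  let ?C = "contr n" and ?E = "ext_mult n"
  define \<delta> where "\<delta> = (\<lambda>A :: nat set. if A = {} then 1 else 0 :: 'k)"
  have pair: "(\<Sum>i\<le>n. v i * l i) = pairing n l v" for v l :: "nat \<Rightarrow> 'k"
    by (simp add: pairing_def mult.commute)
  have C\<delta>: "?C v \<delta> = (\<lambda>B. 0)" for v by (rule ext) (auto simp: contr_def \<delta>_def intro!: sum.neutral)
  have \<delta>0: "\<delta> A = 0" if "\<not> A \<subseteq> {..n}" for A using that by (auto simp: \<delta>_def)
  have E0: "?E l (\<lambda>B. 0) = (\<lambda>B. 0)" for l :: "nat \<Rightarrow> 'k" by (rule ext) (rule ext_mult_0)
  have CE: "?C v (?E l \<eta>) = (\<lambda>B. pairing n l v * \<eta> B - ?E l (?C v \<eta>) B)"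
    if "\<And>A. \<not> A \<subseteq> {..n} \<Longrightarrow> \<eta> A = 0" for v l and \<eta> :: "nat set \<Rightarrow> 'k"
    by (rule ext) (simp add: contr_ext_mult[OF that] pair)
  have C1: "?C v (?E l \<delta>) = (\<lambda>B. pairing n l v * \<delta> B)" for v l
    by (subst CE[OF \<delta>0]) (simp_all add: C\<delta> E0)
  have C2: "?C v (?E l (?E l' \<delta>)) = (\<lambda>B. pairing n l v * ?E l' \<delta> B - ?E l (\<lambda>B. pairing n l' v * \<delta> B) B)" for v l l'
    by (subst CE) (simp_all add: C1 ext_mult_outside)
  have C3: "?C v \<theta> = (\<lambda>B. pairing n (m 0) v * ?E (m 1) (?E (m 2) \<delta>) B -
      ?E (m 0) (\<lambda>B. pairing n (m 1) v * ?E (m 2) \<delta> B - ?E (m 1) (\<lambda>B. pairing n (m 2) v * \<delta> B) B) B)" for v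
    unfolding \<theta>_def \<delta>_def[symmetric] by (subst CE) (simp_all add: C2 ext_mult_outside)
  have "?C (b 2) \<theta> = ?E (m 0) (?E (m 1) \<delta>)"
    unfolding C3 by (simp add: dual E0 ext_mult_uminus)
  moreover have "?C (b 1) (?E (m 0) (?E (m 1) \<delta>)) = (\<lambda>B. - ?E (m 0) \<delta> B)"
    unfolding C2 by (simp add: dual)
  moreover have "?C (b 0) (\<lambda>B. - ?E (m 0) \<delta> B) {} = - 1"
    unfolding contr_uminus C1 by (simp add: dual) (simp add: \<delta>_def)
  ultimately show "?C (b 0) (?C (b 1) (?C (b 2) \<theta>)) {} = - 1" by simp
  show "?C w \<theta> B = 0"
    unfolding C3 by (simp add: w E0)
  fix A assume A: "\<theta> A \<noteq> 0"
  then have "A \<subseteq> {..n}" unfolding \<theta>_def using ext_mult_outside by metis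
  moreover have "card A = Suc (Suc (Suc 0))"
  proof (rule ext_mult_card)
    show "?E (m 0) (?E (m 1) (?E (m 2) \<delta>)) A \<noteq> 0" using A by (simp add: \<theta>_def \<delta>_def)
    fix A' assume A': "?E (m 1) (?E (m 2) \<delta>) A' \<noteq> 0"
    show "card A' = Suc (Suc 0)"
    proof (rule ext_mult_card[OF _ A'])
      fix A'' assume A'': "?E (m 2) \<delta> A'' \<noteq> 0"
      show "card A'' = Suc 0" by (rule ext_mult_card[OF _ A'']) (simp add: \<delta>_def split: if_splits)
    qed
  qed
  ultimately show "A \<subseteq> {..n} \<and> card A = 3" by simp
qed

section \<open>A quadratic identity\<close>

text \<open>
  The symmetric tensor \<open>\<Sum>\<^sub>k v\<^sub>k \<otimes> v\<^sub>k / c\<^sub>k\<close> is inverse to the diagonal form \<open>\<Sum>\<^sub>k c\<^sub>k x\<^sub>k\<^sup>2\<close>; the \<open>v\<^sub>a\<close> are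
  orthogonal of norms \<open>d\<^sub>a\<close> for this form, and \<open>r\<^sub>k\<close> is the orthogonal projection of \<open>v\<^sub>k\<close> to their complement.
\<close>

lemma orthogonal_projection_tensor:
  fixes v r :: "nat \<Rightarrow> nat \<Rightarrow> 'k::field"
  assumes fin: "finite K" "finite A" and c: "\<And>k. k \<in> K \<Longrightarrow> c k \<noteq> 0" and d: "\<And>a. a \<in> A \<Longrightarrow> d a \<noteq> 0"
    and g: "\<And>a i. a \<in> A \<Longrightarrow> i \<le> n \<Longrightarrow> v a i = (\<Sum>k\<in>K. g a k * v k i)"
    and orth: "\<And>a b. a \<in> A \<Longrightarrow> b \<in> A \<Longrightarrow> (\<Sum>k\<in>K. c k * g a k * g b k) = (if a = b then d a else 0)"
    and r: "\<And>k i. k \<in> K \<Longrightarrow> i \<le> n \<Longrightarrow> r k i = v k i - (\<Sum>a\<in>A. c k * g a k / d a * v a i)"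
    and st: "s \<le> n" "t \<le> n"
  shows "(\<Sum>k\<in>K. r k s * r k t / c k) = (\<Sum>k\<in>K. v k s * v k t / c k) - (\<Sum>a\<in>A. v a s * v a t / d a)"
proof -
  define S where "S = (\<Sum>a\<in>A. v a s * v a t / d a)"
  have "r k s * r k t / c k = v k s * v k t / c k
      - (\<Sum>a\<in>A. g a k * v k s / d a * v a t) - (\<Sum>a\<in>A. g a k * v k t / d a * v a s)
      + (\<Sum>a\<in>A. \<Sum>b\<in>A. c k * g a k * g b k * (v a s / d a * (v b t / d b)))" if k: "k \<in> K" for k
  proof -
    \<comment> \<open>With this \<open>x\<close>, r_k = v_k - c_k x, so dividing the product by c_k
      leaves c_k only in front of the quadratic term in \<open>x\<close>.\<close>
    define x where "x = (\<lambda>i. \<Sum>a\<in>A. g a k / d a * v a i)"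
    have rx: "r k i = v k i - c k * x i" if "i \<le> n" for i
      using r[OF k that] by (simp add: x_def sum_distrib_left mult_ac)
    have "r k s * r k t / c k = v k s * v k t / c k - v k s * x t - v k t * x s + c k * (x s * x t)"
      using c[OF k] unfolding rx[OF st(1)] rx[OF st(2)] by (simp add: field_simps)
    moreover have "v k s * x t = (\<Sum>a\<in>A. g a k * v k s / d a * v a t)"
      "v k t * x s = (\<Sum>a\<in>A. g a k * v k t / d a * v a s)"
      by (simp_all add: x_def sum_distrib_left mult_ac)
    moreover have "c k * (x s * x t) = (\<Sum>a\<in>A. \<Sum>b\<in>A. c k * g a k * g b k * (v a s / d a * (v b t / d b)))"
    proof -
      have "x s * x t = (\<Sum>a\<in>A. \<Sum>b\<in>A. g a k / d a * v a s * (g b k / d b * v b t))"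
        unfolding x_def by (rule sum_product)
      then show ?thesis by (simp add: sum_distrib_left mult_ac)
    qed
    ultimately show ?thesis by simp
  qed
  then have "(\<Sum>k\<in>K. r k s * r k t / c k) = (\<Sum>k\<in>K. v k s * v k t / c k)
      - (\<Sum>k\<in>K. \<Sum>a\<in>A. g a k * v k s / d a * v a t) - (\<Sum>k\<in>K. \<Sum>a\<in>A. g a k * v k t / d a * v a s)
      + (\<Sum>k\<in>K. \<Sum>a\<in>A. \<Sum>b\<in>A. c k * g a k * g b k * (v a s / d a * (v b t / d b)))"
    by (simp add: sum.distrib sum_subtractf)
  \<comment> \<open>Both mixed sums equal \<open>S\<close> because the expansion of v_a in the v_k
    reassembles. By orthogonality the double sum keeps only a = b and also equals \<open>S\<close>;
    the total is -S - S + S.\<close>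
  moreover have "(\<Sum>k\<in>K. \<Sum>a\<in>A. g a k * v k s / d a * v a t) = S"
  proof -
    have "(\<Sum>k\<in>K. \<Sum>a\<in>A. g a k * v k s / d a * v a t) = (\<Sum>a\<in>A. (\<Sum>k\<in>K. g a k * v k s) / d a * v a t)"
      by (subst sum.swap) (simp add: sum_distrib_right sum_divide_distrib)
    then show ?thesis unfolding S_def by (simp add: g[OF _ st(1), symmetric])
  qed
  moreover have "(\<Sum>k\<in>K. \<Sum>a\<in>A. g a k * v k t / d a * v a s) = S"
  proof -
    have "(\<Sum>k\<in>K. \<Sum>a\<in>A. g a k * v k t / d a * v a s) = (\<Sum>a\<in>A. (\<Sum>k\<in>K. g a k * v k t) / d a * v a s)"
      by (subst sum.swap) (simp add: sum_distrib_right sum_divide_distrib)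
    then show ?thesis unfolding S_def by (simp add: g[OF _ st(2), symmetric] mult_ac)
  qed
  moreover have "(\<Sum>k\<in>K. \<Sum>a\<in>A. \<Sum>b\<in>A. c k * g a k * g b k * (v a s / d a * (v b t / d b))) = S"
  proof -
    have "(\<Sum>k\<in>K. \<Sum>a\<in>A. \<Sum>b\<in>A. c k * g a k * g b k * (v a s / d a * (v b t / d b))) =
        (\<Sum>a\<in>A. \<Sum>b\<in>A. \<Sum>k\<in>K. c k * g a k * g b k * (v a s / d a * (v b t / d b)))"
      by (subst sum.swap) (simp add: sum.swap[of _ K])
    also have "\<dots> = (\<Sum>a\<in>A. \<Sum>b\<in>A. if b = a then d a * (v a s / d a * (v b t / d b)) else 0)"
      unfolding sum_distrib_right[symmetric] by (intro sum.cong refl) (simp add: orth)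
    also have "\<dots> = S" unfolding S_def using fin d by (intro sum.cong) (auto simp: sum.delta)
    finally show ?thesis .
  qed
  ultimately show ?thesis unfolding S_def by simp
qed

text \<open>The coefficients range over ordered pairs and are not unique; this form lets an identity
  between tensors be applied entry by entry.\<close>

definition quadratic_fun :: "nat \<Rightarrow> ((nat \<Rightarrow> 'k::field) \<Rightarrow> 'k) \<Rightarrow> bool"
  where "quadratic_fun n F \<longleftrightarrow> (\<exists>C. \<forall>p. F p = (\<Sum>t\<le>n. \<Sum>s\<le>n. C s t * (p s * p t)))"

lemma quadratic_fun_0: "quadratic_fun n (\<lambda>p. 0)"
  unfolding quadratic_fun_def by (intro exI[of _ "\<lambda>_ _. 0"]) simp

lemma quadratic_fun_add:
  assumes "quadratic_fun n F" "quadratic_fun n G"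
  shows "quadratic_fun n (\<lambda>p. F p + G p)"
proof -
  obtain C D where "\<And>p. F p = (\<Sum>t\<le>n. \<Sum>s\<le>n. C s t * (p s * p t))"
    "\<And>p. G p = (\<Sum>t\<le>n. \<Sum>s\<le>n. D s t * (p s * p t))"
    using assms unfolding quadratic_fun_def by blast
  then show ?thesis
    unfolding quadratic_fun_def
    by (intro exI[of _ "\<lambda>s t. C s t + D s t"]) (simp add: distrib_right sum.distrib)
qed

lemma quadratic_fun_cmult:
  assumes "quadratic_fun n F"
  shows "quadratic_fun n (\<lambda>p. c * F p)"
proof -
  obtain C where "\<And>p. F p = (\<Sum>t\<le>n. \<Sum>s\<le>n. C s t * (p s * p t))"
    using assms unfolding quadratic_fun_def by blast
  then show ?thesis
    unfolding quadratic_fun_def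
    by (intro exI[of _ "\<lambda>s t. c * C s t"]) (simp add: sum_distrib_left mult.assoc)
qed

lemma quadratic_fun_sum: "(\<And>i. i \<in> I \<Longrightarrow> quadratic_fun n (F i)) \<Longrightarrow> quadratic_fun n (\<lambda>p. \<Sum>i\<in>I. F i p)"
  by (induction I rule: infinite_finite_induct) (simp_all add: quadratic_fun_0 quadratic_fun_add)

lemma quadratic_fun_eval:
  assumes "q \<in> polyS_deg n 2"
  shows "quadratic_fun n (\<lambda>p. eval p q)"
  unfolding quadratic_fun_def
proof (intro exI allI)
  fix p :: "nat \<Rightarrow> 'a"
  show "eval p q = (\<Sum>t\<le>n. \<Sum>s\<le>n. (if s \<le> t then quad_coeff q s t else 0) * (p s * p t))"
    unfolding eval_quadric[OF assms] by (intro sum.cong refl sum.mono_neutral_cong_left) auto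
qed

lemma quadratic_fun_contr:
  assumes "\<And>A. quadratic_fun n (\<lambda>p. \<theta> p A)"
  shows "quadratic_fun n (\<lambda>p. contr m b (\<theta> p) B)"
  using assms by (cases "B \<subseteq> {..m}")
    (auto simp: contr_def quadratic_fun_0 intro!: quadratic_fun_sum quadratic_fun_cmult)

text \<open>A quadratic function of p is linear in the tensor of p with itself, so the tensor
  identity passes to its values.\<close>

lemma orthogonal_projection_quadratic:
  fixes v r :: "nat \<Rightarrow> nat \<Rightarrow> 'k::field"
  assumes F: "quadratic_fun n F"
    and tensor: "\<And>s t. s \<le> n \<Longrightarrow> t \<le> n \<Longrightarrow>
      (\<Sum>k\<in>K. r k s * r k t / c k) = (\<Sum>k\<in>K. v k s * v k t / c k) - (\<Sum>a\<in>A. v a s * v a t / d a)"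
  shows "(\<Sum>k\<in>K. F (r k) / c k) = (\<Sum>k\<in>K. F (v k) / c k) - (\<Sum>a\<in>A. F (v a) / d a)"
proof -
  obtain C where C: "\<And>p. F p = (\<Sum>t\<le>n. \<Sum>s\<le>n. C s t * (p s * p t))"
    using F unfolding quadratic_fun_def by blast
  have *: "(\<Sum>k\<in>I. F (u k) / e k) = (\<Sum>t\<le>n. \<Sum>s\<le>n. C s t * (\<Sum>k\<in>I. u k s * u k t / e k))"
    for I and u :: "nat \<Rightarrow> nat \<Rightarrow> 'k" and e
  proof -
    have "(\<Sum>k\<in>I. F (u k) / e k) = (\<Sum>k\<in>I. \<Sum>t\<le>n. \<Sum>s\<le>n. C s t * (u k s * u k t / e k))"
      by (simp add: C sum_divide_distrib)
    also have "\<dots> = (\<Sum>t\<le>n. \<Sum>s\<le>n. \<Sum>k\<in>I. C s t * (u k s * u k t / e k))"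
      by (subst sum.swap) (simp add: sum.swap[of _ I])
    finally show ?thesis by (simp add: sum_distrib_left)
  qed
  show ?thesis
    unfolding * by (simp add: tensor right_diff_distrib sum_subtractf)
qed

section \<open>The Koszul map is not surjective onto the cycles\<close>

text \<open>
  Here \<open>v\<close> consists of a basis \<open>K\<close> and further points \<open>A\<close>; a solution \<open>L\<close> of the conditions other than that
  at \<open>z\<close> amounts to a diagonal form in the basis \<open>K\<close> for which the points of \<open>A\<close> are orthogonal.
\<close>

definition coupled_forms_trivial :: "nat \<Rightarrow> (nat \<Rightarrow> nat \<Rightarrow> 'k::field) \<Rightarrow> nat set \<Rightarrow> nat set \<Rightarrow> nat \<Rightarrow> bool"
  where "coupled_forms_trivial n v K A z \<longleftrightarrow> (\<forall>L.
    (\<forall>i\<in>K \<union> A. \<forall>j\<in>K \<union> A. (i \<in> K \<longleftrightarrow> j \<in> K) \<and> i \<noteq> j \<longrightarrow> pairing n (L i) (v j) = 0) \<and>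
    (\<forall>k\<in>K. \<forall>a\<in>A. pairing n (L k) (v a) = pairing n (L a) (v k)) \<and>
    pairing n (L z) (v z) = 0 \<longrightarrow>
    (\<forall>j\<in>K \<union> A. \<forall>i\<le>n. L j i = 0))"

lemma pairing_sum_left: "pairing n (\<lambda>i. \<Sum>k\<in>K. m k i) p = (\<Sum>k\<in>K. pairing n (m k) p)"
  unfolding pairing_def sum_distrib_right by (rule sum.swap)

lemma pairing_sum_right: "pairing n m (\<lambda>i. \<Sum>k\<in>K. p k i) = (\<Sum>k\<in>K. pairing n m (p k))"
  unfolding pairing_def sum_distrib_left by (rule sum.swap)

lemma pairing_cmult_right: "pairing n m (\<lambda>i. c * p i) = c * pairing n m p"
  by (simp add: pairing_def sum_distrib_left mult_ac)

lemma pairing_diff_right: "pairing n m (\<lambda>i. p i - q i) = pairing n m p - pairing n m q"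
  by (simp add: pairing_def right_diff_distrib sum_subtractf)

lemma pairing_cong: "(\<And>i. i \<le> n \<Longrightarrow> p i = q i) \<Longrightarrow> pairing n m p = pairing n m q"
  by (simp add: pairing_def)

text \<open>For \<open>card K = 7\<close> and \<open>card A = 4\<close>, there are 6 orthogonality conditions on the 7 coefficients of a diagonal form.\<close>

lemma orthogonal_diagonal_form:
  fixes v :: "nat \<Rightarrow> nat \<Rightarrow> 'k::field"
  assumes K: "indep_points n v K" "finite K" "card K = Suc n"
    and A: "finite A" "K \<inter> A = {}" "card A choose 2 \<le> n"
    and triv: "\<And>z. z \<in> K \<union> A \<Longrightarrow> coupled_forms_trivial n v K A z"
  obtains c g d L where "\<And>k. k \<in> K \<Longrightarrow> c k \<noteq> 0" "\<And>a. a \<in> A \<Longrightarrow> d a \<noteq> 0"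
    "\<And>a i. a \<in> A \<Longrightarrow> i \<le> n \<Longrightarrow> v a i = (\<Sum>k\<in>K. g a k * v k i)"
    "\<And>a b. a \<in> A \<Longrightarrow> b \<in> A \<Longrightarrow> (\<Sum>k\<in>K. c k * g a k * g b k) = (if a = b then d a else 0)"
    "\<And>a k. a \<in> A \<Longrightarrow> k \<in> K \<Longrightarrow> pairing n (L a) (v k) = c k * g a k"
    "\<And>a b. a \<in> A \<Longrightarrow> b \<in> A \<Longrightarrow> pairing n (L a) (v b) = (if a = b then d a else 0)"
proof -
  obtain x where x: "\<forall>k\<in>K. \<forall>j\<in>K. pairing n (x k) (v j) = (if j = k then 1 else 0)"
    using dual_basis[OF K] by blast
  define g where "g = (\<lambda>a k. pairing n (x k) (v a))"
  have g: "v a i = (\<Sum>k\<in>K. g a k * v k i)" if "i \<le> n" for a i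
    unfolding g_def using dual_basis_expansion[OF K(1,2) x that] .
  \<comment> \<open>One equation for each unordered pair of points of \<open>A\<close>: the product
    over \<open>S\<close> is the product of the two k-th coordinates.\<close>
  let ?R = "{S. S \<subseteq> A \<and> card S = 2}"
  have "card ?R < card K" using n_subsets[OF A(1), of 2] A(3) K(3) by simp
  moreover have "finite ?R" using A(1) by simp
  ultimately obtain c where c: "\<forall>S\<in>?R. (\<Sum>k\<in>K. (\<Prod>a\<in>S. g a k) * c k) = 0" "\<exists>k\<in>K. c k \<noteq> 0"
    using underdetermined_system[OF K(2), of ?R "\<lambda>S k. \<Prod>a\<in>S. g a k"] by blast
  have orth: "(\<Sum>k\<in>K. c k * g a k * g b k) = 0" if "a \<in> A" "b \<in> A" "a \<noteq> b" for a b
  proof -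
    have "{a, b} \<in> ?R" using that by simp
    from c(1)[rule_format, OF this] show ?thesis using that by (simp add: mult_ac)
  qed
  \<comment> \<open>For k in \<open>K\<close> this is c_k times the dual form of v_k; for a in
    \<open>A\<close> it is the pairing with v_a under the diagonal form. Hence the value of L_z at
    v_z is c_z or d_z.\<close>
  define L where "L = (\<lambda>j i. if j \<in> K then c j * x j i else \<Sum>k\<in>K. c k * g j k * x k i)"
  define d where "d = (\<lambda>a. pairing n (L a) (v a))"
  have LK: "pairing n (L k) p = c k * pairing n (x k) p" if "k \<in> K" for k p
    unfolding L_def using that by (simp add: pairing_cmult)
  have LA: "pairing n (L a) p = (\<Sum>k\<in>K. c k * g a k * pairing n (x k) p)" if "a \<in> A" for a p
  proof -
    have "a \<notin> K" using that A(2) by blast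
    then show ?thesis unfolding L_def by (simp add: pairing_sum_left pairing_cmult)
  qed
  have LAK: "pairing n (L a) (v k) = c k * g a k" if "a \<in> A" "k \<in> K" for a k
  proof -
    have "pairing n (L a) (v k) = (\<Sum>l\<in>K. if l = k then c k * g a k else 0)"
      unfolding LA[OF that(1)] using x that(2) by (intro sum.cong) auto
    then show ?thesis using that K(2) by simp
  qed
  have LAA: "pairing n (L a) (v b) = (\<Sum>k\<in>K. c k * g a k * g b k)" if "a \<in> A" for a b
    unfolding LA[OF that] g_def ..
  \<comment> \<open>If this value were zero, \<open>L\<close> would solve the coupled system for
    \<open>z\<close> and vanish, so all c_k would be zero, against their choice.\<close>
  have nz: "pairing n (L z) (v z) \<noteq> 0" if z: "z \<in> K \<union> A" for z
  proof
    assume "pairing n (L z) (v z) = 0"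
    moreover have "pairing n (L i) (v j) = 0" if "i \<in> K \<union> A" "j \<in> K \<union> A" "i \<in> K \<longleftrightarrow> j \<in> K" "i \<noteq> j" for i j
    proof (cases "i \<in> K")
      case True
      then show ?thesis using x that by (simp add: LK)
    next
      case False
      then show ?thesis using that orth by (auto simp: LAA)
    qed
    moreover have "pairing n (L k) (v a) = pairing n (L a) (v k)" if "k \<in> K" "a \<in> A" for k a
      using that by (simp add: LK LAK g_def)
    ultimately have "\<forall>j\<in>K \<union> A. \<forall>i\<le>n. L j i = 0"
      using triv[OF z, unfolded coupled_forms_trivial_def, rule_format, of L] by blast
    then have "pairing n (L k) (v k) = 0" if "k \<in> K" for k
      using that by (simp add: pairing_def)
    then have "c k = 0" if "k \<in> K" for k using that x by (simp add: LK)
    then show False using c(2) by blast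
  qed
  show thesis
  proof (rule that[of c d g L])
    show "c k \<noteq> 0" if "k \<in> K" for k using nz[of k] x that by (simp add: LK)
    show "d a \<noteq> 0" if "a \<in> A" for a using nz[of a] that by (simp add: d_def)
    show "(\<Sum>k\<in>K. c k * g a k * g b k) = (if a = b then d a else 0)" if "a \<in> A" "b \<in> A" for a b
      using orth that by (simp add: d_def LAA)
    then show "pairing n (L a) (v b) = (if a = b then d a else 0)" if "a \<in> A" "b \<in> A" for a b
      using that by (simp add: LAA)
  qed (use g LAK in auto)
qed

section \<open>Chains whose coefficients vanish at given points\<close>

lemma chains_empty_iff:
  "u \<in> chains n {} p q \<longleftrightarrow>
     (\<forall>A\<in>Poly_Mapping.keys u. A \<subseteq> {..n} \<and> card A = p \<and> Poly_Mapping.lookup u A \<in> polyS_deg n q)"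
  by (auto simp: chains_def ideal_deg_iff)

text \<open>By homogeneity, one chosen representative of each point decides vanishing.\<close>

lemma chains_iff_vanishing:
  assumes P: "\<And>j. j \<in> J \<Longrightarrow> P j \<in> proj_space n" "\<And>j. j \<in> J \<Longrightarrow> v j \<in> P j"
  shows "u \<in> chains n (P ` J) p q \<longleftrightarrow>
    u \<in> chains n {} p q \<and> (\<forall>j\<in>J. \<forall>A. eval (v j) (Poly_Mapping.lookup u A) = 0)"
proof -
  have "f \<in> ideal_deg n (P ` J) q \<longleftrightarrow> f \<in> polyS_deg n q \<and> (\<forall>j\<in>J. eval (v j) f = 0)" for f
    unfolding ideal_deg_iff using vanishes_at_iff[OF _ P] by blast
  then have "u \<in> chains n (P ` J) p q \<longleftrightarrow>
    u \<in> chains n {} p q \<and> (\<forall>j\<in>J. \<forall>A\<in>Poly_Mapping.keys u. eval (v j) (Poly_Mapping.lookup u A) = 0)"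
    unfolding chains_empty_iff unfolding chains_def by auto
  also have "\<dots> \<longleftrightarrow> u \<in> chains n {} p q \<and> (\<forall>j\<in>J. \<forall>A. eval (v j) (Poly_Mapping.lookup u A) = 0)"
    by (metis eval_0 not_in_keys_iff_lookup_eq_zero)
  finally show ?thesis .
qed

lemma lookup_constant_chain:
  fixes n :: nat
  assumes "\<And>A. \<theta> A \<noteq> 0 \<Longrightarrow> A \<subseteq> {..n}"
  shows "Poly_Mapping.lookup (\<Sum>A\<in>Pow {..n}. Poly_Mapping.single A (Const (\<theta> A) * q)) B = Const (\<theta> B) * q"
proof -
  have "Poly_Mapping.lookup (\<Sum>A\<in>Pow {..n}. Poly_Mapping.single A (Const (\<theta> A) * q)) B =
      (\<Sum>A\<in>Pow {..n}. if A = B then Const (\<theta> B) * q else 0)"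
    unfolding lookup_sum by (intro sum.cong) (auto simp: lookup_single when_def)
  also have "\<dots> = Const (\<theta> B) * q"
    by (cases "\<theta> B = 0") (use assms[of B] in \<open>simp_all add: Const_simps\<close>)
  finally show ?thesis .
qed

lemma koszul_not_onto_cycles:
  fixes v :: "nat \<Rightarrow> nat \<Rightarrow> 'k::field"
  assumes fin: "finite K" "finite A" "K \<inter> A = {}" and n: "card A + 2 = n" "card A choose 2 \<le> n" "1 < n"
    and cardK: "card K = Suc n"
    and A0: "A \<noteq> {}" and cardKA: "card (K \<union> A) \<le> 2 * n - 1"
    and indep: "\<And>J. J \<subseteq> K \<union> A \<Longrightarrow> card J = Suc n \<Longrightarrow> indep_points n v J"
    and triv: "\<And>z. z \<in> K \<union> A \<Longrightarrow> coupled_forms_trivial n v K A z"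
    and P: "\<And>j. j \<in> K \<union> A \<Longrightarrow> P j \<in> proj_space n" "\<And>j. j \<in> K \<union> A \<Longrightarrow> v j \<in> P j"
  shows "\<exists>y \<in> koszul_ker n (P ` (K \<union> A)) 2 3. y \<notin> koszul ` chains n (P ` (K \<union> A)) 3 2"
proof -
  let ?C = "contr n"
  obtain c g d L where c: "\<And>k. k \<in> K \<Longrightarrow> c k \<noteq> 0" and d: "\<And>a. a \<in> A \<Longrightarrow> d a \<noteq> 0"
    and g: "\<And>a i. a \<in> A \<Longrightarrow> i \<le> n \<Longrightarrow> v a i = (\<Sum>k\<in>K. g a k * v k i)"
    and orth: "\<And>a b. a \<in> A \<Longrightarrow> b \<in> A \<Longrightarrow> (\<Sum>k\<in>K. c k * g a k * g b k) = (if a = b then d a else 0)"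
    and LK: "\<And>a k. a \<in> A \<Longrightarrow> k \<in> K \<Longrightarrow> pairing n (L a) (v k) = c k * g a k"
    and LA: "\<And>a b. a \<in> A \<Longrightarrow> b \<in> A \<Longrightarrow> pairing n (L a) (v b) = (if a = b then d a else 0)"
    by (rule orthogonal_diagonal_form[OF indep[OF Un_upper1 cardK] fin(1) cardK fin(2,3) n(2) triv], assumption) (rule that, assumption+)
  \<comment> \<open>The orthogonal projection to the complement of the points of
    \<open>A\<close>.\<close>
  define \<pi> where "\<pi> = (\<lambda>p i. p i - (\<Sum>a\<in>A. pairing n (L a) p / d a * v a i))"
  define r where "r = (\<lambda>k. \<pi> (v k))"
  have r: "r k i = v k i - (\<Sum>a\<in>A. c k * g a k / d a * v a i)" if "k \<in> K" for k i
    using that by (simp add: r_def \<pi>_def LK)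
  note tensor = orthogonal_projection_tensor[OF fin(1,2) c d g orth r, simplified]
  have \<pi>A: "\<pi> (v a) = (\<lambda>i. 0)" if a: "a \<in> A" for a
  proof
    fix i
    have "(\<Sum>b\<in>A. pairing n (L b) (v a) / d b * v b i) = (\<Sum>b\<in>A. if b = a then v b i else 0)"
      using a d by (intro sum.cong) (auto simp: LA)
    then show "\<pi> (v a) i = 0" using a fin(2) by (simp add: \<pi>_def)
  qed
  \<comment> \<open>Three points of \<open>K\<close> complete \<open>A\<close> to a basis, since
    card A + 3 = n + 1; their projections are the vectors b_0, b_1, b_2.\<close>
  obtain T where T: "T \<subseteq> K" "card T = 3"
    using obtain_subset_with_card_n[of 3 K] cardK n(3) by auto
  then obtain k0 k1 k2 where T3: "T = {k0, k1, k2}" "k0 \<noteq> k1" "k0 \<noteq> k2" "k1 \<noteq> k2"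
    by (metis card_3_iff)
  have TA: "T \<union> A \<subseteq> K \<union> A" "T \<inter> A = {}" "finite T" "finite (T \<union> A)"
    using T(1) fin finite_subset by auto
  have "card (T \<union> A) = Suc n" using card_Un_disjoint[OF TA(3) fin(2) TA(2)] T(2) n(1) by simp
  note indepTA = indep[OF TA(1) this] TA(4) this
  obtain m where m: "\<forall>k\<in>T \<union> A. \<forall>j\<in>T \<union> A. pairing n (m k) (v j) = (if j = k then 1 else 0)"
    using dual_basis[OF indepTA] by blast
  define kk where "kk = (\<lambda>i :: nat. if i = 0 then k0 else if i = 1 then k1 else k2)"
  have kk: "kk i \<in> T" for i by (simp add: kk_def T3)
  have kk_inj: "kk i = kk j \<longleftrightarrow> i = j" if "i < 3" "j < 3" for i j
    using that T3(2,3,4) by (auto simp: kk_def less_Suc_eq numeral_3_eq_3)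
  obtain a0 where a0: "a0 \<in> A" using A0 by blast
  have m_A: "pairing n (m (kk i)) (v a) = 0" if a: "a \<in> A" for i a
  proof -
    have "kk i \<in> T \<union> A" "a \<in> T \<union> A" "a \<noteq> kk i" using kk[of i] a TA(2) by blast+
    then show ?thesis using m by simp
  qed
  \<comment> \<open>The dual forms of \<open>T\<close> vanish on \<open>A\<close>, and the
    projection changes a vector only by a combination of points of \<open>A\<close>.\<close>
  have m_r: "pairing n (m (kk i)) (r (kk j)) = (if i = j then 1 else 0)" if "i < 3" "j < 3" for i j
  proof -
    have "pairing n (m (kk i)) (r (kk j)) = pairing n (m (kk i)) (v (kk j)) -
        (\<Sum>a\<in>A. pairing n (L a) (v (kk j)) / d a * pairing n (m (kk i)) (v a))"
      unfolding r_def \<pi>_def pairing_diff_right pairing_sum_right pairing_cmult_right ..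
    also have "(\<Sum>a\<in>A. pairing n (L a) (v (kk j)) / d a * pairing n (m (kk i)) (v a)) = 0"
      by (rule sum.neutral) (simp add: m_A)
    also have "pairing n (m (kk i)) (v (kk j)) = (if kk j = kk i then 1 else 0)"
      using m UnI1[OF kk[of i]] UnI1[OF kk[of j]] by blast
    finally show ?thesis using kk_inj[OF that(2,1)] by auto
  qed
  define mm where "mm = (\<lambda>i. m (kk i))"
  define b where "b = (\<lambda>i. r (kk i))"
  have dual: "pairing n (mm i) (b j) = (if i = j then 1 else 0)" if "i < 3" "j < 3" for i j
    using m_r[OF that] by (simp only: mm_def b_def)
  have mm_a0: "pairing n (mm i) (v a0) = 0" if "i < 3" for i
    using m_A[OF a0] by (simp only: mm_def)
  define \<theta> where "\<theta> = ext_mult n (mm 0) (ext_mult n (mm 1) (ext_mult n (mm 2) (\<lambda>A. if A = {} then 1 else 0)))"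
  have \<theta>: "?C (b 0) (?C (b 1) (?C (b 2) \<theta>)) {} = - 1" "?C (v a0) \<theta> B = 0"
    "\<theta> B \<noteq> 0 \<Longrightarrow> B \<subseteq> {..n} \<and> card B = 3" for B
    unfolding \<theta>_def using contr_ext_mult_triple[of n mm b "v a0", OF dual mm_a0] by blast+
  \<comment> \<open>Evaluation of a trivector on (b_0, b_1, b_2), in the order for which
    \<open>\<theta>\<close> has value -1.\<close>
  define \<Phi> where "\<Phi> = (\<lambda>h. ?C (b 0) (?C (b 1) (?C (b 2) h)) {})"
  have \<Phi>_diff: "\<Phi> (\<lambda>B. e * h B - h' B) = e * \<Phi> h - \<Phi> h'" for e h h'
  proof -
    have "?C p (\<lambda>B. e * h B - h' B) = (\<lambda>B. e * ?C p h B - ?C p h' B)" for p h h'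
      by (rule ext) (simp only: contr_diff contr_cmult)
    then show ?thesis unfolding \<Phi>_def by simp
  qed
  have \<Phi>_0: "\<Phi> (\<lambda>B. 0) = 0" using \<Phi>_diff[of 1 "\<lambda>B. 0" "\<lambda>B. 0"] by simp
  obtain q where q: "q \<in> polyS_deg n 2" "eval (v a0) q \<noteq> 0" "\<forall>j\<in>(K \<union> A) - {a0}. eval (v j) q = 0"
  proof -
    have "Suc n \<le> card (K \<union> A)" using card_mono[of "K \<union> A" K] fin cardK by simp
    then show thesis
      using separating_quadric[of "K \<union> A" n a0 v] fin cardKA a0 indep that by blast
  qed
  define w where "w = (\<Sum>B\<in>Pow {..n}. Poly_Mapping.single B (Const (\<theta> B) * q))"
  have lw: "Poly_Mapping.lookup w B = Const (\<theta> B) * q" for B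
    unfolding w_def using \<theta>(3) by (intro lookup_constant_chain) blast
  have w_keys: "B \<subseteq> {..n} \<and> card B = 3" if "B \<in> Poly_Mapping.keys w" for B
  proof -
    have "\<theta> B \<noteq> 0" using that by (auto simp: in_keys_iff lw Const_simps)
    then show ?thesis by (rule \<theta>(3))
  qed
  then have w: "w \<in> chains n {} (Suc 2) 2"
    unfolding chains_empty_iff by (simp add: lw polyS_deg_Const_mult q(1))
  have "koszul w \<in> koszul_ker n {} 2 3" using koszul_chains[OF w] by simp
  \<comment> \<open>At \<open>v a0\<close> contraction kills \<open>\<theta>\<close>; at the other
    points \<open>q\<close> vanishes.\<close>
  moreover have "eval (v j) (Poly_Mapping.lookup (koszul w) B) = 0" if j: "j \<in> K \<union> A" for j B
  proof -
    have "eval (v j) (Poly_Mapping.lookup (koszul w) B) = ?C (v j) (\<lambda>B. eval (v j) q * \<theta> B) B"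
      using w_keys by (subst eval_koszul[of w n]) (auto simp: lw mult.commute)
    also have "\<dots> = eval (v j) q * ?C (v j) \<theta> B" by (rule contr_cmult)
    also have "\<dots> = 0" using \<theta>(2) q(3) j by (cases "j = a0") auto
    finally show ?thesis .
  qed
  ultimately have y: "koszul w \<in> koszul_ker n (P ` (K \<union> A)) 2 3"
    unfolding koszul_ker_def using chains_iff_vanishing[of "K \<union> A" P n v, OF P] by blast
  have "koszul w \<notin> koszul ` chains n (P ` (K \<union> A)) 3 2"
  proof
    assume "koszul w \<in> koszul ` chains n (P ` (K \<union> A)) 3 2"
    then obtain u where u: "koszul w = koszul u" "u \<in> chains n (P ` (K \<union> A)) 3 2" by blast
    have u_van: "eval (v j) (Poly_Mapping.lookup u B) = 0" if "j \<in> K \<union> A" for j B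
      using u(2) that chains_iff_vanishing[of "K \<union> A" P n v, OF P] by blast
    have u_deg: "Poly_Mapping.lookup u B \<in> polyS_deg n 2" for B
      using lookup_chains[OF u(2)] by (simp add: ideal_deg_iff)
    have u_keys: "B \<subseteq> {..n}" if "B \<in> Poly_Mapping.keys u" for B using u(2) that by (auto simp: chains_def)
    \<comment> \<open>This is w - u as a function of the point; at the points of Y the part from
      \<open>u\<close> vanishes.\<close>
    define h where "h = (\<lambda>p B. eval p q * \<theta> B - eval p (Poly_Mapping.lookup u B))"
    define F where "F = (\<lambda>p. \<Phi> (h p))"
    have h_eq: "h p B = eval p (Poly_Mapping.lookup w B - Poly_Mapping.lookup u B)" for p B
      by (simp add: h_def lw mult.commute)
    have quad_h: "quadratic_fun n (\<lambda>p. h p B)" for B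
    proof -
      have "Poly_Mapping.lookup w B + - Poly_Mapping.lookup u B \<in> polyS_deg n 2"
        unfolding lw by (intro polyS_deg_add polyS_deg_uminus polyS_deg_Const_mult q(1) u_deg)
      then show ?thesis unfolding h_eq by (intro quadratic_fun_eval) simp
    qed
    have quad: "quadratic_fun n F"
      unfolding F_def \<Phi>_def by (intro quadratic_fun_contr quad_h)
    have Fv: "F (v j) = - eval (v j) q" if "j \<in> K \<union> A" for j
    proof -
      have "F (v j) = eval (v j) q * \<Phi> \<theta> - \<Phi> (\<lambda>B. eval (v j) (Poly_Mapping.lookup u B))"
        unfolding F_def h_def by (rule \<Phi>_diff)
      then show ?thesis using \<theta>(1) by (simp add: u_van[OF that] \<Phi>_0) (simp add: \<Phi>_def)
    qed
    \<comment> \<open>The value of w - u at p is killed by contraction with p because w and u have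
      the same boundary.\<close>
    have closed: "?C p (h p) B = 0" for p B
    proof -
      have "?C p (h p) B = eval p (Poly_Mapping.lookup (koszul w) B) - eval p (Poly_Mapping.lookup (koszul u) B)"
      proof -
        have "h p = (\<lambda>B. eval p (Poly_Mapping.lookup w B) - eval p (Poly_Mapping.lookup u B))"
          by (rule ext) (simp add: h_eq)
        then show ?thesis
          using eval_koszul[of w n p B] eval_koszul[of u n p B] w_keys u_keys by (simp add: contr_diff)
      qed
      then show ?thesis by (simp add: u(1))
    qed
    \<comment> \<open>Expand v_k in the basis \<open>T \<union> A\<close> and project: the points of
      \<open>A\<close> go to zero, so r_k is a combination of b_0, b_1, b_2, as
      \<open>contr_triple_zero\<close> requires.\<close>
    have Fr: "F (r k) = 0" for k
    proof -
      define \<beta> where "\<beta> = (\<lambda>j. pairing n (m j) (v k))"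
      have vk: "v k i = (\<Sum>j\<in>T \<union> A. \<beta> j * v j i)" if "i \<le> n" for i
        unfolding \<beta>_def using dual_basis_expansion[OF indepTA(1,2) m that] .
      have "r k i = (\<Sum>j\<in>T \<union> A. \<beta> j * \<pi> (v j) i)" if i: "i \<le> n" for i
      proof -
        have pk: "pairing n (L a) (v k) = (\<Sum>j\<in>T \<union> A. \<beta> j * pairing n (L a) (v j))" for a
          using pairing_cong[of n "v k" "\<lambda>i. \<Sum>j\<in>T \<union> A. \<beta> j * v j i" "L a"] vk
          by (simp add: pairing_sum_right pairing_cmult_right)
        have "(\<Sum>a\<in>A. pairing n (L a) (v k) / d a * v a i) =
            (\<Sum>j\<in>T \<union> A. \<Sum>a\<in>A. \<beta> j * (pairing n (L a) (v j) / d a * v a i))"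
          unfolding pk by (subst sum.swap) (simp add: sum_distrib_right sum_divide_distrib mult.assoc)
        then show ?thesis
          unfolding r_def \<pi>_def vk[OF i]
          by (simp add: right_diff_distrib sum_subtractf sum_distrib_left)
      qed
      also have "(\<Sum>j\<in>T \<union> A. \<beta> j * \<pi> (v j) i) = (\<Sum>j\<in>T. \<beta> j * r j i)" for i
        unfolding r_def using TA(4) by (intro sum.mono_neutral_right) (auto simp: \<pi>A)
      also have "(\<Sum>j\<in>T. \<beta> j * r j i) = \<beta> k0 * r k0 i + \<beta> k1 * r k1 i + \<beta> k2 * r k2 i" for i
        using T3(2,3,4) by (simp add: T3(1) add.assoc)
      finally have rk: "r k i = \<beta> k0 * r k0 i + \<beta> k1 * r k1 i + \<beta> k2 * r k2 i" if "i \<le> n" for i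
        using that by blast
      show ?thesis
      proof (cases "\<beta> k0 \<noteq> 0 \<or> \<beta> k1 \<noteq> 0 \<or> \<beta> k2 \<noteq> 0")
        case True
        then show ?thesis
          using contr_triple_zero[of n "r k" _ "r k0" _ "r k1" _ "r k2" "h (r k)" "{}", OF rk _ closed]
          by (simp add: F_def \<Phi>_def b_def kk_def)
      next
        case False
        \<comment> \<open>A zero projection is not covered by \<open>contr_triple_zero\<close>; here
          \<open>F\<close> vanishes by homogeneity.\<close>
        then have "r k i = 0" if "i \<le> n" for i using rk[OF that] by simp
        then show ?thesis using quad unfolding quadratic_fun_def by auto
      qed
    qed
    have "(\<Sum>k\<in>K. F (r k) / c k) = (\<Sum>k\<in>K. F (v k) / c k) - (\<Sum>a\<in>A. F (v a) / d a)"
      by (rule orthogonal_projection_quadratic[OF quad tensor])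
    moreover have "(\<Sum>k\<in>K. F (v k) / c k) = 0"
      using q(3) a0 fin(3) by (intro sum.neutral) (auto simp: Fv)
    \<comment> \<open>\<open>q\<close> separates \<open>a0\<close> from the other points, so one
      nonzero term is left in an identity whose other sums are zero.\<close>
    moreover have "(\<Sum>a\<in>A. F (v a) / d a) = (\<Sum>a\<in>A. if a = a0 then - eval (v a0) q / d a0 else 0)"
      using q(3) by (intro sum.cong) (auto simp: Fv)
    ultimately show False using a0 fin(2) d[OF a0] q(2) by (simp add: Fr)
  qed
  then show ?thesis using y by blast
qed

section \<open>A nonzero cycle\<close>

lemma contr_sum: "contr n v (\<lambda>A. \<Sum>c\<in>I. \<theta> c A) B = (\<Sum>c\<in>I. contr n v (\<theta> c) B)"
  by (induction I rule: infinite_finite_induct) (simp_all add: contr_0 contr_add)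

text \<open>Contraction at B - {i} expresses v_i times the value at B through values at sets
  avoiding i. Vanishing thus needs to be imposed only at the \<open>p\<close>-element subsets of an
  n-element set, 20 of them for n = 6 and p = 3.\<close>

lemma contr_zero_determined:
  fixes v :: "nat \<Rightarrow> 'k::field"
  assumes i: "i \<le> n" "v i \<noteq> 0" and c: "\<And>B. contr n v \<omega> B = 0"
    and \<omega>: "\<And>B. B \<subseteq> {..n} - {i} \<Longrightarrow> card B = p \<Longrightarrow> \<omega> B = 0"
    and B: "B \<subseteq> {..n}" "card B = p"
  shows "\<omega> B = 0"
proof (cases "i \<in> B")
  case True
  have fin: "finite B" using B(1) finite_subset by blast
  have D: "B - {i} \<subseteq> {..n}" using B(1) by blast
  have cD: "card (insert a (B - {i})) = p" if "a \<notin> B" for a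
    using that fin card_Suc_Diff1[OF fin True] B(2) by simp
  have "0 = (\<Sum>a\<in>{..n} - (B - {i}). above_sign a (B - {i}) * v a * \<omega> (insert a (B - {i})))"
    using c[of "B - {i}"] D by (simp add: contr_def)
  also have "\<dots> = (\<Sum>a\<in>{i}. above_sign a (B - {i}) * v a * \<omega> (insert a (B - {i})))"
  proof (rule sum.mono_neutral_right)
    show "\<forall>a\<in>{..n} - (B - {i}) - {i}. above_sign a (B - {i}) * v a * \<omega> (insert a (B - {i})) = 0"
    proof
      fix a assume a: "a \<in> {..n} - (B - {i}) - {i}"
      then have "\<omega> (insert a (B - {i})) = 0" using B(1) by (intro \<omega> cD) auto
      then show "above_sign a (B - {i}) * v a * \<omega> (insert a (B - {i})) = 0" by simp
    qed
  qed (use i in auto)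
  finally show ?thesis using i(2) True by (simp add: insert_absorb above_sign_def)
next
  case False
  then show ?thesis using B by (intro \<omega>) auto
qed

text \<open>
  The elements \<open>x\<^sub>B \<and> x\<^sub>m \<otimes> x\<^sub>i\<close> with \<open>B\<close> below \<open>m\<close> and \<open>i \<le> m\<close> span a complement of the kernel of
  \<open>\<Lambda>\<^sup>p\<^sup>+\<^sup>1 S\<^sub>1 \<otimes> S\<^sub>1 \<rightarrow> \<Lambda>\<^sup>p S\<^sub>1 \<otimes> S\<^sub>2\<close>.
\<close>

definition hook_index :: "nat \<Rightarrow> nat \<Rightarrow> (nat \<times> nat set \<times> nat) set"
  where "hook_index n p = (SIGMA m:{..n}. {B. B \<subseteq> {..<m} \<and> card B = p} \<times> {..m})"

definition hook_chain :: "nat \<Rightarrow> nat \<Rightarrow> (nat \<times> nat set \<times> nat \<Rightarrow> 'k::field) \<Rightarrow> 'k chain"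
  where "hook_chain n p x = (\<Sum>(m, B, i)\<in>hook_index n p.
           Poly_Mapping.single (insert m B) (Const (x (m, B, i)) * Var i))"

lemma finite_hook_index: "finite (hook_index n p)"
  unfolding hook_index_def by (intro finite_SigmaI finite_cartesian_product) auto

text \<open>For n = 6 and p = 3 this is 4 + 20 + 60 + 140 = 224.\<close>

lemma card_hook_index: "card (hook_index n p) = (\<Sum>m\<le>n. (m choose p) * Suc m)"
  unfolding hook_index_def by (subst card_SigmaI) (auto simp: card_cartesian_product n_subsets)

lemma hook_chain_chains: "hook_chain n p x \<in> chains n {} (Suc p) 1"
proof -
  have "Poly_Mapping.single (insert m B) (Const (x (m, B, i)) * Var i) \<in> chains n {} (Suc p) 1"
    if "(m, B, i) \<in> hook_index n p" for m B i
  proof -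
    have h: "m \<le> n" "B \<subseteq> {..<m}" "card B = p" "i \<le> m" using that by (auto simp: hook_index_def)
    have "finite B" "m \<notin> B" using h(2) finite_subset by auto
    then show ?thesis
      using h by (auto simp: chains_empty_iff lookup_single intro!: polyS_deg_Const_mult polyS_deg_Var)
  qed
  then show ?thesis
    unfolding hook_chain_def by (intro chain.subspace_sum[OF subspace_chains]) auto
qed

lemma monom_coefficient:
  "(-1) ^ k * (Var a * (Const c * Var i)) = Poly_Mapping.single (pair_monom a i) ((-1) ^ k * c)"
proof -
  have "(-1 :: (nat, 'a) mpoly) ^ k = Const ((-1) ^ k)"
    by (induction k) (simp_all add: Const_def single_uminus)
  then show ?thesis by (simp add: Const_def Var_def mult_single pair_monom_def)
qed

lemma pair_monom_commute: "pair_monom s t = pair_monom t s"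
  by (simp add: pair_monom_def add.commute)

lemma pair_monom_eq_iff: "pair_monom s t = pair_monom s' t' \<longleftrightarrow> s = s' \<and> t = t' \<or> s = t' \<and> t = s'"
proof
  assume eq: "pair_monom s t = pair_monom s' t'"
  have "pair_monom (min s t) (max s t) = pair_monom (min s' t') (max s' t')"
    using eq by (simp add: min_def max_def pair_monom_commute)
  then have "min s t = min s' t' \<and> max s t = max s' t'" by (intro pair_monom_inject) auto
  then show "s = s' \<and> t = t' \<or> s = t' \<and> t = s'" by (auto simp: min_def max_def split: if_splits)
qed (auto simp: pair_monom_commute)

text \<open>Each unknown can be read off from one coefficient of the image, so the images are
  independent. A generator (m, B, i) contributes only if the removed index a and i are i0 and m0 in
  some order. If a = m0, comparing largest elements gives m = m0 and the same generator; otherwise i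
  = m0 while m < m0, contrary to i at most m.\<close>

lemma koszul_hook_chain_coefficient:
  assumes c: "(m0, B0, i0) \<in> hook_index n p"
  shows "Poly_Mapping.lookup (Poly_Mapping.lookup (koszul (hook_chain n p x)) B0) (pair_monom i0 m0) = x (m0, B0, i0)"
proof -
  have h0: "B0 \<subseteq> {..<m0}" "i0 \<le> m0" using c by (auto simp: hook_index_def)
  have fin: "finite (insert m B)" if "(m, B, i) \<in> hook_index n p" for m B i
    using that by (auto simp: hook_index_def intro: finite_subset)
  define G where "G = (\<lambda>m B i a. (if insert m B - {a} = B0 \<and> pair_monom a i = pair_monom i0 m0
      then (-1) ^ card {b. (b = m \<or> b \<in> B) \<and> a < b} * x (m, B, i) else 0))"
  have single_lookup: "Poly_Mapping.lookup (Poly_Mapping.lookup (Poly_Mapping.single C (Poly_Mapping.single \<mu> y)) B0) \<nu> =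
      (if C = B0 \<and> \<mu> = \<nu> then y else 0)" for C \<mu> \<nu> and y :: 'a
    by (simp add: lookup_single when_def)
  have zero: "G m B i a = 0"
    if t: "(m, B, i) \<in> hook_index n p" and ne: "(m, B, i) \<noteq> (m0, B0, i0)" and a: "a \<in> insert m B" for m B i a
  proof (rule ccontr)
    assume nz: "G m B i a \<noteq> 0"
    have h: "B \<subseteq> {..<m}" "i \<le> m" using t by (auto simp: hook_index_def)
    have e: "insert m B - {a} = B0" "pair_monom a i = pair_monom i0 m0"
      using nz by (auto simp: G_def split: if_splits)
    have eq: "insert m B = insert a B0" using a e(1) by blast
    have "a = i0 \<and> i = m0 \<or> a = m0 \<and> i = i0" using e(2) by (simp add: pair_monom_eq_iff)
    then consider "a = m0" "i = i0" | "a = i0" "i = m0" "i0 < m0" using h0(2) by fastforce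
    then show False
    proof cases
      case 1
      have "m \<le> m0" using eq h0(1) 1 by (metis insertE insertI1 lessThan_iff less_imp_le order_refl subsetD)
      moreover have "m0 \<le> m" using eq h(1) 1 by (metis insertE insertI1 lessThan_iff less_imp_le order_refl subsetD)
      ultimately have "m = m0" by simp
      moreover from this have "B = B0" using e(1) 1 h(1) by auto
      ultimately show False using ne 1 by simp
    next
      case 2
      have "m < m0" using eq h0(1) 2 by (metis insertE insertI1 lessThan_iff subsetD)
      then show False using h(2) 2 by simp
    qed
  qed
  have "Poly_Mapping.lookup (Poly_Mapping.lookup (koszul (hook_chain n p x)) B0) (pair_monom i0 m0) =
      (\<Sum>(m, B, i)\<in>hook_index n p. \<Sum>a\<in>insert m B. G m B i a)"
    unfolding hook_chain_def koszul_sum lookup_sum G_def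
    by (intro sum.cong refl) (auto simp: koszul_single lookup_sum monom_coefficient single_lookup)
  also have "\<dots> = (\<Sum>(m, B, i)\<in>{(m0, B0, i0)}. \<Sum>a\<in>insert m B. G m B i a)"
  proof (rule sum.mono_neutral_right[OF finite_hook_index])
    have "(\<Sum>a\<in>insert m B. G m B i a) = 0" if "(m, B, i) \<in> hook_index n p - {(m0, B0, i0)}" for m B i
      using that by (intro sum.neutral ballI zero) auto
    then show "\<forall>t\<in>hook_index n p - {(m0, B0, i0)}. (case t of (m, B, i) \<Rightarrow> \<Sum>a\<in>insert m B. G m B i a) = 0"
      by fast
  qed (use c in auto)
  also have "\<dots> = (\<Sum>a\<in>insert m0 B0. G m0 B0 i0 a)" by simp
  also have "\<dots> = (\<Sum>a\<in>{m0}. G m0 B0 i0 a)"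
  proof (rule sum.mono_neutral_right[OF fin[OF c]])
    show "\<forall>a\<in>insert m0 B0 - {m0}. G m0 B0 i0 a = 0"
      using h0(1) by (auto simp: G_def)
  qed simp
  also have "\<dots> = x (m0, B0, i0)"
  proof -
    have "{b. (b = m0 \<or> b \<in> B0) \<and> m0 < b} = {}" using h0(1) by auto
    then have 0: "card {b. (b = m0 \<or> b \<in> B0) \<and> m0 < b} = 0" by (simp only: card.empty)
    have "insert m0 B0 - {m0} = B0" using h0(1) by auto
    then have "G m0 B0 i0 m0 = x (m0, B0, i0)" unfolding G_def 0 pair_monom_commute[of m0 i0] by simp
    then show ?thesis by simp
  qed
  finally show ?thesis .
qed

text \<open>The cycle is sought as the boundary of a hook chain. Its value at each point is killed
  by contraction with that point, so only n choose p linear conditions per point are needed; a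
  nonzero solution gives a nonzero boundary because hook chains are mapped injectively.\<close>

lemma nonzero_koszul_cycle:
  fixes v :: "nat \<Rightarrow> nat \<Rightarrow> 'k::field"
  assumes J: "finite J" and count: "card J * (n choose p) < (\<Sum>m\<le>n. (m choose p) * Suc m)"
    and P: "\<And>j. j \<in> J \<Longrightarrow> P j \<in> proj_space n" "\<And>j. j \<in> J \<Longrightarrow> v j \<in> P j"
  shows "\<exists>u \<in> koszul_ker n (P ` J) p 2. u \<noteq> 0"
proof -
  obtain s where s: "\<And>j. j \<in> J \<Longrightarrow> s j \<le> n \<and> v j (s j) \<noteq> 0"
    using proj_space_vec[OF P] by metis
  define R where "R = (SIGMA j:J. {B. B \<subseteq> {..n} - {s j} \<and> card B = p})"
  \<comment> \<open>The value at v_j of the coefficient of x_A in the generator with index (m, B',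
    i).\<close>
  define \<beta> where "\<beta> = (\<lambda>j (m, B', i) (A :: nat set). if insert m B' = A then v j i else 0)"
  have cardR: "card R = card J * (n choose p)"
  proof -
    have "card {B. B \<subseteq> {..n} - {s j} \<and> card B = p} = n choose p" if "j \<in> J" for j
      using n_subsets[of "{..n} - {s j}" p] s[OF that] by simp
    then show ?thesis unfolding R_def using J by (subst card_SigmaI) auto
  qed
  have finR: "finite R" unfolding R_def using J by (intro finite_SigmaI) auto
  obtain x where x: "\<forall>(j, B)\<in>R. (\<Sum>c\<in>hook_index n p. contr n (v j) (\<beta> j c) B * x c) = 0"
    and x0: "\<exists>c\<in>hook_index n p. x c \<noteq> 0"
    using underdetermined_system[OF finite_hook_index finR, of n p "\<lambda>(j, B) c. contr n (v j) (\<beta> j c) B"]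
      cardR count card_hook_index[of n p] by (auto simp: case_prod_beta)
  let ?\<tau> = "hook_chain n p x"
  define u where "u = koszul ?\<tau>"
  have u: "u \<in> koszul_ker n {} p 2" unfolding u_def using koszul_chains[OF hook_chain_chains] by simp
  then have u_keys: "B \<subseteq> {..n} \<and> card B = p" if "B \<in> Poly_Mapping.keys u" for B
    using that by (simp add: koszul_ker_def chains_empty_iff)
  have \<tau>_keys: "A \<subseteq> {..n}" if "A \<in> Poly_Mapping.keys ?\<tau>" for A
    using that hook_chain_chains[of n p x] by (simp add: chains_empty_iff)
  have ev: "eval (v j) (Poly_Mapping.lookup ?\<tau> A) = (\<Sum>c\<in>hook_index n p. x c * \<beta> j c A)" for j A
    unfolding hook_chain_def lookup_sum eval_sum
    by (intro sum.cong) (auto simp: \<beta>_def lookup_single when_def)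
  have u_ev: "eval (v j) (Poly_Mapping.lookup u B) = (\<Sum>c\<in>hook_index n p. contr n (v j) (\<beta> j c) B * x c)" for j B
    unfolding u_def by (subst eval_koszul[of _ n]) (auto simp: \<tau>_keys ev contr_sum contr_cmult mult.commute)
  have "eval (v j) (Poly_Mapping.lookup u B) = 0" if j: "j \<in> J" for j B
  proof (cases "B \<subseteq> {..n} \<and> card B = p")
    case True
    show ?thesis
    proof (rule contr_zero_determined[where v = "v j" and i = "s j" and n = n and p = p
          and \<omega> = "\<lambda>B. eval (v j) (Poly_Mapping.lookup u B)"])
      show "contr n (v j) (\<lambda>B. eval (v j) (Poly_Mapping.lookup u B)) B = 0" for B
        using eval_koszul[of u n "v j" B] u_keys u by (simp add: koszul_ker_def)
      show "eval (v j) (Poly_Mapping.lookup u B) = 0" if "B \<subseteq> {..n} - {s j}" "card B = p" for B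
      proof -
        have "(j, B) \<in> R" using that j by (simp add: R_def)
        then show ?thesis using x unfolding u_ev by blast
      qed
    qed (use True s[OF j] in auto)
  next
    case False
    then have "B \<notin> Poly_Mapping.keys u" using u_keys[of B] by blast
    then show ?thesis by (simp add: not_in_keys_iff_lookup_eq_zero)
  qed
  then have "u \<in> koszul_ker n (P ` J) p 2"
    using u unfolding koszul_ker_def using chains_iff_vanishing[of J P n v, OF P] by blast
  moreover have "u \<noteq> 0"
  proof -
    obtain m B i where "(m, B, i) \<in> hook_index n p" "x (m, B, i) \<noteq> 0" using x0 by auto
    then have "Poly_Mapping.lookup (Poly_Mapping.lookup u B) (pair_monom i m) \<noteq> 0"
      unfolding u_def by (simp add: koszul_hook_chain_coefficient)
    then show ?thesis by auto
  qed
  ultimately show ?thesis by blast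
qed

section \<open>General points\<close>

lemma generic_indep_points:
  assumes J: "J \<subseteq> {..<d}" "card J = Suc n"
  shows "generically n d (\<lambda>v :: nat \<Rightarrow> nat \<Rightarrow> 'k::field. indep_points n v J)"
proof -
  have iff: "indep_points n v J \<longleftrightarrow> injective_system J {..n} (\<lambda>j i. v j i)" for v :: "nat \<Rightarrow> nat \<Rightarrow> 'k"
    unfolding indep_points_def injective_system_def pairing_def by (simp add: mult.commute Ball_def)
  have "finite J" using J(1) finite_subset by blast
  then obtain ix where ix: "bij_betw ix J {..n}"
    using J(2) finite_same_card_bij[of J "{..n}"] by auto
  \<comment> \<open>Witness: the points of \<open>J\<close> are the standard basis vectors.\<close>
  define w where "w = (\<lambda>j i. if i = ix j then 1 else 0 :: 'k)"
  have "indep_points n w J"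
    unfolding indep_points_def
  proof (intro allI impI)
    fix m i assume m: "\<forall>j\<in>J. pairing n m (w j) = 0" and i: "i \<le> n"
    then obtain j where j: "j \<in> J" "ix j = i" using ix unfolding bij_betw_def by (metis atMost_iff imageE)
    then have "pairing n m (w j) = m i" using i by (simp add: pairing_def w_def if_distrib cong: if_cong)
    then show "m i = 0" using m j by simp
  qed
  then have "injective_system J {..n} (\<lambda>j i. w j i)" by (simp add: iff)
  then show ?thesis
    unfolding iff
  proof (rule injective_system_generic[rotated 2])
    show "mhom n d (\<lambda>l. (if l = j then 1 else 0) - 0) (\<lambda>v. v j i)" if "j \<in> J" "i \<in> {..n}" for j i
      using that J(1) mhom_coord[of j d i n] by auto
  qed simp
qed

subsection \<open>Coupled linear forms\<close>

text \<open>The unknown (l, s) is the s-th coefficient of L_l, and row (i, j) is the condition on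
  L_i(v_j). Let e_i denote degree 1 in point i. Row degree e_i + e_j and column degree e_l fit all
  entries: column l = i contains v_j, and column l = j contains v_i. Within one block, the rows i =
  j other than that of \<open>z\<close> are zero.\<close>

definition coupled_matrix :: "nat set \<Rightarrow> nat \<Rightarrow> nat \<times> nat \<Rightarrow> nat \<times> nat \<Rightarrow> (nat \<Rightarrow> nat \<Rightarrow> 'k::field) \<Rightarrow> 'k"
  where "coupled_matrix K z r c v =
    (if fst r \<in> K \<longleftrightarrow> snd r \<in> K
     then (if (fst r \<noteq> snd r \<or> fst r = z) \<and> fst c = fst r then v (snd r) (snd c) else 0)
     else (if fst c = fst r then v (snd r) (snd c) else 0) - (if fst c = snd r then v (fst r) (snd c) else 0))"

lemma coupled_matrix_row:
  assumes Y: "finite Y" "i \<in> Y" "j \<in> Y"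
  shows "(\<Sum>c\<in>Y \<times> {..n}. coupled_matrix K z (i, j) c v * x c) =
    (if i \<in> K \<longleftrightarrow> j \<in> K then (if i \<noteq> j \<or> i = z then pairing n (\<lambda>s. x (i, s)) (v j) else 0)
     else pairing n (\<lambda>s. x (i, s)) (v j) - pairing n (\<lambda>s. x (j, s)) (v i))"
proof -
  have *: "(\<Sum>c\<in>Y \<times> {..n}. (if fst c = i then v j (snd c) else 0) * x c) = pairing n (\<lambda>s. x (i, s)) (v j)"
    if "i \<in> Y" for i j
  proof -
    have "(\<Sum>c\<in>Y \<times> {..n}. (if fst c = i then v j (snd c) else 0) * x c) =
        (\<Sum>(l, s)\<in>Y \<times> {..n}. (if l = i then v j s else 0) * x (l, s))"
      by (intro sum.cong) auto
    also have "\<dots> = (\<Sum>l\<in>Y. if l = i then pairing n (\<lambda>s. x (i, s)) (v j) else 0)"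
      unfolding sum.cartesian_product[symmetric]
      by (intro sum.cong) (auto simp: pairing_def mult.commute)
    finally show ?thesis using that Y(1) by simp
  qed
  show ?thesis
    unfolding coupled_matrix_def fst_conv snd_conv
    using *[OF Y(2), of j] *[OF Y(3), of i]
    by (auto simp: left_diff_distrib sum_subtractf)
qed

lemma coupled_forms_trivial_iff:
  assumes fin: "finite K" "finite A" "K \<inter> A = {}" and z: "z \<in> K \<union> A"
  shows "coupled_forms_trivial n v K A z \<longleftrightarrow>
    injective_system ((K \<union> A) \<times> (K \<union> A)) ((K \<union> A) \<times> {..n}) (\<lambda>r c. coupled_matrix K z r c v)"
proof -
  let ?Y = "K \<union> A"
  have finY: "finite ?Y" using fin by blast
  have rows: "(\<forall>r\<in>?Y \<times> ?Y. (\<Sum>c\<in>?Y \<times> {..n}. coupled_matrix K z r c v * x c) = 0) \<longleftrightarrow>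
    (\<forall>i\<in>?Y. \<forall>j\<in>?Y. (i \<in> K \<longleftrightarrow> j \<in> K) \<and> i \<noteq> j \<longrightarrow> pairing n (\<lambda>s. x (i, s)) (v j) = 0) \<and>
    (\<forall>k\<in>K. \<forall>a\<in>A. pairing n (\<lambda>s. x (k, s)) (v a) = pairing n (\<lambda>s. x (a, s)) (v k)) \<and>
    pairing n (\<lambda>s. x (z, s)) (v z) = 0" (is "?L x \<longleftrightarrow> ?R x") for x
  proof -
    have r: "(\<Sum>c\<in>?Y \<times> {..n}. coupled_matrix K z (i, j) c v * x c) =
      (if i \<in> K \<longleftrightarrow> j \<in> K then (if i \<noteq> j \<or> i = z then pairing n (\<lambda>s. x (i, s)) (v j) else 0)
       else pairing n (\<lambda>s. x (i, s)) (v j) - pairing n (\<lambda>s. x (j, s)) (v i))"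
      if "i \<in> ?Y" "j \<in> ?Y" for i j using coupled_matrix_row[OF finY that] .
    have A: "a \<notin> K" if "a \<in> A" for a using that fin(3) by blast
    show ?thesis
    proof
      assume L: "?L x"
      then have L': "(\<Sum>c\<in>?Y \<times> {..n}. coupled_matrix K z (i, j) c v * x c) = 0" if "i \<in> ?Y" "j \<in> ?Y" for i j
        using that by blast
      have "pairing n (\<lambda>s. x (i, s)) (v j) = 0" if "i \<in> ?Y" "j \<in> ?Y" "i \<in> K \<longleftrightarrow> j \<in> K" "i \<noteq> j" for i j
        using L'[OF that(1,2)] r[OF that(1,2)] that(3,4) by simp
      moreover have "pairing n (\<lambda>s. x (k, s)) (v a) = pairing n (\<lambda>s. x (a, s)) (v k)" if "k \<in> K" "a \<in> A" for k a
        using L'[of k a] r[of k a] that A[OF that(2)] by simp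
      moreover have "pairing n (\<lambda>s. x (z, s)) (v z) = 0" using L'[OF z z] r[OF z z] by simp
      ultimately show "?R x" by blast
    next
      assume R: "?R x"
      have "(\<Sum>c\<in>?Y \<times> {..n}. coupled_matrix K z (i, j) c v * x c) = 0" if ij: "i \<in> ?Y" "j \<in> ?Y" for i j
      proof (cases "i \<in> K \<longleftrightarrow> j \<in> K")
        case True
        then show ?thesis using R ij by (cases "i = j") (auto simp: r)
      next
        case False
        then have "i \<in> K \<and> j \<in> A \<or> i \<in> A \<and> j \<in> K" using ij by blast
        then show ?thesis using R A False unfolding r[OF ij] by auto
      qed
      then show "?L x" by blast
    qed
  qed
  show ?thesis
  proof
    assume triv: "coupled_forms_trivial n v K A z"
    show "injective_system (?Y \<times> ?Y) (?Y \<times> {..n}) (\<lambda>r c. coupled_matrix K z r c v)"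
      unfolding injective_system_def rows
    proof (intro allI impI ballI)
      fix x c assume R: "?R x" and c: "c \<in> ?Y \<times> {..n}"
      have "\<forall>j\<in>?Y. \<forall>i\<le>n. x (j, i) = 0"
        using triv[unfolded coupled_forms_trivial_def, THEN spec, of "\<lambda>j i. x (j, i)"] R by (rule mp)
      then show "x c = 0" using c by auto
    qed
  next
    assume inj: "injective_system (?Y \<times> ?Y) (?Y \<times> {..n}) (\<lambda>r c. coupled_matrix K z r c v)"
    show "coupled_forms_trivial n v K A z"
      unfolding coupled_forms_trivial_def
    proof (intro allI impI ballI)
      fix L j i
      assume L: "(\<forall>i\<in>K \<union> A. \<forall>j\<in>K \<union> A. (i \<in> K) = (j \<in> K) \<and> i \<noteq> j \<longrightarrow> pairing n (L i) (v j) = 0) \<and>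
         (\<forall>k\<in>K. \<forall>a\<in>A. pairing n (L k) (v a) = pairing n (L a) (v k)) \<and> pairing n (L z) (v z) = 0"
        and ji: "j \<in> ?Y" "i \<le> n"
      have "\<forall>c\<in>?Y \<times> {..n}. (\<lambda>(l, s). L l s) c = 0"
        by (rule inj[unfolded injective_system_def rows, THEN spec, of "\<lambda>(l, s). L l s", THEN mp])
          (unfold prod.case, rule L)
      then show "L j i = 0" using ji by force
    qed
  qed
qed

text \<open>
  The witness: \<open>K\<close> is the standard basis, all elements of \<open>K\<close> but \<open>k0\<close> are identified by \<open>f\<close> with the pairs
  of elements of \<open>A\<close>, and \<open>v\<^sub>a\<close> is the sum of the basis vectors of the pairs containing \<open>a\<close>, plus that of \<open>k0\<close> if \<open>a = a0\<close>.
\<close>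

lemma generic_coupled_forms_trivial:
  assumes KA: "K \<subseteq> {..<d}" "A \<subseteq> {..<d}" "K \<inter> A = {}" and card: "card K = Suc n" "card A choose 2 = n"
    and A0: "A \<noteq> {}" and z: "z \<in> K \<union> A"
  shows "generically n d (\<lambda>v :: nat \<Rightarrow> nat \<Rightarrow> 'k::field. coupled_forms_trivial n v K A z)"
proof -
  have fin: "finite K" "finite A" using KA finite_subset by blast+
  \<comment> \<open>If \<open>z\<close> lies in \<open>K\<close>, the distinguished basis vector
    must be \<open>z\<close> itself, so that the extra equation concerns the coefficient that no
    pair controls; likewise \<open>a0\<close> is \<open>z\<close> if \<open>z\<close> lies in
    \<open>A\<close>.\<close>
  obtain k0 where k0: "k0 \<in> K" "z \<in> K \<Longrightarrow> k0 = z" using card(1) by (metis card.empty ex_in_conv nat.distinct(1))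
  obtain a0 where a0: "a0 \<in> A" "z \<in> A \<Longrightarrow> a0 = z" using A0 by blast
  obtain ix where ix: "bij_betw ix K {..n}"
    using card(1) finite_same_card_bij[of K "{..n}"] fin by auto
  \<comment> \<open>Both sides equal n, so each pair in \<open>A\<close> gets its own basis
    vector.\<close>
  have "card (K - {k0}) = card {S. S \<subseteq> A \<and> card S = 2}"
    using card k0(1) n_subsets[OF fin(2), of 2] by simp
  then obtain f where f: "bij_betw f (K - {k0}) {S. S \<subseteq> A \<and> card S = 2}"
    using finite_same_card_bij[of "K - {k0}" "{S. S \<subseteq> A \<and> card S = 2}"] fin by auto
  define g where "g = (\<lambda>a k. if k = k0 then (if a = a0 then 1 else 0) else if a \<in> f k then 1 else 0 :: 'k)"
  define w where "w = (\<lambda>j i. if j \<in> K then (if i = ix j then 1 else 0) else \<Sum>k\<in>K. if i = ix k then g j k else 0)"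
  have ixn: "ix k \<le> n" if "k \<in> K" for k using ix that unfolding bij_betw_def by blast
  have wK: "pairing n m (w k) = m (ix k)" if "k \<in> K" for m k
  proof -
    have "pairing n m (w k) = (\<Sum>i\<le>n. if i = ix k then m (ix k) else 0)"
      unfolding pairing_def using that by (intro sum.cong) (auto simp: w_def)
    then show ?thesis using ixn[OF that] by simp
  qed
  have wA: "pairing n m (w a) = (\<Sum>k\<in>K. g a k * m (ix k))" if "a \<in> A" for m a
  proof -
    have "a \<notin> K" using that KA(3) by blast
    then have "pairing n m (w a) = (\<Sum>i\<le>n. \<Sum>k\<in>K. if i = ix k then g a k * m i else 0)"
      unfolding pairing_def by (intro sum.cong refl) (auto simp: w_def sum_distrib_left intro!: sum.cong)
    also have "\<dots> = (\<Sum>k\<in>K. \<Sum>i\<le>n. if i = ix k then g a k * m i else 0)" by (rule sum.swap)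
    also have "\<dots> = (\<Sum>k\<in>K. g a k * m (ix k))" using ixn by (intro sum.cong) auto
    finally show ?thesis .
  qed
  have "coupled_forms_trivial n w K A z"
    unfolding coupled_forms_trivial_def
  proof (intro allI impI)
    fix L
    assume L: "(\<forall>i\<in>K \<union> A. \<forall>j\<in>K \<union> A. (i \<in> K) = (j \<in> K) \<and> i \<noteq> j \<longrightarrow> pairing n (L i) (w j) = 0) \<and>
      (\<forall>k\<in>K. \<forall>a\<in>A. pairing n (L k) (w a) = pairing n (L a) (w k)) \<and> pairing n (L z) (w z) = 0"
    define c where "c = (\<lambda>k. L k (ix k))"
    have LK: "L k (ix j) = (if j = k then c k else 0)" if "k \<in> K" "j \<in> K" for k j
      using L that wK[OF that(2), of "L k"] by (auto simp: c_def)
    have LA: "L a (ix k) = g a k * c k" if a: "a \<in> A" and k: "k \<in> K" for a k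
    proof -
      have "L a (ix k) = pairing n (L k) (w a)" using L a k wK[OF k, of "L a"] by simp
      also have "\<dots> = (\<Sum>j\<in>K. if j = k then g a k * c k else 0)"
        unfolding wA[OF a] using LK[OF k] by (intro sum.cong) auto
      finally show ?thesis using k fin(1) by simp
    qed
    have LAA: "pairing n (L a) (w b) = (\<Sum>k\<in>K. g b k * (g a k * c k))" if "a \<in> A" "b \<in> A" for a b
      unfolding wA[OF that(2)] using LA[OF that(1)] by (intro sum.cong) auto
    \<comment> \<open>The vectors of \<open>a\<close> and \<open>b\<close> share only the basis
      vector of their pair: \<open>k0\<close> occurs in that of \<open>a0\<close> alone.
      Orthogonality of \<open>a\<close> and \<open>b\<close> therefore isolates one
      coefficient.\<close>
    have c1: "c k = 0" if k: "k \<in> K - {k0}" for k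
    proof -
      have "f k \<subseteq> A" "card (f k) = 2" using f k unfolding bij_betw_def by blast+
      then obtain a b where ab: "f k = {a, b}" "a \<noteq> b" "a \<in> A" "b \<in> A"
        by (auto simp: card_2_iff)
      have "g b j * (g a j * c j) = (if j = k then c k else 0)" if j: "j \<in> K" for j
      proof (cases "j = k0 \<or> j = k")
        case True
        then show ?thesis using ab k by (auto simp: g_def)
      next
        case False
        then have "f j \<noteq> f k" "f j \<subseteq> A" "card (f j) = 2"
          using f j k unfolding bij_betw_def inj_on_def by blast+
        then have "\<not> (a \<in> f j \<and> b \<in> f j)"
          using ab(1,2) by (auto simp: card_2_iff)
        then show ?thesis using False by (auto simp: g_def)
      qed
      then have "pairing n (L a) (w b) = (\<Sum>j\<in>K. if j = k then c k else 0)"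
        unfolding LAA[OF ab(3,4)] by (intro sum.cong) auto
      moreover have "pairing n (L a) (w b) = 0" using L ab(2,3,4) KA(3) by blast
      ultimately show ?thesis using k fin(1) by simp
    qed
    \<comment> \<open>The equation at \<open>z\<close> is either c_k0 = 0 itself or a zero norm of
      v_z, in which only c_k0 is left once the other coefficients vanish.\<close>
    have c0: "c k0 = 0"
    proof (cases "z \<in> K")
      case True
      then show ?thesis using L k0 wK[OF k0(1), of "L k0"] by (simp add: c_def)
    next
      case False
      then have zA: "z \<in> A" "a0 = z" using z a0 by blast+
      have "pairing n (L z) (w z) = (\<Sum>k\<in>K. if k = k0 then c k0 else 0)"
        unfolding LAA[OF zA(1) zA(1)] using zA(2) c1 by (intro sum.cong) (auto simp: g_def)
      then show ?thesis using L k0(1) fin(1) by simp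
    qed
    have c: "c k = 0" if "k \<in> K" for k using c0 c1 that by blast
    show "\<forall>j\<in>K \<union> A. \<forall>i\<le>n. L j i = 0"
    proof (intro ballI allI impI)
      fix j i assume j: "j \<in> K \<union> A" and "i \<le> n"
      then obtain k where k: "k \<in> K" "i = ix k" using ix unfolding bij_betw_def by (metis atMost_iff imageE)
      show "L j i = 0" using j k c LK[of j k] LA[of j k] by auto
    qed
  qed
  then have "injective_system ((K \<union> A) \<times> (K \<union> A)) ((K \<union> A) \<times> {..n}) (\<lambda>r c. coupled_matrix K z r c w)"
    using coupled_forms_trivial_iff[OF fin KA(3) z] by blast
  then show ?thesis
    unfolding coupled_forms_trivial_iff[OF fin KA(3) z]
  proof (rule injective_system_generic[rotated 2])
    let ?e = "\<lambda>i l :: nat. if l = i then 1 else 0 :: int"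
    fix r c assume r: "r \<in> (K \<union> A) \<times> (K \<union> A)" and c: "c \<in> (K \<union> A) \<times> {..n}"
    obtain i j l s where rc: "r = (i, j)" "c = (l, s)" by (metis surj_pair)
    have ijs: "i < d" "j < d" "s \<le> n" using r c KA(1,2) by (auto simp: rc)
    \<comment> \<open>The two possible degrees of a nonzero entry, according to whether its column
      belongs to i or to j.\<close>
    have e: "(\<lambda>x. ?e i x + ?e j x - ?e i x) = ?e j" "(\<lambda>x. ?e i x + ?e j x - ?e j x) = ?e i" by auto
    have "mhom n d (\<lambda>x. ?e i x + ?e j x - ?e l x) (coupled_matrix K z (i, j) (l, s))"
      unfolding coupled_matrix_def fst_conv snd_conv
      using ijs by (cases "i \<in> K \<longleftrightarrow> j \<in> K"; cases "l = i"; cases "l = j"; cases "i \<noteq> j \<or> i = z")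
        (auto simp: e mhom_zero intro!: mhom_diff mhom_uminus mhom_coord)
    then show "mhom n d (\<lambda>x. (case r of (i, j) \<Rightarrow> \<lambda>x. ?e i x + ?e j x) x - (case c of (l, s) \<Rightarrow> ?e l) x)
        (coupled_matrix K z r c)"
      by (simp add: rc)
  qed (use fin in simp)
qed

subsection \<open>Quadratic cycles\<close>

definition no_quadratic_cycles :: "nat \<Rightarrow> nat \<Rightarrow> nat \<Rightarrow> (nat \<Rightarrow> nat \<Rightarrow> 'k::field) \<Rightarrow> bool"
  where "no_quadratic_cycles n p d v \<longleftrightarrow> (\<forall>u \<in> chains n {} p 2.
    koszul u = 0 \<and> (\<forall>j<d. \<forall>A. eval (v j) (Poly_Mapping.lookup u A) = 0) \<longrightarrow> u = 0)"

section \<open>Coordinates on chains of quadrics\<close>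

definition quad_index :: "nat \<Rightarrow> nat \<Rightarrow> (nat set \<times> nat \<times> nat) set"
  where "quad_index n p = {A. A \<subseteq> {..n} \<and> card A = p} \<times> (SIGMA t:{..n}. {..t})"

definition quad_basis :: "nat set \<times> nat \<times> nat \<Rightarrow> 'k::field chain"
  where "quad_basis c = Poly_Mapping.single (fst c) (Poly_Mapping.single (pair_monom (snd (snd c)) (fst (snd c))) 1)"

definition quad_chain :: "nat \<Rightarrow> nat \<Rightarrow> (nat set \<times> nat \<times> nat \<Rightarrow> 'k::field) \<Rightarrow> 'k chain"
  where "quad_chain n p x = (\<Sum>c\<in>quad_index n p. cscale (x c) (quad_basis c))"

lemma finite_quad_index: "finite (quad_index n p)"
  unfolding quad_index_def by (intro finite_cartesian_product finite_SigmaI) auto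

lemma pair_monom_deg:
  fixes c :: "'k::field"
  assumes "s \<le> n" "t \<le> n"
  shows "Poly_Mapping.single (pair_monom s t) c \<in> polyS_deg n 2"
proof -
  have "Poly_Mapping.single (pair_monom s t) c = Const c * (Var s * Var t)"
    using monom_coefficient[of 0 s c t] by (simp add: mult_ac)
  moreover have "(Var s * Var t :: (nat, 'k) mpoly) \<in> polyS_deg n (1 + 1)"
    by (intro polyS_deg_mult polyS_deg_Var assms)
  ultimately show ?thesis by (simp add: polyS_deg_Const_mult)
qed

lemma quad_chain_chains: "quad_chain n p x \<in> chains n {} p 2"
  unfolding quad_chain_def
proof (intro chain.subspace_sum[OF subspace_chains] chain.subspace_scale[OF subspace_chains])
  fix c assume "c \<in> quad_index n p"
  then show "quad_basis c \<in> chains n {} p 2"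
    by (auto simp: quad_index_def quad_basis_def chains_empty_iff intro!: pair_monom_deg)
qed

lemma lookup_quad_chain:
  assumes "A \<subseteq> {..n}" "card A = p"
  shows "Poly_Mapping.lookup (quad_chain n p x) A = (\<Sum>t\<le>n. \<Sum>s\<le>t. Poly_Mapping.single (pair_monom s t) (x (A, t, s)))"
proof -
  let ?S = "{A. A \<subseteq> {..n} \<and> card A = p}" and ?T = "SIGMA t:{..n}. {..t}"
  have "Poly_Mapping.lookup (quad_chain n p x) A =
      (\<Sum>c\<in>?S \<times> ?T. if fst c = A then Poly_Mapping.single (pair_monom (snd (snd c)) (fst (snd c))) (x c) else 0)"
    unfolding quad_chain_def quad_index_def lookup_sum
    by (intro sum.cong refl)
      (auto simp: lookup_cscale quad_basis_def lookup_single when_def pscale_def Const_def mult_single)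
  also have "\<dots> = (\<Sum>B\<in>?S. \<Sum>e\<in>?T. if B = A then Poly_Mapping.single (pair_monom (snd e) (fst e)) (x (A, e)) else 0)"
    by (subst sum.cartesian_product) (auto intro!: sum.cong)
  also have "\<dots> = (\<Sum>B\<in>?S. if B = A then \<Sum>e\<in>?T. Poly_Mapping.single (pair_monom (snd e) (fst e)) (x (A, e)) else 0)"
    by (intro sum.cong) auto
  also have "\<dots> = (\<Sum>e\<in>?T. Poly_Mapping.single (pair_monom (snd e) (fst e)) (x (A, e)))"
    using assms by simp
  also have "\<dots> = (\<Sum>t\<le>n. \<Sum>s\<le>t. Poly_Mapping.single (pair_monom s t) (x (A, t, s)))"
    by (subst sum.Sigma) (auto simp: case_prod_beta)
  finally show ?thesis .
qed

lemma quad_chain_surj: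
  assumes u: "u \<in> chains n {} p 2"
  shows "u = quad_chain n p (\<lambda>(A, t, s). quad_coeff (Poly_Mapping.lookup u A) s t)"
proof (rule poly_mapping_eqI)
  fix A
  let ?x = "\<lambda>(A, t, s). quad_coeff (Poly_Mapping.lookup u A) s t"
  show "Poly_Mapping.lookup u A = Poly_Mapping.lookup (quad_chain n p ?x) A"
  proof (cases "A \<subseteq> {..n} \<and> card A = p")
    case True
    have "Poly_Mapping.lookup u A \<in> polyS_deg n 2"
      using lookup_chains[OF u] by (simp add: ideal_deg_iff)
    from quadric_eq[OF this] show ?thesis using True by (simp add: lookup_quad_chain)
  next
    case False
    then have "A \<notin> Poly_Mapping.keys u" "A \<notin> Poly_Mapping.keys (quad_chain n p ?x)"
      using u quad_chain_chains[of n p ?x] unfolding chains_empty_iff by blast+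
    then show ?thesis by (simp add: not_in_keys_iff_lookup_eq_zero)
  qed
qed

lemma quad_coeff_quad_chain:
  assumes "(A, t, s) \<in> quad_index n p"
  shows "quad_coeff (Poly_Mapping.lookup (quad_chain n p x) A) s t = x (A, t, s)"
proof -
  have h: "A \<subseteq> {..n}" "card A = p" "t \<le> n" "s \<le> t" using assms by (auto simp: quad_index_def)
  have eq: "pair_monom s' t' = pair_monom s t \<longleftrightarrow> s' = s \<and> t' = t" if "s' \<le> t'" for s' t'
    using that h(4) pair_monom_inject by blast
  have "quad_coeff (Poly_Mapping.lookup (quad_chain n p x) A) s t =
      (\<Sum>t'\<le>n. \<Sum>s'\<le>t'. if s' = s \<and> t' = t then x (A, t, s) else 0)"
    unfolding lookup_quad_chain[OF h(1,2)] quad_coeff_def lookup_sum lookup_single when_def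
    by (intro sum.cong refl) (auto simp: eq)
  also have "\<dots> = (\<Sum>t'\<le>n. if t' = t then x (A, t, s) else 0)"
    using h(4) by (intro sum.cong refl) auto
  also have "\<dots> = x (A, t, s)" using h(3) by simp
  finally show ?thesis .
qed

text \<open>Rows \<open>Inl\<close> express vanishing at point j and have degree 2 in that point;
  rows \<open>Inr\<close> express that a coefficient of the boundary is zero and are constant in the
  points.\<close>

definition cycle_matrix :: "(nat set \<times> nat) + (nat set \<times> (nat \<Rightarrow>\<^sub>0 nat)) \<Rightarrow> nat set \<times> nat \<times> nat \<Rightarrow>
    (nat \<Rightarrow> nat \<Rightarrow> 'k::field) \<Rightarrow> 'k"
  where "cycle_matrix r c v = (case r of
     Inl (A, j) \<Rightarrow> if fst c = A then v j (snd (snd c)) * v j (fst (snd c)) else 0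
   | Inr (B, \<mu>) \<Rightarrow> Poly_Mapping.lookup (Poly_Mapping.lookup (koszul (quad_basis c)) B) \<mu>)"

lemma cycle_matrix_vanishing:
  "(\<Sum>c\<in>quad_index n p. cycle_matrix (Inl (A, j)) c v * x c) = eval (v j) (Poly_Mapping.lookup (quad_chain n p x) A)"
  unfolding quad_chain_def lookup_sum eval_sum
  by (intro sum.cong)
    (auto simp: cycle_matrix_def lookup_cscale quad_basis_def lookup_single when_def pair_monom_def monom_val_add)

lemma cycle_matrix_koszul:
  "(\<Sum>c\<in>quad_index n p. cycle_matrix (Inr (B, \<mu>)) c v * x c) =
    Poly_Mapping.lookup (Poly_Mapping.lookup (koszul (quad_chain n p x)) B) \<mu>"
proof -
  have "Poly_Mapping.lookup (pscale a f) \<mu> = a * Poly_Mapping.lookup f \<mu>" for a and f :: "(nat, 'a) mpoly"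
    by (subst poly_mapping_eq_sum_single[of f], subst (2) poly_mapping_eq_sum_single[of f])
      (simp add: pscale_def Const_def sum_distrib_left mult_single lookup_sum lookup_single when_def if_distrib cong: if_cong)
  then show ?thesis
    unfolding quad_chain_def koszul_sum lookup_sum
    by (intro sum.cong) (auto simp: cycle_matrix_def koszul_cscale lookup_cscale mult.commute)
qed

definition cycle_rows :: "nat \<Rightarrow> ((nat set \<times> nat) + (nat set \<times> (nat \<Rightarrow>\<^sub>0 nat))) set"
  where "cycle_rows d = {r. case r of Inl (A, j) \<Rightarrow> j < d | Inr _ \<Rightarrow> True}"

lemma cycle_rows_iff:
  "(\<forall>r\<in>cycle_rows d. (\<Sum>c\<in>quad_index n p. cycle_matrix r c v * x c) = 0) \<longleftrightarrow>
    koszul (quad_chain n p x) = 0 \<and> (\<forall>j<d. \<forall>A. eval (v j) (Poly_Mapping.lookup (quad_chain n p x) A) = 0)"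
  (is "?L \<longleftrightarrow> ?R")
proof
  assume L: ?L
  have "Poly_Mapping.lookup (Poly_Mapping.lookup (koszul (quad_chain n p x)) B) \<mu> = 0" for B \<mu>
    using L[rule_format, of "Inr (B, \<mu>)"] by (simp add: cycle_rows_def cycle_matrix_koszul)
  then have "koszul (quad_chain n p x) = 0"
    by (intro poly_mapping_eqI) simp
  moreover have "eval (v j) (Poly_Mapping.lookup (quad_chain n p x) A) = 0" if "j < d" for j A
    using L[rule_format, of "Inl (A, j)"] that by (simp add: cycle_rows_def cycle_matrix_vanishing)
  ultimately show ?R by blast
next
  assume R: ?R
  show ?L
  proof
    fix r assume r: "r \<in> cycle_rows d"
    show "(\<Sum>c\<in>quad_index n p. cycle_matrix r c v * x c) = 0"
    proof (cases r)
      case (Inl a)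
      obtain A j where "a = (A, j)" by (cases a)
      then show ?thesis using r R by (simp add: Inl cycle_rows_def cycle_matrix_vanishing)
    next
      case (Inr a)
      obtain B \<mu> where "a = (B, \<mu>)" by (cases a)
      then show ?thesis using R by (simp add: Inr cycle_matrix_koszul)
    qed
  qed
qed

lemma no_quadratic_cycles_iff:
  "no_quadratic_cycles n p d v \<longleftrightarrow> injective_system (cycle_rows d) (quad_index n p) (\<lambda>r c. cycle_matrix r c v)"
proof
  assume no: "no_quadratic_cycles n p d v"
  show "injective_system (cycle_rows d) (quad_index n p) (\<lambda>r c. cycle_matrix r c v)"
    unfolding injective_system_def cycle_rows_iff
  proof (intro allI impI ballI)
    fix x :: "nat set \<times> nat \<times> nat \<Rightarrow> 'a" and c
    assume "koszul (quad_chain n p x) = 0 \<and>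
      (\<forall>j<d. \<forall>A. eval (v j) (Poly_Mapping.lookup (quad_chain n p x) A) = 0)"
    then have 0: "quad_chain n p x = 0"
      using no quad_chain_chains[of n p x] unfolding no_quadratic_cycles_def by blast
    assume c: "c \<in> quad_index n p"
    obtain A t s where "c = (A, t, s)" by (metis surj_pair)
    then show "x c = 0" using quad_coeff_quad_chain[of A t s n p x] c by (simp add: 0 quad_coeff_def)
  qed
next
  assume inj: "injective_system (cycle_rows d) (quad_index n p) (\<lambda>r c. cycle_matrix r c v)"
  show "no_quadratic_cycles n p d v"
    unfolding no_quadratic_cycles_def
  proof (intro ballI impI)
    fix u assume u: "u \<in> chains n {} p 2"
      and 0: "koszul u = 0 \<and> (\<forall>j<d. \<forall>A. eval (v j) (Poly_Mapping.lookup u A) = 0)"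
    obtain x where x: "u = quad_chain n p x" using quad_chain_surj[OF u] by blast
    have "\<forall>c\<in>quad_index n p. x c = 0"
      using inj[unfolded injective_system_def cycle_rows_iff, THEN spec, of x] 0[unfolded x] by (rule mp)
    then show "u = 0" by (simp add: x quad_chain_def)
  qed
qed

section \<open>Coefficients and special values of quadrics\<close>

lemma lookup_Var_mult:
  "Poly_Mapping.lookup (Var a * f) (Poly_Mapping.single a 1 + m) = Poly_Mapping.lookup f m"
  "Poly_Mapping.lookup \<mu> a = 0 \<Longrightarrow> Poly_Mapping.lookup (Var a * f) \<mu> = 0"
proof -
  have eq: "Poly_Mapping.lookup (Var a * f) \<nu> =
      (\<Sum>l\<in>Poly_Mapping.keys f. if Poly_Mapping.single a 1 + l = \<nu> then Poly_Mapping.lookup f l else 0)" for \<nu>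
    by (subst poly_mapping_eq_sum_single[of f])
      (simp add: Var_def sum_distrib_left mult_single lookup_sum lookup_single when_def)
  show "Poly_Mapping.lookup (Var a * f) (Poly_Mapping.single a 1 + m) = Poly_Mapping.lookup f m"
    unfolding eq by (auto simp: not_in_keys_iff_lookup_eq_zero)
  assume "Poly_Mapping.lookup \<mu> a = 0"
  then have "Poly_Mapping.single a 1 + l \<noteq> \<mu>" for l by (auto simp: lookup_add)
  then show "Poly_Mapping.lookup (Var a * f) \<mu> = 0" unfolding eq by simp
qed

lemma lookup_sign_mult:
  "Poly_Mapping.lookup (above_sign a B * f) \<mu> = above_sign a B * Poly_Mapping.lookup (f :: (nat, 'k::field) mpoly) \<mu>"
proof -
  have "Poly_Mapping.lookup ((-1) ^ k * f) \<mu> = (-1) ^ k * Poly_Mapping.lookup f \<mu>" for k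
    by (induction k) simp_all
  then show ?thesis by (simp add: above_sign_def)
qed

lemma eval_quadric_pair:
  assumes q: "q \<in> polyS_deg n 2" and ik: "i < k" "k \<le> n"
  shows "eval (\<lambda>l. if l = i \<or> l = k then 1 else 0) q = quad_coeff q i i + quad_coeff q i k + quad_coeff q k k"
proof -
  let ?v = "\<lambda>l. if l = i \<or> l = k then 1 else 0 :: 'a"
  have "eval ?v q = (\<Sum>t\<le>n. \<Sum>s\<le>t. quad_coeff q s t * (?v s * ?v t))" by (rule eval_quadric[OF q])
  also have "\<dots> = (\<Sum>t\<in>{i, k}. \<Sum>s\<le>t. quad_coeff q s t * (?v s * ?v t))"
    using ik by (intro sum.mono_neutral_right) auto
  also have "\<dots> = (\<Sum>s\<le>i. quad_coeff q s i * ?v s) + (\<Sum>s\<le>k. quad_coeff q s k * ?v s)"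
    using ik by simp
  also have "(\<Sum>s\<le>i. quad_coeff q s i * ?v s) = (\<Sum>s\<in>{i}. quad_coeff q s i * ?v s)"
    using ik by (intro sum.mono_neutral_right) auto
  also have "(\<Sum>s\<le>k. quad_coeff q s k * ?v s) = (\<Sum>s\<in>{i, k}. quad_coeff q s k * ?v s)"
    using ik by (intro sum.mono_neutral_right) auto
  finally show ?thesis using ik by simp
qed

lemma eval_quadric_unit:
  assumes q: "q \<in> polyS_deg n 2" and i: "i \<le> n"
  shows "eval (\<lambda>l. if l = i then 1 else 0) q = quad_coeff q i i"
proof -
  let ?v = "\<lambda>l. if l = i then 1 else 0 :: 'a"
  have "eval ?v q = (\<Sum>t\<le>n. \<Sum>s\<le>t. quad_coeff q s t * (?v s * ?v t))" by (rule eval_quadric[OF q])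
  also have "\<dots> = (\<Sum>t\<in>{i}. \<Sum>s\<le>t. quad_coeff q s t * (?v s * ?v t))"
    using i by (intro sum.mono_neutral_right) auto
  also have "\<dots> = (\<Sum>s\<le>i. quad_coeff q s i * ?v s)" by simp
  also have "\<dots> = (\<Sum>s\<in>{i}. quad_coeff q s i * ?v s)"
    by (intro sum.mono_neutral_right) auto
  finally show ?thesis by simp
qed

text \<open>
  The points with indicator vectors of \<open>{i}\<close> and \<open>{i, k}\<close>, \<open>k \<ge> i + 2\<close>, have \<open>I\<^sub>2\<close> spanned by the \<open>x\<^sub>i x\<^sub>i\<^sub>+\<^sub>1\<close>.
  Every \<open>A\<close> with three elements contains some \<open>a\<close> such that \<open>x\<^sub>i x\<^sub>i\<^sub>+\<^sub>1\<close> is the only one of them whose multiple by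
  a variable is \<open>x\<^sub>a x\<^sub>i x\<^sub>i\<^sub>+\<^sub>1\<close> with the variable outside of \<open>A - {a}\<close>.
\<close>

definition witness_pairs :: "nat \<Rightarrow> (nat \<times> nat) list"
  where "witness_pairs n = concat (map (\<lambda>k. map (\<lambda>i. (i, k)) (filter (\<lambda>i. k \<noteq> Suc i) [0..<Suc k])) [0..<Suc n])"

lemma set_witness_pairs: "set (witness_pairs n) = {(i, k). i \<le> k \<and> k \<le> n \<and> k \<noteq> Suc i}"
  by (auto simp: witness_pairs_def less_Suc_eq_le simp del: upt_Suc)

text \<open>There are 28 pairs i at most k up to 6, and 6 of them are adjacent.\<close>

lemma length_witness_pairs_6: "length (witness_pairs 6) = 22"
  by (simp add: witness_pairs_def numeral_eq_Suc)

lemma no_quadratic_cycles_witness: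
  fixes w :: "nat \<Rightarrow> nat \<Rightarrow> 'k::field"
  assumes w: "\<And>i k. i \<le> k \<Longrightarrow> k \<le> n \<Longrightarrow> k \<noteq> Suc i \<Longrightarrow> \<exists>j<d. w j = (\<lambda>l. if l = i \<or> l = k then 1 else 0)"
  shows "no_quadratic_cycles n 3 d w"
  unfolding no_quadratic_cycles_def
proof (intro ballI impI)
  fix u assume u: "u \<in> chains n {} 3 2"
    and 0: "koszul u = 0 \<and> (\<forall>j<d. \<forall>A. eval (w j) (Poly_Mapping.lookup u A) = 0)"
  define q where "q = Poly_Mapping.lookup u"
  have deg: "q A \<in> polyS_deg n 2" for A unfolding q_def using lookup_chains[OF u] by (simp add: ideal_deg_iff)
  have van: "eval (\<lambda>l. if l = i \<or> l = k then 1 else 0) (q A) = 0" if "i \<le> k" "k \<le> n" "k \<noteq> Suc i" for i k A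
    using w[OF that] 0 unfolding q_def by metis
  have diag: "quad_coeff (q A) i i = 0" if "i \<le> n" for A i
    using van[of i i A] that eval_quadric_unit[OF deg that] by simp
  have nonadj: "quad_coeff (q A) i k = 0" if "i \<le> k" "k \<le> n" "k \<noteq> Suc i" for A i k
    using van[OF that] that eval_quadric_pair[OF deg, of i k A] diag[of i A] diag[of k A]
    by (cases "i = k") auto
  have adj: "quad_coeff (q A) i (Suc i) = 0" if A: "A \<subseteq> {..n}" "card A = 3" and i: "Suc i \<le> n" for A i
  proof -
    have finA: "finite A" using A(1) finite_subset by blast
    \<comment> \<open>Two excluded indices cannot exhaust three elements. For i = 0 the truncated
      difference i - 1 is 0.\<close>
    have "\<not> A \<subseteq> {i - 1, i + 2}"
    proof
      assume "A \<subseteq> {i - 1, i + 2}"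
      then have "card A \<le> card {i - 1, i + 2}" by (intro card_mono) auto
      also have "\<dots> \<le> 2" by (simp add: card_insert_if)
      finally show False using A(2) by simp
    qed
    then obtain a where a: "a \<in> A" "a \<noteq> i - 1" "a \<noteq> i + 2" by blast
    define B where "B = A - {a}"
    have B: "B \<subseteq> {..n}" "a \<notin> B" "insert a B = A" using A(1) a(1) by (auto simp: B_def)
    define \<mu> where "\<mu> = Poly_Mapping.single a 1 + pair_monom i (Suc i)"
    \<comment> \<open>Division of \<open>\<mu>\<close> by another variable x_b leaves x_a x_(i+1) or
      x_a x_i, or is impossible. The choice of \<open>a\<close> makes these products nonadjacent, so
      their coefficients are zero and only the term of \<open>a\<close> survives in the cycle
      condition.\<close>
    have other: "Poly_Mapping.lookup (Var b * q (insert b B)) \<mu> = 0" if b: "b \<noteq> a" for b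
    proof -
      have an: "a \<le> n" using A(1) a(1) by blast
      consider "b = i" | "b = Suc i" | "b \<noteq> i" "b \<noteq> Suc i" by blast
      then show ?thesis
      proof cases
        case 1
        have "\<mu> = Poly_Mapping.single b 1 + pair_monom a (Suc i)"
          by (simp add: \<mu>_def 1 pair_monom_def add_ac)
        moreover have "Poly_Mapping.lookup (q C) (pair_monom a (Suc i)) = 0" for C
        proof (cases "a \<le> Suc i")
          case True
          then show ?thesis using nonadj[of a "Suc i" C] b 1 i by (auto simp: quad_coeff_def)
        next
          case False
          then show ?thesis using nonadj[of "Suc i" a C] a(3) an
            by (auto simp: quad_coeff_def pair_monom_commute[of a])
        qed
        ultimately show ?thesis by (simp only: lookup_Var_mult)
      next
        case 2
        have "\<mu> = Poly_Mapping.single b 1 + pair_monom a i"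
          by (simp add: \<mu>_def 2 pair_monom_def add_ac)
        moreover have "Poly_Mapping.lookup (q C) (pair_monom a i) = 0" for C
        proof (cases "a \<le> i")
          case True
          then show ?thesis using nonadj[of a i C] a(2) i by (auto simp: quad_coeff_def)
        next
          case False
          then show ?thesis using nonadj[of i a C] b 2 an
            by (auto simp: quad_coeff_def pair_monom_commute[of a])
        qed
        ultimately show ?thesis by (simp only: lookup_Var_mult)
      next
        case 3
        then show ?thesis using b by (intro lookup_Var_mult(2)) (simp add: \<mu>_def lookup_add lookup_pair_monom lookup_single when_def)
      qed
    qed
    have "0 = Poly_Mapping.lookup (contr n Var q B) \<mu>"
      using lookup_koszul[of u n B] u 0 by (simp add: chains_empty_iff q_def)
    also have "\<dots> = (\<Sum>b\<in>{..n} - B. above_sign b B * Poly_Mapping.lookup (Var b * q (insert b B)) \<mu>)"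
      using B(1) by (simp add: contr_def lookup_sum mult.assoc lookup_sign_mult)
    also have "\<dots> = (\<Sum>b\<in>{a}. above_sign b B * Poly_Mapping.lookup (Var b * q (insert b B)) \<mu>)"
      using A(1) a(1) B(2) other by (intro sum.mono_neutral_right) auto
    also have "\<dots> = above_sign a B * quad_coeff (q A) i (Suc i)"
      using lookup_Var_mult(1)[of a "q A" "pair_monom i (Suc i)"] by (simp add: \<mu>_def B(3) quad_coeff_def)
    finally show ?thesis by (simp add: above_sign_def)
  qed
  have "q A = 0" for A
  proof (cases "A \<subseteq> {..n} \<and> card A = 3")
    case True
    have "quad_coeff (q A) s t = 0" if "t \<le> n" "s \<le> t" for s t
      using that True nonadj adj by (cases "t = Suc s") auto
    then show ?thesis using quadric_eq[OF deg[of A]] by simp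
  next
    case False
    then have "A \<notin> Poly_Mapping.keys u" using u unfolding chains_empty_iff by blast
    then show ?thesis by (simp add: q_def not_in_keys_iff_lookup_eq_zero)
  qed
  then show "u = 0" unfolding q_def by (intro poly_mapping_eqI) simp
qed

lemma generic_no_quadratic_cycles:
  "generically 6 22 (\<lambda>v :: nat \<Rightarrow> nat \<Rightarrow> 'k::field. no_quadratic_cycles 6 3 22 v)"
proof -
  define w where "w = (\<lambda>j l. if l = fst (witness_pairs 6 ! j) \<or> l = snd (witness_pairs 6 ! j) then 1 else 0 :: 'k)"
  have "\<exists>j<22. w j = (\<lambda>l. if l = i \<or> l = k then 1 else 0)" if "i \<le> k" "k \<le> 6" "k \<noteq> Suc i" for i k
  proof -
    have "(i, k) \<in> set (witness_pairs 6)" using that by (simp add: set_witness_pairs)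
    then obtain j where "j < 22" "witness_pairs 6 ! j = (i, k)"
      by (auto simp: in_set_conv_nth length_witness_pairs_6)
    then show ?thesis by (intro exI[of _ j]) (auto simp: w_def)
  qed
  then have "no_quadratic_cycles 6 3 22 w" by (rule no_quadratic_cycles_witness)
  then have "injective_system (cycle_rows 22) (quad_index 6 3) (\<lambda>r c. cycle_matrix r c w)"
    by (simp add: no_quadratic_cycles_iff)
  then show ?thesis
    unfolding no_quadratic_cycles_iff
  proof (rule injective_system_generic[rotated 2])
    \<comment> \<open>Degree 2 in the point of an \<open>Inl\<close> row, with all column degrees
      zero.\<close>
    define dr where "dr = (\<lambda>r :: (nat set \<times> nat) + (nat set \<times> (nat \<Rightarrow>\<^sub>0 nat)). \<lambda>l.
      (case r of Inl (A, j) \<Rightarrow> (if l = j then 1 else 0) + (if l = j then 1 else 0) | Inr _ \<Rightarrow> 0) :: int)"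
    fix r c assume r: "r \<in> cycle_rows 22" and c: "c \<in> quad_index 6 3"
    have c': "fst (snd c) \<le> 6" "snd (snd c) \<le> 6" using c by (auto simp: quad_index_def)
    have "mhom 6 22 (dr r) (cycle_matrix r c :: (nat \<Rightarrow> nat \<Rightarrow> 'k) \<Rightarrow> 'k)"
    proof (cases r)
      case (Inl a)
      obtain A j where a: "a = (A, j)" by (cases a)
      then have "j < 22" using r by (simp add: Inl cycle_rows_def)
      then show ?thesis
        unfolding Inl a cycle_matrix_def dr_def sum.case prod.case using c'
        by (cases "fst c = A") (simp_all only: if_True if_False simp_thms, intro mhom_mult mhom_coord, simp_all, rule mhom_zero)
    next
      case (Inr a)
      obtain B \<mu> where a: "a = (B, \<mu>)" by (cases a)
      show ?thesis unfolding Inr a cycle_matrix_def dr_def by (simp add: mhom_const)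
    qed
    then show "mhom 6 22 (\<lambda>l. dr r l - (\<lambda>c l. 0) c l) (cycle_matrix r c :: (nat \<Rightarrow> nat \<Rightarrow> 'k) \<Rightarrow> 'k)" by simp
  qed (rule finite_quad_index)
qed

section \<open>Twenty-two general points\<close>

lemma mhom_imp_multihomogeneous:
  assumes "mhom n d e F"
  obtains f where "multihomogeneous n d f" "\<And>v. F v = eval (\<lambda>(j, i). v j i) f"
    "\<And>m. m \<in> Poly_Mapping.keys f \<Longrightarrow> Poly_Mapping.keys m \<subseteq> {..<d} \<times> {..n}"
proof -
  obtain f where f: "\<forall>m\<in>Poly_Mapping.keys f. Poly_Mapping.keys m \<subseteq> {..<d} \<times> {..n} \<and>
       (\<forall>j<d. int (\<Sum>i\<le>n. Poly_Mapping.lookup m (j, i)) = e j)" "\<forall>v. F v = eval (\<lambda>(j, i). v j i) f"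
    using assms unfolding mhom_def by blast
  have "\<exists>e'. \<forall>m\<in>Poly_Mapping.keys f. \<forall>j<d. (\<Sum>i\<le>n. Poly_Mapping.lookup m (j, i)) = e' j"
  proof (intro exI ballI allI impI)
    fix m j assume "m \<in> Poly_Mapping.keys f" "j < d"
    then have "int (\<Sum>i\<le>n. Poly_Mapping.lookup m (j, i)) = e j" using f(1) by blast
    then show "(\<Sum>i\<le>n. Poly_Mapping.lookup m (j, i)) = nat (e j)" by linarith
  qed
  then have "multihomogeneous n d f" unfolding multihomogeneous_def using f(1) by blast
  then show thesis using that f by blast
qed

text \<open>All splittings into \<open>K\<close> and \<open>A\<close> are quantified because Y may
  be any 11 of the points; there are finitely many, so the conjunction is still generic.\<close>

definition general_points :: "(nat \<Rightarrow> nat \<Rightarrow> 'k::field) \<Rightarrow> bool"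
  where "general_points v \<longleftrightarrow>
    (\<forall>J\<in>{J. J \<subseteq> {..<22} \<and> card J = 7}. indep_points 6 v J) \<and>
    (\<forall>(K, A, z)\<in>{(K, A, z). K \<subseteq> {..<22} \<and> A \<subseteq> {..<22} \<and> K \<inter> A = {} \<and> card K = 7 \<and> card A = 4 \<and> z \<in> K \<union> A}.
      coupled_forms_trivial 6 v K A z) \<and>
    no_quadratic_cycles 6 3 22 v"

lemma generic_general_points:
  "generically 6 22 (general_points :: (nat \<Rightarrow> nat \<Rightarrow> 'k::alg_closed_field) \<Rightarrow> bool)"
proof -
  note inf = infinite_alg_closed_field[where 'k = 'k]
  let ?S = "{(K, A, z). K \<subseteq> {..<22::nat} \<and> A \<subseteq> {..<22::nat} \<and> K \<inter> A = {} \<and> card K = 7 \<and> card A = 4 \<and> z \<in> K \<union> A}"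
  have "?S \<subseteq> Pow {..<22} \<times> Pow {..<22} \<times> {..<22}" by auto
  then have finS: "finite ?S" by (rule finite_subset) auto
  have "generically 6 22 (\<lambda>v :: nat \<Rightarrow> nat \<Rightarrow> 'k. \<forall>J\<in>{J. J \<subseteq> {..<22} \<and> card J = 7}. indep_points 6 v J)"
    by (intro generically_Ball[OF inf]) (auto intro: generic_indep_points)
  moreover have "generically 6 22 (\<lambda>v :: nat \<Rightarrow> nat \<Rightarrow> 'k. \<forall>(K, A, z)\<in>?S. coupled_forms_trivial 6 v K A z)"
  proof (rule generically_Ball[OF inf finS])
    fix s assume s: "s \<in> ?S"
    obtain K A z where s': "s = (K, A, z)" by (metis surj_pair)
    have "(4::nat) choose 2 = 6" by (simp add: numeral_eq_Suc)
    then show "generically 6 22 (\<lambda>v :: nat \<Rightarrow> nat \<Rightarrow> 'k. case s of (K, A, z) \<Rightarrow> coupled_forms_trivial 6 v K A z)"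
      using s unfolding s' prod.case by (intro generic_coupled_forms_trivial) auto
  qed
  ultimately have "generically 6 22 (\<lambda>v :: nat \<Rightarrow> nat \<Rightarrow> 'k.
      (\<forall>J\<in>{J. J \<subseteq> {..<22} \<and> card J = 7}. indep_points 6 v J) \<and>
      ((\<forall>(K, A, z)\<in>?S. coupled_forms_trivial 6 v K A z) \<and> no_quadratic_cycles 6 3 22 v))"
    by (intro generically_conj[OF inf] generic_no_quadratic_cycles)
  then show ?thesis unfolding general_points_def .
qed

text \<open>Any two of the points lie among 7 independent ones. The case i = j says that no vector
  is zero, so that it represents a point; the case of distinct indices says that the points are
  distinct.\<close>

lemma general_points_separated:
  assumes v: "general_points v" and ij: "i < 22" "j < 22"
  shows "\<exists>x. pairing 6 x (v i) = 1 \<and> (i \<noteq> j \<longrightarrow> pairing 6 x (v j) = 0)"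
proof -
  have "card {i, j} \<le> 7" by (simp add: card_insert_if)
  then obtain J where J: "{i, j} \<subseteq> J" "J \<subseteq> {..<22}" "card J = 7"
    using exists_subset_between[of "{i, j}" 7 "{..<22}"] ij by auto
  have "finite J" using J(2) finite_subset by blast
  moreover have "indep_points 6 v J" using v J(2,3) unfolding general_points_def by blast
  ultimately obtain x where "\<forall>l\<in>J. pairing 6 x (v l) = (if l = i then 1 else 0)"
    using dual_form[of 6 v J i] J by auto
  then show ?thesis using J(1) by (intro exI[of _ x]) auto
qed

lemma general_points_inj:
  assumes v: "general_points v" and P: "\<And>j. j < 22 \<Longrightarrow> P j \<in> proj_space 6" "\<And>j. j < 22 \<Longrightarrow> v j \<in> P j"
  shows "inj_on P {..<22}"
proof (rule inj_onI, rule ccontr)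
  fix i j assume ij: "i \<in> {..<22}" "j \<in> {..<22}" "P i = P j" "i \<noteq> j"
  obtain x where x: "pairing 6 x (v i) = 1" "pairing 6 x (v j) = 0"
    using general_points_separated[OF v, of i j] ij by auto
  obtain c where c: "v i = (\<lambda>l. c * v j l)"
    using proj_space_scale[of "P i" 6 "v j" "v i"] P ij by auto
  have "pairing 6 x (v i) = c * pairing 6 x (v j)" unfolding c by (rule pairing_cmult_right)
  then show False using x by simp
qed

lemma general_points_not_predicted:
  fixes v :: "nat \<Rightarrow> nat \<Rightarrow> 'k::field"
  assumes v: "general_points v" and P: "\<And>j. j < 22 \<Longrightarrow> P j \<in> proj_space 6" "\<And>j. j < 22 \<Longrightarrow> v j \<in> P j"
    and Y: "Y \<subseteq> P ` {..<22}" "card Y = 11"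
  shows "\<not> predicted_subset_resolution 6 (P ` {..<22}) Y"
proof -
  define J where "J = {j. j < 22 \<and> P j \<in> Y}"
  have YJ: "Y = P ` J" using Y(1) by (auto simp: J_def)
  have J: "J \<subseteq> {..<22}" "finite J" by (auto simp: J_def)
  have "inj_on P J" using general_points_inj[OF v P] J(1) inj_on_subset by blast
  then have cardJ: "card J = 11" using Y(2) YJ card_image by metis
  obtain K where K: "K \<subseteq> J" "card K = 7" "finite K" using obtain_subset_with_card_n[of 7 J] cardJ by auto
  define A where "A = J - K"
  have KA: "K \<union> A = J" "K \<inter> A = {}" "finite A" using K(1) J(2) by (auto simp: A_def)
  have cardA: "card A = 4" using card_Diff_subset[OF K(3,1)] K(2) cardJ by (simp add: A_def)
  have PJ: "P j \<in> proj_space 6" "v j \<in> P j" if "j \<in> J" for j using P that J(1) by auto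
  have c42: "(4::nat) choose 2 = 6" by (simp add: numeral_eq_Suc)
  have triv: "coupled_forms_trivial 6 v K A z" if "z \<in> K \<union> A" for z
  proof -
    have "(K, A, z) \<in> {(K, A, z). K \<subseteq> {..<22} \<and> A \<subseteq> {..<22} \<and> K \<inter> A = {} \<and> card K = 7 \<and> card A = 4 \<and> z \<in> K \<union> A}"
      using that KA K J(1) cardA by auto
    then show ?thesis using v unfolding general_points_def by blast
  qed
  have indep: "indep_points 6 v I" if "I \<subseteq> J" "card I = Suc 6" for I
    using v that J(1) unfolding general_points_def by auto
  obtain y where y: "y \<in> koszul_ker 6 (P ` J) 2 3" "y \<notin> koszul ` chains 6 (P ` J) 3 2"
    using koszul_not_onto_cycles[OF K(3) KA(3,2), of 6 v P] cardA K(2) c42 triv indep PJ cardJ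
    unfolding KA(1) by force
  \<comment> \<open>11 times 20 is 220, below the 224 hook chains.\<close>
  have "card J * (6 choose 3) < (\<Sum>m\<le>6. (m choose 3) * Suc m)"
    unfolding cardJ by (simp add: numeral_eq_Suc)
  then obtain x where x: "x \<in> koszul_ker 6 (P ` J) 3 2" "x \<noteq> 0"
    using nonzero_koszul_cycle[OF J(2), of 6 3 P v] PJ by auto
  have "koszul_ker 6 (P ` {..<22}) 3 2 = {0}"
  proof -
    have "u = 0" if "u \<in> koszul_ker 6 (P ` {..<22}) 3 2" for u
    proof -
      have "u \<in> chains 6 (P ` {..<22}) 3 2" "koszul u = 0" using that by (auto simp: koszul_ker_def)
      then show ?thesis
        using v chains_iff_vanishing[of "{..<22}" P 6 v u 3 2] P
        unfolding general_points_def no_quadratic_cycles_def by auto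
    qed
    moreover have "0 \<in> koszul_ker 6 (P ` {..<22}) 3 2"
      by (simp add: koszul_ker_def chains_def)
    ultimately show ?thesis by blast
  qed
  then show ?thesis
    using not_predicted_subset_resolution[of 6 "P ` {..<22}" 2 2 x "P ` J" y] x y
    by (simp add: YJ numeral_3_eq_3)
qed

theorem mainTheorem2:
  shows "(\<exists>U :: (nat \<Rightarrow> (nat \<Rightarrow> 'k::alg_closed_field) set) set.
            zariski_open_tuples 6 22 U \<and> U \<noteq> {} \<and>
            (\<forall>P\<in>U. card (P ` {..<22}) = 22 \<and>
               (\<forall>Y\<subseteq>P ` {..<22}. card Y = 11 \<longrightarrow>
                  \<not> predicted_subset_resolution 6 (P ` {..<22}) Y)))
       \<and> \<not> (\<forall>n (X :: (nat \<Rightarrow> 'k) set set) e.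
              finite X \<and> X \<subseteq> proj_space n \<and> 1 \<le> e \<and> e < card X \<longrightarrow>
              (\<exists>Y\<subseteq>X. card Y = e \<and> predicted_subset_resolution n X Y))"
proof -
  obtain e and F :: "(nat \<Rightarrow> nat \<Rightarrow> 'k) \<Rightarrow> 'k" and v0 where F: "mhom 6 22 e F" "F v0 \<noteq> 0"
    "\<And>v. F v \<noteq> 0 \<Longrightarrow> general_points v"
    using generic_general_points unfolding generically_def by blast
  obtain f where f: "multihomogeneous 6 22 f" "\<And>v. F v = eval (\<lambda>(j, i). v j i) f"
    "\<And>m. m \<in> Poly_Mapping.keys f \<Longrightarrow> Poly_Mapping.keys m \<subseteq> {..<22} \<times> {..6}"
    using mhom_imp_multihomogeneous[OF F(1)] by blast
  define U where "U = {P \<in> {..<22} \<rightarrow>\<^sub>E proj_space 6. \<not> (\<forall>f\<in>{f}. vanishes_at_tuple 22 f P)}"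
  have "zariski_open_tuples 6 22 U"
    unfolding zariski_open_tuples_def U_def using f(1) by (intro exI[of _ "{f}"]) auto
  moreover have "U \<noteq> {}"
  proof -
    \<comment> \<open>Representatives of points vanish beyond index 6; \<open>F\<close> sees only
      the coordinates up to 6, so the truncation keeps its value.\<close>
    define v where "v = (\<lambda>j i. if i \<le> 6 then v0 j i else 0)"
    define P where "P = restrict (\<lambda>j. {(v, w). \<exists>c. c \<noteq> 0 \<and> w = (\<lambda>i. c * v i)} `` {v j}) {..<22}"
    have "monom_val (\<lambda>(j, i). v j i) m = monom_val (\<lambda>(j, i). v0 j i) m" if "m \<in> Poly_Mapping.keys f" for m
      unfolding monom_val_def using f(3)[OF that] by (intro prod.cong) (auto simp: v_def)
    then have "F v = F v0" by (simp add: f(2) eval_eq)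
    then have Fv: "F v \<noteq> 0" using F(2) by simp
    then have gen: "general_points v" by (rule F(3))
    have "\<exists>i. v j i \<noteq> 0" if j: "j < 22" for j
    proof (rule ccontr)
      assume "\<not> ?thesis"
      then have "pairing 6 x (v j) = 0" for x by (simp add: pairing_def)
      then show False using general_points_separated[OF gen j j] by auto
    qed
    then have "v j \<in> {v. (\<forall>i>6. v i = 0) \<and> (\<exists>i. v i \<noteq> 0)}" if "j < 22" for j
      using that by (simp add: v_def)
    then have "P j \<in> proj_space 6" if "j < 22" for j
      using that unfolding P_def proj_space_def by (simp only: restrict_apply lessThan_iff if_True quotientI)
    then have "P \<in> {..<22} \<rightarrow>\<^sub>E proj_space 6" by (auto simp: P_def)
    moreover have "v j \<in> P j" if "j < 22" for j
      using that by (auto simp: P_def intro: exI[of _ 1])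
    then have "\<not> vanishes_at_tuple 22 f P"
      using Fv unfolding vanishes_at_tuple_def f(2) by blast
    ultimately have "P \<in> U" by (simp add: U_def)
    then show ?thesis by blast
  qed
  moreover have main: "card (P ` {..<22}) = 22 \<and>
      (\<forall>Y\<subseteq>P ` {..<22}. card Y = 11 \<longrightarrow> \<not> predicted_subset_resolution 6 (P ` {..<22}) Y)"
    and sub: "P ` {..<22} \<subseteq> proj_space 6" if "P \<in> U" for P
  proof -
    have P: "P j \<in> proj_space 6" if "j < 22" for j
      using \<open>P \<in> U\<close> that by (auto simp: U_def)
    have "\<not> vanishes_at_tuple 22 f P" using that by (simp add: U_def)
    then obtain v where v: "\<forall>j<22. v j \<in> P j" "F v \<noteq> 0"
      unfolding vanishes_at_tuple_def f(2) by blast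
    have gen: "general_points v" using F(3)[OF v(2)] .
    have vP: "v j \<in> P j" if "j < 22" for j using v(1) that by blast
    have "inj_on P {..<22}" by (rule general_points_inj[OF gen P vP])
    then have "card (P ` {..<22}) = 22" by (simp add: card_image)
    moreover have "\<not> predicted_subset_resolution 6 (P ` {..<22}) Y" if "Y \<subseteq> P ` {..<22}" "card Y = 11" for Y
      by (rule general_points_not_predicted[OF gen P vP that])
    ultimately show "card (P ` {..<22}) = 22 \<and>
      (\<forall>Y\<subseteq>P ` {..<22}. card Y = 11 \<longrightarrow> \<not> predicted_subset_resolution 6 (P ` {..<22}) Y)"
      by blast
    show "P ` {..<22} \<subseteq> proj_space 6" using P by auto
  qed
  moreover have "\<not> (\<forall>n (X :: (nat \<Rightarrow> 'k) set set) e.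
              finite X \<and> X \<subseteq> proj_space n \<and> 1 \<le> e \<and> e < card X \<longrightarrow>
              (\<exists>Y\<subseteq>X. card Y = e \<and> predicted_subset_resolution n X Y))"
  proof
    assume *: "\<forall>n (X :: (nat \<Rightarrow> 'k) set set) e.
              finite X \<and> X \<subseteq> proj_space n \<and> 1 \<le> e \<and> e < card X \<longrightarrow>
              (\<exists>Y\<subseteq>X. card Y = e \<and> predicted_subset_resolution n X Y)"
    \<comment> \<open>Any member of \<open>U\<close> refutes the general claim, with e = 11.\<close>
    obtain P where P: "P \<in> U" using \<open>U \<noteq> {}\<close> by blast
    have "\<exists>Y\<subseteq>P ` {..<22}. card Y = 11 \<and> predicted_subset_resolution 6 (P ` {..<22}) Y"
    proof (rule *[rule_format])
      show "finite (P ` {..<22}) \<and> P ` {..<22} \<subseteq> proj_space 6 \<and> 1 \<le> (11::nat) \<and> 11 < card (P ` {..<22})"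
        using main[OF P] sub[OF P] by simp
    qed
    then show False using main[OF P] by blast
  qed
  ultimately show ?thesis by blast
qed

end
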